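(* Let $\mathfrak T$ be a measurable action of an inductively compact group $G$ on a standard Borel space $(X,\mathcal B)$, and let $\nu$ be a $\sigma$-finite $\mathfrak T$-invariant Borel measure on $X$ such that the space $L_1(X,\nu)$ contains a positive Borel measurable fibrewise continuous function. Then the measure $\nu$ admits an ergodic decomposition.
   Context: A standard Borel space is a pair $(X,\mathcal B)$, $\mathcal B$ a sigma-algebra on $X$, admitting a bijection of $X$ onto the unit interval carrying $\mathcal B$ to the Borel sigma-algebra. An inductively compact group is $G=\bigcup_{n\ge1}K(n)$, where $K(1)\subset K(2)\subset\cdots$ is an ascending chain of metrizable compact groups; $G$ carries the inductive limit topology (a function on $G$ is continuous iff its restriction to every $K(n)$ is continuous) and the Borel sigma-algebra spanned by those of the $K(n)$. A measurable action $\mathfrak T$ of $G$ on $X$ is an action $g\mapsto T_g$ with $(g,x)\mapsto T_gx$ Borel-measurable on $G\times X$. A Borel function $f:X\to\mathbb R$ is fibrewise continuous if for every $x\in X$ the function $g\mapsto f(T_gx)$ is continuous on $G$. $\mathfrak M^\infty(X)$ is the space of $\sigma$-finite (possibly finite) Borel measures on $X$, with the sigma-algebra generated by the sets $\{\nu:\alpha<\nu(A)<\beta\}$, $\alpha,\beta$ real, $A\subset X$ Borel. An ergodic decomposition of a $\mathfrak T$-invariant measure $\nu\in\mathfrak M^\infty(X)$ is a representation $\nu=\int_{\mathfrak M^\infty(X)}\eta\,d\overline\nu(\eta)$, where $\overline\nu$ is a $\sigma$-finite Borel measure on $\mathfrak M^\infty(X)$ and $\overline\nu$-almost every $\eta$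 is $\mathfrak T$-invariant and ergodic (every $G$-invariant Borel set is $\eta$-null or has $\eta$-null complement). The equality means that for every Borel $A\subset X$ with $\nu(A)<+\infty$ the function $\eta\mapsto\eta(A)$ is in $L_1(\mathfrak M^\infty(X),\overline\nu)$ and $\nu(A)=\int\eta(A)\,d\overline\nu(\eta)$. *)

theory Defs
  imports "HOL-Analysis.Analysis" "HOL-Algebra.Group_Action"
begin

text \<open>Only the measurable structure of \<open>X\<close> matters here, not the values of the measure.\<close>

definition standard_borel_space :: "'a measure \<Rightarrow> bool" where
  "standard_borel_space X \<longleftrightarrow>
     (\<exists>f. bij_betw f (space X) {0..1::real} \<and>
          (\<lambda>A. f ` A) ` sets X = sets (restrict_space borel {0..1}))"

definition topological_group :: "('g, 'm) monoid_scheme \<Rightarrow> 'g topology \<Rightarrow> bool" where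
  "topological_group G \<tau> \<longleftrightarrow>
     group G \<and> topspace \<tau> = carrier G \<and>
     continuous_map (prod_topology \<tau> \<tau>) \<tau> (\<lambda>(g, h). g \<otimes>\<^bsub>G\<^esub> h) \<and>
     continuous_map \<tau> \<tau> (\<lambda>g. inv\<^bsub>G\<^esub> g)"

text \<open>The chain consists of topological groups: \<open>K n\<close> is a subgroup of \<open>K (Suc n)\<close>
  and carries the subspace topology. The chain is indexed from \<open>0\<close>.\<close>

locale inductively_compact_group = group G
  for G :: "('g, 'm) monoid_scheme" (structure) +
  fixes K :: "nat \<Rightarrow> 'g set" and \<tau> :: "nat \<Rightarrow> 'g topology"
  assumes subgroup_K: "subgroup (K n) G"
    and topological_group_K: "topological_group (G\<lparr>carrier := K n\<rparr>) (\<tau> n)"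
    and compact_K: "compact_space (\<tau> n)"
    and metrizable_K: "metrizable_space (\<tau> n)"
    and K_mono: "K n \<subseteq> K (Suc n)"
    and subtopology_K: "\<tau> n = subtopology (\<tau> (Suc n)) (K n)"
    and carrier_eq: "carrier G = (\<Union>n. K n)"

definition inductive_limit_topology :: "(nat \<Rightarrow> 'g topology) \<Rightarrow> 'g topology" where
  "inductive_limit_topology \<tau> =
     topology (\<lambda>U. U \<subseteq> (\<Union>n. topspace (\<tau> n)) \<and> (\<forall>n. openin (\<tau> n) (U \<inter> topspace (\<tau> n))))"

lemma openin_inductive_limit_topology:
  "openin (inductive_limit_topology \<tau>) U \<longleftrightarrow>
     U \<subseteq> (\<Union>n. topspace (\<tau> n)) \<and> (\<forall>n. openin (\<tau> n) (U \<inter> topspace (\<tau> n)))"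
proof -
  have "istopology (\<lambda>U. U \<subseteq> (\<Union>n. topspace (\<tau> n)) \<and> (\<forall>n. openin (\<tau> n) (U \<inter> topspace (\<tau> n))))"
    unfolding istopology_def
  proof (intro conjI allI impI)
    fix S T n
    assume "S \<subseteq> (\<Union>n. topspace (\<tau> n)) \<and> (\<forall>n. openin (\<tau> n) (S \<inter> topspace (\<tau> n)))"
      and "T \<subseteq> (\<Union>n. topspace (\<tau> n)) \<and> (\<forall>n. openin (\<tau> n) (T \<inter> topspace (\<tau> n)))"
    then have "openin (\<tau> n) ((S \<inter> topspace (\<tau> n)) \<inter> (T \<inter> topspace (\<tau> n)))"
      by (blast intro: openin_Int)
    then show "openin (\<tau> n) (S \<inter> T \<inter> topspace (\<tau> n))"
      by (simp add: inf_assoc inf_left_commute)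
  next
    fix \<U> n
    assume "\<forall>U\<in>\<U>. U \<subseteq> (\<Union>n. topspace (\<tau> n)) \<and> (\<forall>n. openin (\<tau> n) (U \<inter> topspace (\<tau> n)))"
    then have "openin (\<tau> n) (\<Union>U\<in>\<U>. U \<inter> topspace (\<tau> n))"
      by (blast intro: openin_Union)
    then show "openin (\<tau> n) (\<Union>\<U> \<inter> topspace (\<tau> n))"
      by (simp only: Int_Union2)
  qed blast+
  then show ?thesis
    by (simp add: inductive_limit_topology_def topology_inverse')
qed

lemma (in inductively_compact_group) topspace_K: "topspace (\<tau> n) = K n"
  using topological_group_K[of n] by (simp add: topological_group_def)

lemma (in inductively_compact_group) K_le: "m \<le> n \<Longrightarrow> K m \<subseteq> K n"
  by (rule lift_Suc_mono_le[of K]) (use K_mono in auto)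

lemma (in inductively_compact_group) subtopology_K_le:
  "m \<le> n \<Longrightarrow> \<tau> m = subtopology (\<tau> n) (K m)"
proof (induction n rule: dec_induct)
  case base
  show ?case by (metis topspace_K subtopology_topspace)
next
  case (step n)
  then have "\<tau> m = subtopology (subtopology (\<tau> (Suc n)) (K n)) (K m)"
    using subtopology_K by metis
  also have "\<dots> = subtopology (\<tau> (Suc n)) (K m)"
    using K_le[OF step(1)] by (simp add: subtopology_subtopology Int_absorb1)
  finally show ?case .
qed

lemma (in inductively_compact_group) topspace_inductive_limit:
  "topspace (inductive_limit_topology \<tau>) = carrier G"
proof
  show "topspace (inductive_limit_topology \<tau>) \<subseteq> carrier G"
    using openin_inductive_limit_topology[of \<tau> "topspace (inductive_limit_topology \<tau>)"]
    by (simp add: topspace_K carrier_eq)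
  have "openin (\<tau> n) ((\<Union>n. K n) \<inter> K n)" for n
    by (metis UNIV_I UN_upper inf.absorb2 openin_topspace topspace_K)
  then have "openin (inductive_limit_topology \<tau>) (carrier G)"
    by (simp add: openin_inductive_limit_topology topspace_K carrier_eq)
  then show "carrier G \<subseteq> topspace (inductive_limit_topology \<tau>)"
    by (rule openin_subset)
qed

lemma (in inductively_compact_group) continuous_map_inductive_limit:
  "continuous_map (inductive_limit_topology \<tau>) Y f \<longleftrightarrow> (\<forall>n. continuous_map (\<tau> n) Y f)"
proof -
  have *: "{x \<in> carrier G. f x \<in> U} \<inter> K n = {x \<in> K n. f x \<in> U}" for n U
    by (auto simp: carrier_eq)
  have "{x \<in> carrier G. f x \<in> U} \<subseteq> (\<Union>n. K n)" for U
    by (auto simp: carrier_eq)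
  then show ?thesis
    unfolding continuous_map_def topspace_inductive_limit topspace_K
      openin_inductive_limit_topology *
    by (auto simp: carrier_eq Pi_iff)
qed

definition borel_of :: "'g topology \<Rightarrow> 'g measure" where
  "borel_of \<tau> = sigma (topspace \<tau>) {U. openin \<tau> U}"

definition inductive_limit_borel :: "(nat \<Rightarrow> 'g topology) \<Rightarrow> 'g measure" where
  "inductive_limit_borel \<tau> = sigma (\<Union>n. topspace (\<tau> n)) (\<Union>n. sets (borel_of (\<tau> n)))"

text \<open>\<^const>\<open>group_action\<close> normalises each \<open>T g\<close> to \<open>undefined\<close> outside \<open>space X\<close>.\<close>

definition measurable_action ::
  "('g, 'm) monoid_scheme \<Rightarrow> (nat \<Rightarrow> 'g topology) \<Rightarrow> 'a measure \<Rightarrow> ('g \<Rightarrow> 'a \<Rightarrow> 'a) \<Rightarrow> bool" where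
  "measurable_action G \<tau> X T \<longleftrightarrow>
     group_action G (space X) T \<and>
     (\<lambda>(g, x). T g x) \<in> inductive_limit_borel \<tau> \<Otimes>\<^sub>M X \<rightarrow>\<^sub>M X"

definition fibrewise_continuous ::
  "(nat \<Rightarrow> 'g topology) \<Rightarrow> 'a measure \<Rightarrow> ('g \<Rightarrow> 'a \<Rightarrow> 'a) \<Rightarrow> ('a \<Rightarrow> real) \<Rightarrow> bool" where
  "fibrewise_continuous \<tau> X T f \<longleftrightarrow>
     (\<forall>x\<in>space X. continuous_map (inductive_limit_topology \<tau>) euclideanreal (\<lambda>g. f (T g x)))"

definition invariant_measure ::
  "('g, 'm) monoid_scheme \<Rightarrow> ('g \<Rightarrow> 'a \<Rightarrow> 'a) \<Rightarrow> 'a measure \<Rightarrow> bool" where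
  "invariant_measure G T \<eta> \<longleftrightarrow> (\<forall>g\<in>carrier G. distr \<eta> \<eta> (T g) = \<eta>)"

definition ergodic_measure ::
  "('g, 'm) monoid_scheme \<Rightarrow> ('g \<Rightarrow> 'a \<Rightarrow> 'a) \<Rightarrow> 'a measure \<Rightarrow> bool" where
  "ergodic_measure G T \<eta> \<longleftrightarrow>
     (\<forall>A\<in>sets \<eta>. (\<forall>g\<in>carrier G. T g ` A = A) \<longrightarrow>
        emeasure \<eta> A = 0 \<or> emeasure \<eta> (space \<eta> - A) = 0)"

definition sigma_finite_measures :: "'a measure \<Rightarrow> 'a measure set" where
  "sigma_finite_measures X = {\<eta>. sets \<eta> = sets X \<and> sigma_finite_measure \<eta>}"

definition sigma_finite_algebra :: "'a measure \<Rightarrow> 'a measure measure" where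
  "sigma_finite_algebra X =
     sigma (sigma_finite_measures X)
       {{\<eta> \<in> sigma_finite_measures X.
           ereal \<alpha> < enn2ereal (emeasure \<eta> A) \<and> enn2ereal (emeasure \<eta> A) < ereal \<beta>} |
        \<alpha> \<beta> A. A \<in> sets X}"

text \<open>Since \<open>\<eta> A\<close> may be infinite for a \<open>\<nu>'\<close>-null set of \<open>\<eta>\<close>, membership of \<open>\<eta> \<mapsto> \<eta> A\<close> in \<open>L\<^sub>1\<close> is
  expressed by measurability and finiteness of the nonnegative integral of \<open>emeasure \<eta> A\<close>;
  the real-valued \<open>measure \<eta> A\<close> would silently replace infinite values by \<open>0\<close>.\<close>

definition ergodic_decomposition ::
  "('g, 'm) monoid_scheme \<Rightarrow> 'a measure \<Rightarrow> ('g \<Rightarrow> 'a \<Rightarrow> 'a) \<Rightarrow> 'a measure \<Rightarrow> 'a measure measure \<Rightarrow> bool"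
where
  "ergodic_decomposition G X T \<nu> \<nu>' \<longleftrightarrow>
     sets \<nu>' = sets (sigma_finite_algebra X) \<and> sigma_finite_measure \<nu>' \<and>
     (AE \<eta> in \<nu>'. invariant_measure G T \<eta> \<and> ergodic_measure G T \<eta>) \<and>
     (\<forall>A\<in>sets X. emeasure \<nu> A < \<infinity> \<longrightarrow>
        (\<lambda>\<eta>. emeasure \<eta> A) \<in> borel_measurable \<nu>' \<and>
        (\<integral>\<^sup>+ \<eta>. emeasure \<eta> A \<partial>\<nu>') < \<infinity> \<and>
        emeasure \<nu> A = (\<integral>\<^sup>+ \<eta>. emeasure \<eta> A \<partial>\<nu>'))"

end

(*
Fix a positive fibrewise continuous f in L1(nu) and pass from nu to the probability measure
P = f nu, suitably normalised. Averaging over the Haar measure of K(n) with weight f gives the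
probability kernels A(n, x) = (law of T_g x, g Haar on K(n)), reweighted by f; continuity of f along
the orbits and compactness of K(n) make the normalising constant positive and finite. A measure eta
is K(n)-invariant for all n iff f eta is stationary under all the A(n), i.e. a Gibbs measure of the
specification (A(n)). So the theorem becomes the decomposition of a Gibbs measure into Gibbs measures
that are trivial on the tail sigma-algebra: A(n, x) converges P-almost everywhere along a subsequence
to a regular conditional distribution of P given the tail, whose values are almost surely
Gibbs and tail-trivial. Dividing by f again turns them into sigma-finite invariant ergodic measures.
*)

theory Submission
  imports Defs "HOL-Probability.Probability"
begin

section \<open>Haar measure on compact metrizable groups\<close>

text \<open>Invariance under \<open>G\<close> consists of uncountably many conditions, and the
  measures sought are only sigma-finite. After weighting by \<open>f\<close>, both are replaced by
  stationarity of probability measures under countably many kernels, tested on a countable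
  pi-system, which is a measurable condition. Convergence is Hilbert space geometry: under a Gibbs
  measure the increments of \<open>A n y C\<close> are orthogonal in L2, so the norms decrease, the
  functions are Cauchy, and a subsequence depending on \<open>C\<close> converges almost everywhere.
  The limits for the pi-system are glued to a kernel \<open>\<kappa>\<close>. For almost every
  \<open>x\<close> the limits are constant \<open>\<kappa> x\<close>-almost everywhere, which makes
  tail sets independent of themselves. Ergodicity concerns strictly invariant sets, and these belong
  to the tail, so tail triviality applies to them directly. Haar measure is used on both sides:
  right invariance makes the kernels constant on \<open>K n\<close>-orbits, left invariance and the
  resulting invariance under inversion translate between invariance and stationarity.\<close>

text \<open>Total boundedness supplies a finite net at every scale, and the balls of radius
  \<open>1 / Suc n\<close> around the nets form the base. Its enumeration serves twice: as positions
  of digits in a real code, and as atoms of a discrete measure with dense support.\<close>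

lemma compact_metrizable_countable_base:
  assumes "compact_space \<tau>" "metrizable_space \<tau>"
  obtains U :: "nat \<Rightarrow> 'g set" where "\<And>j. openin \<tau> (U j)"
    "\<And>V x. openin \<tau> V \<Longrightarrow> x \<in> V \<Longrightarrow> \<exists>j. x \<in> U j \<and> U j \<subseteq> V"
proof -
  obtain M d where "Metric_space M d" and \<tau>: "\<tau> = Metric_space.mtopology M d"
    using assms(2) by (auto simp: metrizable_space_def)
  interpret Metric_space M d by fact
  have "mtotally_bounded M"
    using assms(1) unfolding \<tau> compact_space_eq_mcomplete_mtotally_bounded by simp
  then have "\<exists>K. finite K \<and> M \<subseteq> (\<Union>x\<in>K. mball x (1 / Suc n))" for n
    unfolding mtotally_bounded_def by (elim allE[of _ "1 / Suc n"]) auto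
  then have "\<exists>K. \<forall>n. finite (K n) \<and> M \<subseteq> (\<Union>x\<in>K n. mball x (1 / Suc n))"
    by (intro choice allI)
  then obtain K where K: "\<And>n. finite (K n)" "\<And>n. M \<subseteq> (\<Union>x\<in>K n. mball x (1 / Suc n))"
    by blast
  \<comment> \<open>The empty set keeps \<open>B\<close> nonempty even over an empty space, as
    \<open>from_nat_into\<close> requires.\<close>
  define B where "B = insert {} (\<Union>n. (\<lambda>x. mball x (1 / Suc n)) ` K n)"
  have B: "countable B" "B \<noteq> {}"
    using K(1) by (auto simp: B_def countable_finite)
  show ?thesis
  proof (rule that[of "from_nat_into B"])
    show "openin \<tau> (from_nat_into B j)" for j
      using from_nat_into[OF B(2), of j] by (auto simp: B_def \<tau>)
    fix V x assume V: "openin \<tau> V" "x \<in> V"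
    then obtain r where r: "0 < r" "mball x r \<subseteq> V" "x \<in> M"
      unfolding \<tau> openin_mtopology by blast
    \<comment> \<open>A ball of this radius that contains \<open>x\<close> has diameter below
      \<open>r\<close> and so stays inside \<open>mball x r\<close>.\<close>
    obtain n where n: "1 / Suc n < r / 2"
      using r(1) nat_approx_posE[of "r / 2"] by auto
    obtain c where c: "c \<in> K n" "x \<in> mball c (1 / Suc n)"
      using K(2)[of n] r(3) by auto
    have "mball c (1 / Suc n) \<subseteq> mball x r"
    proof
      fix y assume y: "y \<in> mball c (1 / Suc n)"
      then have "d x y \<le> d c x + d c y"
        using c(2) triangle[of x c y] by (auto simp: commute)
      then show "y \<in> mball x r"
        using y c n by auto
    qed
    then have "mball c (1 / Suc n) \<subseteq> V" using r(2) by (rule subset_trans)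
    moreover have "mball c (1 / Suc n) \<in> B"
      using c(1) unfolding B_def by blast
    then obtain j where "from_nat_into B j = mball c (1 / Suc n)"
      using from_nat_into_surj[OF B(1)] by blast
    ultimately show "\<exists>j. x \<in> from_nat_into B j \<and> from_nat_into B j \<subseteq> V"
      using c(2) by (intro exI[of _ j]) simp
  qed
qed

text \<open>The first differing digit contributes \<open>(1/4)^k\<close>, all later ones together at
  most a third of that. Using only the digits 0 and 1 in base 4 leaves this gap; in base 2 the later
  digits could cancel the first.\<close>

lemma digit_separation:
  fixes a b :: "nat \<Rightarrow> real"
  assumes a: "\<And>i. a i = 0 \<or> a i = 1" and b: "\<And>i. b i = 0 \<or> b i = 1" and "a j \<noteq> b j"
  shows "(1/4)^j / 2 \<le> \<bar>(\<Sum>i. a i * (1/4)^i) - (\<Sum>i. b i * (1/4)^i)\<bar>"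
proof -
  define k where "k = (LEAST i. a i \<noteq> b i)"
  have k: "a k \<noteq> b k" "k \<le> j" and below: "\<And>i. i < k \<Longrightarrow> a i = b i"
    unfolding k_def using LeastI[of "\<lambda>i. a i \<noteq> b i" j] Least_le[of "\<lambda>i. a i \<noteq> b i" j]
      not_less_Least[of _ "\<lambda>i. a i \<noteq> b i"] assms(3) by blast+
  define f where "f i = (a i - b i) * (1/4)^i" for i
  have geo: "summable (\<lambda>i. (1/4)^i :: real)" by simp
  have sa: "summable (\<lambda>i. a i * (1/4)^i)"
  proof (rule summable_comparison_test'[OF geo, of 0])
    show "norm (a i * (1/4)^i) \<le> (1/4)^i" for i using a[of i] by auto
  qed
  have sb: "summable (\<lambda>i. b i * (1/4)^i)"
  proof (rule summable_comparison_test'[OF geo, of 0])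
    show "norm (b i * (1/4)^i) \<le> (1/4)^i" for i using b[of i] by auto
  qed
  have sf: "summable f"
    unfolding f_def using summable_diff[OF sa sb] by (simp add: algebra_simps)
  have f_le: "\<bar>f i\<bar> \<le> (1/4)^i" for i
    using a[of i] b[of i] by (auto simp: f_def)
  have "(\<Sum>i. a i * (1/4)^i) - (\<Sum>i. b i * (1/4)^i) = suminf f"
    unfolding f_def using suminf_diff[OF sa sb] by (simp add: algebra_simps)
  also have "\<dots> = (\<Sum>i. f (i + Suc k)) + (\<Sum>i<Suc k. f i)"
    by (rule suminf_split_initial_segment[OF sf])
  also have "(\<Sum>i<Suc k. f i) = f k"
    using below by (simp add: f_def)
  finally have eq: "(\<Sum>i. a i * (1/4)^i) - (\<Sum>i. b i * (1/4)^i) = (\<Sum>i. f (i + Suc k)) + f k" .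
  have "\<bar>\<Sum>i. f (i + Suc k)\<bar> \<le> (\<Sum>i. (1/4)^Suc k * (1/4)^i)"
  proof -
    have s: "summable (\<lambda>i. (1/4)^Suc k * (1/4)^i :: real)" by (intro summable_mult geo)
    have le: "\<bar>f (i + Suc k)\<bar> \<le> (1/4)^Suc k * (1/4)^i" for i
      using f_le[of "i + Suc k"] by (simp add: power_add mult.commute)
    have "\<bar>\<Sum>i. f (i + Suc k)\<bar> \<le> (\<Sum>i. \<bar>f (i + Suc k)\<bar>)"
      using summable_comparison_test'[OF s, of 0 "\<lambda>i. \<bar>f (i + Suc k)\<bar>"] le by (intro summable_rabs) simp
    also have "\<dots> \<le> (\<Sum>i. (1/4)^Suc k * (1/4)^i)"
      using summable_comparison_test'[OF s, of 0 "\<lambda>i. \<bar>f (i + Suc k)\<bar>"] le s by (intro suminf_le) simp_all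
    finally show ?thesis .
  qed
  also have "\<dots> = (1/4)^k / 3"
    by (subst suminf_mult[OF geo]) (simp add: suminf_geometric)
  finally have "\<bar>\<Sum>i. f (i + Suc k)\<bar> \<le> (1/4)^k / 3" .
  moreover have "\<bar>f k\<bar> = (1/4)^k"
    using k(1) a[of k] b[of k] by (auto simp: f_def)
  moreover have "(1/4)^j \<le> ((1/4)^k :: real)"
    using k(2) by (intro power_decreasing) auto
  moreover have "0 < ((1/4)^k :: real)" by simp
  ultimately show ?thesis
    unfolding eq by linarith
qed

section \<open>Borel sets of an abstract topology and real codes of compact metrizable
  spaces\<close>

lemma space_borel_of [simp]: "space (borel_of \<tau>) = topspace \<tau>"
  unfolding borel_of_def by (rule space_measure_of) (auto dest: openin_subset)

lemma sets_borel_of: "sets (borel_of \<tau>) = sigma_sets (topspace \<tau>) {U. openin \<tau> U}"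
  unfolding borel_of_def by (rule sets_measure_of) (auto dest: openin_subset)

lemma openin_borel_of: "openin \<tau> U \<Longrightarrow> U \<in> sets (borel_of \<tau>)"
  by (auto simp: sets_borel_of)

lemma closedin_borel_of: "closedin \<tau> F \<Longrightarrow> F \<in> sets (borel_of \<tau>)"
  using sets.compl_sets[OF openin_borel_of, of \<tau> "topspace \<tau> - F"]
  by (simp add: closedin_def Diff_Diff_Int Int_absorb1)

lemma measurable_borel_ofI:
  assumes "f \<in> space M \<rightarrow> topspace \<tau>" "\<And>U. openin \<tau> U \<Longrightarrow> f -` U \<inter> space M \<in> sets M"
  shows "f \<in> M \<rightarrow>\<^sub>M borel_of \<tau>"
  unfolding borel_of_def using assms by (intro measurable_measure_of) (auto dest: openin_subset)

lemma continuous_map_measurable_borel_of: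
  assumes "continuous_map \<tau> \<sigma> f"
  shows "f \<in> borel_of \<tau> \<rightarrow>\<^sub>M borel_of \<sigma>"
proof (rule measurable_borel_ofI)
  show "f \<in> space (borel_of \<tau>) \<rightarrow> topspace \<sigma>"
    using assms by (simp add: continuous_map_def)
  fix U assume "openin \<sigma> U"
  then have "openin \<tau> {x\<in>topspace \<tau>. f x \<in> U}"
    using assms by (simp add: continuous_map_def)
  moreover have "f -` U \<inter> space (borel_of \<tau>) = {x\<in>topspace \<tau>. f x \<in> U}" by auto
  ultimately show "f -` U \<inter> space (borel_of \<tau>) \<in> sets (borel_of \<tau>)"
    by (simp add: openin_borel_of)
qed

lemma continuous_map_borel_measurable:
  assumes "continuous_map \<tau> euclideanreal f"
  shows "f \<in> borel_measurable (borel_of \<tau>)"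
proof (rule borel_measurableI)
  fix S :: "real set" assume "open S"
  then have "openin \<tau> {x\<in>topspace \<tau>. f x \<in> S}"
    using assms by (simp add: continuous_map_def)
  moreover have "f -` S \<inter> space (borel_of \<tau>) = {x\<in>topspace \<tau>. f x \<in> S}" by auto
  ultimately show "f -` S \<inter> space (borel_of \<tau>) \<in> sets (borel_of \<tau>)"
    by (simp add: openin_borel_of)
qed

lemma continuous_map_compact_bounded:
  assumes "compact_space \<tau>" "continuous_map \<tau> euclideanreal \<psi>"
  obtains B where "0 \<le> B" "\<And>x. x \<in> topspace \<tau> \<Longrightarrow> \<bar>\<psi> x\<bar> \<le> B"
proof -
  have "compact (\<psi> ` topspace \<tau>)"
    using image_compactin[OF _ assms(2), of "topspace \<tau>"] assms(1) by (simp add: compact_space_def)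
  then obtain B where "\<And>y. y \<in> \<psi> ` topspace \<tau> \<Longrightarrow> \<bar>y\<bar> \<le> B"
    using compact_imp_bounded[of "\<psi> ` topspace \<tau>"] by (auto simp: bounded_iff)
  then show ?thesis
    by (intro that[of "max 0 B"]) (auto simp: le_max_iff_disj)
qed

text \<open>Parametrises the compact space by a compact set of reals, so that Helly selection on the line yields weakly convergent subsequences of measures on the space.\<close>

lemma real_code:
  fixes \<tau> :: "'g topology"
  assumes comp: "compact_space \<tau>" and metr: "metrizable_space \<tau>" and ne: "topspace \<tau> \<noteq> {}"
  obtains s :: "'g \<Rightarrow> real" and C c where "compact C" "continuous_map (top_of_set C) \<tau> c"
    "\<And>x. x \<in> topspace \<tau> \<Longrightarrow> s x \<in> C \<and> c (s x) = x" "C \<noteq> {}"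
proof -
  obtain U :: "nat \<Rightarrow> 'g set" where U: "\<And>j. openin \<tau> (U j)" and base: "\<And>V x. openin \<tau> V \<Longrightarrow> x \<in> V \<Longrightarrow> \<exists>j. x \<in> U j \<and> U j \<subseteq> V"
    using compact_metrizable_countable_base[OF comp metr] by blast
  have haus: "Hausdorff_space \<tau>" by (rule metrizable_imp_Hausdorff_space[OF metr])
  define s where "s x = (\<Sum>i. (if x \<in> U i then 1 else 0) * (1/4)^i :: real)" for x
  have sep: "(1/4)^j / 2 \<le> \<bar>s x - s y\<bar>" if "x \<in> U j" "y \<notin> U j" for x y j
    unfolding s_def by (rule digit_separation) (use that in auto)
  have s_range: "s x \<in> {0..4/3}" for x
  proof -
    have geo: "summable (\<lambda>i. (1/4)^i :: real)" by simp
    have sm: "summable (\<lambda>i. (if x \<in> U i then 1 else 0) * (1/4)^i :: real)"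
      by (rule summable_comparison_test'[OF geo, of 0]) auto
    have "s x \<le> (\<Sum>i. (1/4)^i)" unfolding s_def
      by (rule suminf_le[OF _ sm geo]) auto
    moreover have "0 \<le> s x" unfolding s_def by (rule suminf_nonneg[OF sm]) auto
    ultimately show ?thesis by (simp add: suminf_geometric)
  qed
  let ?T = "prod_topology euclideanreal \<tau>"
  \<comment> \<open>The code \<open>s\<close> has the membership in \<open>U i\<close> as its digit
    \<open>i\<close>; it jumps, so its graph need not be closed. The closure is compact, and the
    gaps between codes keep it the graph of a function from codes back to points.\<close>
  define \<Gamma> where "\<Gamma> = Abstract_Topology.closure_of ?T ((\<lambda>x. (s x, x)) ` topspace \<tau>)"
  have inj: "x = y" if x: "(t, x) \<in> \<Gamma>" and y: "(t, y) \<in> \<Gamma>" for t x y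
  proof (rule ccontr)
    assume "x \<noteq> y"
    have xy: "x \<in> topspace \<tau>" "y \<in> topspace \<tau>"
      using x y by (auto simp: \<Gamma>_def in_closure_of)
    then obtain V V' where V: "openin \<tau> V" "openin \<tau> V'" "x \<in> V" "y \<in> V'" "disjnt V V'"
      using haus \<open>x \<noteq> y\<close> unfolding Hausdorff_space_def by blast
    then obtain j where j: "x \<in> U j" "U j \<subseteq> V" using base by blast
    \<comment> \<open>Two codes in this ball differ by less than \<open>(1/4)^j / 2\<close>, which
      \<open>sep\<close> forbids when exactly one of the points lies in \<open>U j\<close>.\<close>
    let ?B = "ball t ((1/4)^j / 4)"
    have meets: "\<exists>z\<in>topspace \<tau>. s z \<in> ?B \<and> z \<in> W" if "openin \<tau> W" "w \<in> W" and w: "(t, w) \<in> \<Gamma>" for w W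
    proof -
      have "openin ?T (?B \<times> W)" "(t, w) \<in> ?B \<times> W"
        using that by (auto simp: openin_prod_Times_iff)
      then obtain z where "z \<in> (\<lambda>x. (s x, x)) ` topspace \<tau>" "z \<in> ?B \<times> W"
        using w unfolding \<Gamma>_def in_closure_of by metis
      then show ?thesis by auto
    qed
    obtain x' where x': "s x' \<in> ?B" "x' \<in> U j" using meets[OF U j(1) x] by blast
    obtain y' where y': "s y' \<in> ?B" "y' \<in> V'" using meets[OF V(2,4) y] by blast
    have "y' \<notin> U j" using y' j V by (auto simp: disjnt_iff)
    then have "(1/4)^j / 2 \<le> \<bar>s x' - s y'\<bar>" by (rule sep[OF x'(2)])
    moreover have "\<bar>t - s x'\<bar> < (1/4)^j / 4" "\<bar>t - s y'\<bar> < (1/4)^j / 4"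
      using x' y' by (simp_all add: dist_real_def)
    ultimately show False by linarith
  qed
  have "\<Gamma> \<subseteq> {0..4/3} \<times> topspace \<tau>"
  proof -
    have "closedin ?T ({0..4/3} \<times> topspace \<tau>)"
      by (simp add: closedin_prod_Times_iff)
    then show ?thesis
      unfolding \<Gamma>_def using s_range by (intro closure_of_minimal) auto
  qed
  moreover have "compactin ?T ({0..4/3} \<times> topspace \<tau>)"
    using comp by (simp add: compactin_Times compact_space_def)
  ultimately have \<Gamma>_comp: "compactin ?T \<Gamma>"
    unfolding \<Gamma>_def by (metis closed_compactin closedin_closure_of)
  have \<Gamma>_s: "(s x, x) \<in> \<Gamma>" if "x \<in> topspace \<tau>" for x
    unfolding \<Gamma>_def using that closure_of_subset[of "(\<lambda>x. (s x, x)) ` topspace \<tau>" ?T] by auto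
  define C where "C = fst ` \<Gamma>"
  have fst_comp: "compact (fst ` S)" if "compactin ?T S" for S
    using image_compactin[OF that continuous_map_fst] by simp
  have C: "compact C" unfolding C_def using \<Gamma>_comp by (rule fst_comp)
  define c where "c t = (THE x. (t, x) \<in> \<Gamma>)" for t
  have c: "c t = x" if "(t, x) \<in> \<Gamma>" for t x
    unfolding c_def using that inj by blast
  have \<Gamma>_c: "(t, c t) \<in> \<Gamma>" if "t \<in> C" for t
    using that c by (auto simp: C_def)
  have "continuous_map (top_of_set C) \<tau> c"
    unfolding continuous_map_closedin
  proof (intro conjI allI impI)
    show "c \<in> topspace (top_of_set C) \<rightarrow> topspace \<tau>"
      using \<Gamma>_c by (auto simp: \<Gamma>_def in_closure_of)
    \<comment> \<open>The preimage of a closed set is the projection of a compact slice of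
      \<open>\<Gamma>\<close>.\<close>
    fix F assume F: "closedin \<tau> F"
    have "closedin ?T (UNIV \<times> F)"
      using F by (auto simp: closedin_prod_Times_iff)
    then have "compact (fst ` (\<Gamma> \<inter> UNIV \<times> F))"
      by (intro fst_comp compact_Int_closedin \<Gamma>_comp)
    moreover have "fst ` (\<Gamma> \<inter> UNIV \<times> F) = {t \<in> topspace (top_of_set C). c t \<in> F}"
    proof (intro antisym subsetI)
      fix t assume "t \<in> {t \<in> topspace (top_of_set C). c t \<in> F}"
      then have "(t, c t) \<in> \<Gamma> \<inter> UNIV \<times> F" using \<Gamma>_c by auto
      then show "t \<in> fst ` (\<Gamma> \<inter> UNIV \<times> F)" by (rule image_eqI[rotated]) simp
    qed (auto simp: C_def c intro: rev_image_eqI)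
    ultimately show "closedin (top_of_set C) {t \<in> topspace (top_of_set C). c t \<in> F}"
      using compact_imp_closed closed_subset[of "{t \<in> topspace (top_of_set C). c t \<in> F}" C] by auto
  qed
  moreover have "s x \<in> C \<and> c (s x) = x" if "x \<in> topspace \<tau>" for x
    using \<Gamma>_s[OF that] c by (auto simp: C_def intro: rev_image_eqI)
  moreover have "C \<noteq> {}"
  proof -
    obtain x where "x \<in> topspace \<tau>" using ne by blast
    then show ?thesis using \<Gamma>_s by (auto simp: C_def)
  qed
  ultimately show ?thesis
    using C by (intro that[of C c s])
qed

section \<open>Weak limits, and measures determined by continuous functions\<close>

text \<open>The laws of the codes live in one compact set, so they are tight; a weak limit on the
  line is carried back by \<open>c\<close>. For a \<open>pmf\<close> every function is measurable,
  in particular the discontinuous code \<open>s\<close>.\<close>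

lemma weak_limit_compact_metrizable:
  fixes p :: "nat \<Rightarrow> 'g pmf"
  assumes comp: "compact_space \<tau>" and metr: "metrizable_space \<tau>"
    and supp: "\<And>n. set_pmf (p n) \<subseteq> topspace \<tau>"
  obtains r m where "strict_mono (r :: nat \<Rightarrow> nat)" "prob_space m" "sets m = sets (borel_of \<tau>)"
    "\<And>\<psi>. continuous_map \<tau> euclideanreal \<psi> \<Longrightarrow>
      (\<lambda>n. measure_pmf.expectation (p (r n)) \<psi>) \<longlonglongrightarrow> (\<integral>x. \<psi> x \<partial>m)"
proof -
  have ne: "topspace \<tau> \<noteq> {}" using supp[of 0] set_pmf_not_empty[of "p 0"] by auto
  obtain s :: "'g \<Rightarrow> real" and C c where C: "compact C" "C \<noteq> {}" and c: "continuous_map (top_of_set C) \<tau> c"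
    and s: "\<And>x. x \<in> topspace \<tau> \<Longrightarrow> s x \<in> C \<and> c (s x) = x"
    using real_code[OF comp metr ne] by metis
  define \<mu> where "\<mu> n = distr (measure_pmf (p n)) borel s" for n
  have \<mu>: "real_distribution (\<mu> n)" for n
    unfolding \<mu>_def by (rule prob_space.real_distribution_distr[OF prob_space_measure_pmf]) simp
  have AE_C: "AE x in measure_pmf (p n). s x \<in> C" for n
    using supp[of n] s by (auto simp: AE_measure_pmf_iff)
  obtain b where b: "\<And>t. t \<in> C \<Longrightarrow> \<bar>t\<bar> \<le> b" "0 < b"
    using compact_imp_bounded[OF C(1)] by (auto simp: bounded_pos)
  have "tight \<mu>"
    unfolding tight_def
  proof (intro conjI allI impI \<mu>)
    fix e :: real assume "0 < e"
    \<comment> \<open>The interval is open on the left, so its left end is moved below the possible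
      code \<open>- b\<close>.\<close>
    have "measure (\<mu> n) {- b - 1<..b} = 1" for n
    proof -
      have "AE x in measure_pmf (p n). s x \<in> {- b - 1<..b}"
        using AE_C by eventually_elim (use b in force)
      then show ?thesis
        unfolding \<mu>_def by (subst measure_distr) (auto intro!: measure_pmf.prob_eq_1[THEN iffD2])
    qed
    then show "\<exists>a b. a < b \<and> (\<forall>n. 1 - e < measure (\<mu> n) {a<..b})"
      using b(2) \<open>0 < e\<close> by (intro exI[of _ "- b - 1"] exI[of _ b]) auto
  qed
  from tight_imp_convergent_subsubsequence[OF this strict_mono_id] obtain r M
    where r: "strict_mono (r :: nat \<Rightarrow> nat)" and M: "real_distribution M" and lim: "weak_conv_m (\<lambda>n. \<mu> (r n)) M"
    by (auto simp: comp_def)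
  interpret M: real_distribution M by (rule M)
  have conv: "(\<lambda>n. measure_pmf.expectation (p (r n)) (\<lambda>x. f (s x))) \<longlonglongrightarrow> (\<integral>t. f t \<partial>M)"
    if f: "continuous_on UNIV f" "\<And>t. \<bar>f t\<bar> \<le> B" for f :: "real \<Rightarrow> real" and B
  proof -
    have [measurable]: "f \<in> borel_measurable borel" using f(1) by (rule borel_measurable_continuous_onI)
    have "(\<lambda>n. \<integral>t. f t \<partial>\<mu> (r n)) \<longlonglongrightarrow> (\<integral>t. f t \<partial>M)"
      using f by (intro weak_conv_imp_integral_bdd_continuous_conv[OF \<mu> M lim]) (auto simp: continuous_on_eq_continuous_at)
    then show ?thesis
      unfolding \<mu>_def by (simp add: integral_distr)
  qed
  have "AE t in M. t \<in> C"
  proof -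
    \<comment> \<open>The truncated distance to \<open>C\<close> is a bounded continuous test
      function that vanishes on all codes, so its integral vanishes in the limit.\<close>
    let ?f = "\<lambda>t. min 1 (infdist t C)"
    have cf: "continuous_on UNIV ?f" by (intro continuous_intros)
    have [measurable]: "?f \<in> borel_measurable borel" using cf by (rule borel_measurable_continuous_onI)
    have f01: "\<bar>?f t\<bar> \<le> 1" for t using infdist_nonneg[of t C] by auto
    have "measure_pmf.expectation (p (r n)) (\<lambda>x. ?f (s x)) = 0" for n
      using AE_C[of "r n"] by (subst integral_cong_AE[where g="\<lambda>_. 0"]) (auto elim!: eventually_mono)
    then have "(\<integral>t. ?f t \<partial>M) = 0"
      using conv[OF cf f01] by (simp add: LIMSEQ_const_iff)
    moreover have "integrable M ?f"
      using f01 by (intro M.integrable_const_bound[where B=1]) auto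
    ultimately have "AE t in M. ?f t = 0"
      by (subst (asm) integral_nonneg_eq_0_iff_AE) (auto simp: infdist_nonneg)
    then show ?thesis
    proof eventually_elim
      case (elim t)
      then have "infdist t C = 0" by (auto simp: min_def split: if_splits)
      then show ?case
        using in_closed_iff_infdist_zero[OF compact_imp_closed[OF C(1)] C(2)] by simp
    qed
  qed
  note AE_M = this
  obtain x0 where x0: "x0 \<in> topspace \<tau>" using ne by blast
  \<comment> \<open>The value off \<open>C\<close>, an \<open>M\<close>-null set, is arbitrary; it
    only makes the map total.\<close>
  define c' where "c' t = (if t \<in> C then c t else x0)" for t
  have c': "c' \<in> M \<rightarrow>\<^sub>M borel_of \<tau>"
  proof (rule measurable_borel_ofI)
    show "c' \<in> space M \<rightarrow> topspace \<tau>"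
      using c x0 by (auto simp: c'_def continuous_map_def)
    fix U assume "openin \<tau> U"
    then have "openin (top_of_set C) {t\<in>C. c t \<in> U}"
      using c by (simp add: continuous_map_def)
    then obtain T where T: "open T" "{t\<in>C. c t \<in> U} = T \<inter> C"
      by (auto simp: openin_open Int_commute)
    have "c' -` U \<inter> space M = T \<inter> C \<union> (if x0 \<in> U then - C else {})"
      unfolding T(2)[symmetric] by (auto simp: c'_def split: if_splits)
    moreover have "T \<in> sets borel" "C \<in> sets borel"
      using T(1) compact_imp_closed[OF C(1)] by auto
    ultimately show "c' -` U \<inter> space M \<in> sets M" by auto
  qed
  define m where "m = distr M (borel_of \<tau>) c'"
  have "(\<lambda>n. measure_pmf.expectation (p (r n)) \<psi>) \<longlonglongrightarrow> (\<integral>x. \<psi> x \<partial>m)"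
    if \<psi>: "continuous_map \<tau> euclideanreal \<psi>" for \<psi>
  proof -
    obtain B where B: "0 \<le> B" "\<And>x. x \<in> topspace \<tau> \<Longrightarrow> \<bar>\<psi> x\<bar> \<le> B"
      using continuous_map_compact_bounded[OF comp \<psi>] by blast
    \<comment> \<open>The composition lives on \<open>C\<close> only; a Tietze extension with the
      same bound makes weak convergence on the line applicable.\<close>
    have "continuous_map (top_of_set C) euclideanreal (\<psi> \<circ> c)"
      by (rule continuous_map_compose[OF c \<psi>])
    then have "continuous_on C (\<lambda>t. \<psi> (c t))" by (simp add: comp_def)
    moreover have "c t \<in> topspace \<tau>" if "t \<in> C" for t
      using c that by (auto simp: continuous_map_def)
    ultimately obtain f where f: "continuous_on UNIV f" "\<And>t. t \<in> C \<Longrightarrow> f t = \<psi> (c t)" "\<And>t. \<bar>f t\<bar> \<le> B"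
      using Tietze[of C "\<lambda>t. \<psi> (c t)" UNIV B] B compact_imp_closed[OF C(1)] by auto
    have "measure_pmf.expectation (p (r n)) \<psi> = measure_pmf.expectation (p (r n)) (\<lambda>x. f (s x))" for n
      using supp[of "r n"] f(2) s by (intro integral_cong_AE) (auto simp: AE_measure_pmf_iff subset_eq)
    moreover have "(\<integral>x. \<psi> x \<partial>m) = (\<integral>t. f t \<partial>M)"
    proof -
      have [measurable]: "f \<in> borel_measurable borel" using f(1) by (rule borel_measurable_continuous_onI)
      note \<psi>m = continuous_map_borel_measurable[OF \<psi>]
      have "(\<integral>x. \<psi> x \<partial>m) = (\<integral>t. \<psi> (c' t) \<partial>M)"
        unfolding m_def by (rule integral_distr[OF c' \<psi>m])
      also have "\<dots> = (\<integral>t. f t \<partial>M)"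
        using AE_M measurable_compose[OF c' \<psi>m]
        by (intro integral_cong_AE) (auto elim!: eventually_mono simp: f(2) c'_def)
      finally show ?thesis .
    qed
    ultimately show ?thesis
      using conv[OF f(1,3)] by simp
  qed
  then show ?thesis
    using r c' by (intro that[of r m]) (auto simp: m_def intro: M.prob_space_distr)
qed

text \<open>A closed set is a decreasing intersection of open sets \<open>V n\<close>. A Urysohn
  function between \<open>F\<close> and \<open>V n\<close> bounds the \<open>M\<close>-mass of
  \<open>F\<close> by the \<open>N\<close>-mass of \<open>V n\<close>, hence in the limit by that of
  \<open>F\<close>. By symmetry the measures agree on the closed sets, an intersection-stable
  generator.\<close>

lemma prob_eq_of_continuous_integrals:
  assumes metr: "metrizable_space \<tau>" and "prob_space M" "prob_space N"
    and sets: "sets M = sets (borel_of \<tau>)" "sets N = sets (borel_of \<tau>)"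
    and eq: "\<And>\<psi>. continuous_map \<tau> euclideanreal \<psi> \<Longrightarrow> (\<integral>x. \<psi> x \<partial>M) = (\<integral>x. \<psi> x \<partial>N)"
  shows "M = N"
proof -
  have le: "measure M F \<le> measure N F"
    if "prob_space M" "prob_space N" and sM: "sets M = sets (borel_of \<tau>)" and sN: "sets N = sets (borel_of \<tau>)"
      and eq: "\<And>\<psi>. continuous_map \<tau> euclideanreal \<psi> \<Longrightarrow> (\<integral>x. \<psi> x \<partial>M) = (\<integral>x. \<psi> x \<partial>N)"
      and F: "closedin \<tau> F" for M N F
  proof -
    interpret M: prob_space M by fact
    interpret N: prob_space N by fact
    have spM: "space M = topspace \<tau>" and spN: "space N = topspace \<tau>"
      using sets_eq_imp_space_eq[OF sM] sets_eq_imp_space_eq[OF sN] by auto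
    obtain V where V: "\<And>n. openin \<tau> (V n)" "\<And>n. V (Suc n) \<subseteq> V n" "\<Inter>(range V) = F"
      using closed_imp_gdelta_in[OF metr F] unfolding gdelta_in_descending by metis
    have FV: "F \<subseteq> V n" for n using V(3) by auto
    have "measure M F \<le> measure N (V n)" for n
    proof -
      have "closedin \<tau> (topspace \<tau> - V n)" using V(1) by auto
      moreover have "disjnt (topspace \<tau> - V n) F" using FV by (auto simp: disjnt_iff)
      ultimately obtain f where f: "continuous_map \<tau> (top_of_set {0..1::real}) f"
          "f ` (topspace \<tau> - V n) \<subseteq> {0}" "f ` F \<subseteq> {1}"
        using Urysohn_lemma[OF metrizable_imp_normal_space[OF metr] _ F, of "topspace \<tau> - V n" 0 1] by auto
      have fc: "continuous_map \<tau> euclideanreal f"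
        using f(1) by (simp add: continuous_map_in_subtopology)
      have f01: "0 \<le> f x \<and> f x \<le> 1" if "x \<in> topspace \<tau>" for x
        using f(1) that by (auto simp: continuous_map_in_subtopology)
      have fm: "f \<in> borel_measurable M" "f \<in> borel_measurable N"
        using continuous_map_borel_measurable[OF fc] sM sN by (simp_all cong: measurable_cong_sets)
      have fF: "f x = 1" if "x \<in> F" for x using f(3) that by auto
      have fV: "f x = 0" if "x \<in> topspace \<tau>" "x \<notin> V n" for x using f(2) that by auto
      have FM: "F \<in> sets M" and VN: "V n \<in> sets N"
        using sM sN closedin_borel_of[OF F] openin_borel_of[OF V(1)] by auto
      have "measure M F = (\<integral>x. indicator F x \<partial>M)"
        using FM sets.sets_into_space[OF FM] by (simp add: Int_absorb2)
      also have "\<dots> \<le> (\<integral>x. f x \<partial>M)"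
        using f01 fF FM fm(1) spM
        by (intro integral_mono M.integrable_const_bound[where B=1]) (auto split: split_indicator)
      also have "\<dots> = (\<integral>x. f x \<partial>N)" by (rule eq[OF fc])
      also have "\<dots> \<le> (\<integral>x. indicator (V n) x \<partial>N)"
        using f01 fV VN fm(2) spN
        by (intro integral_mono N.integrable_const_bound[where B=1]) (auto split: split_indicator)
      also have "\<dots> = measure N (V n)"
        using VN sets.sets_into_space[OF VN] by (simp add: Int_absorb2)
      finally show ?thesis .
    qed
    moreover have "(\<lambda>n. measure N (V n)) \<longlonglongrightarrow> measure N (\<Inter>n. V n)"
      using V sN openin_borel_of[OF V(1)] by (intro N.finite_Lim_measure_decseq) (auto simp: decseq_Suc_iff)
    ultimately show ?thesis
      using V(3) by (intro LIMSEQ_le_const[of "\<lambda>n. measure N (V n)"]) auto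
  qed
  interpret M: prob_space M by fact
  interpret N: prob_space N by fact
  let ?E = "{F. closedin \<tau> F}"
  have "sigma_sets (topspace \<tau>) ?E = sets (borel_of \<tau>)"
  proof
    show "sigma_sets (topspace \<tau>) ?E \<subseteq> sets (borel_of \<tau>)"
      using closedin_borel_of by (subst space_borel_of[symmetric], intro sets.sigma_sets_subset) auto
    have "U \<in> sigma_sets (topspace \<tau>) ?E" if "openin \<tau> U" for U
    proof -
      have "topspace \<tau> - (topspace \<tau> - U) \<in> sigma_sets (topspace \<tau>) ?E"
        using that by (intro sigma_sets.Compl sigma_sets.Basic) auto
      then show ?thesis using openin_subset[OF that] by (simp add: Diff_Diff_Int Int_absorb1)
    qed
    then show "sets (borel_of \<tau>) \<subseteq> sigma_sets (topspace \<tau>) ?E"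
      unfolding sets_borel_of by (intro sigma_sets_mono) auto
  qed
  then have gen: "sets M = sigma_sets (topspace \<tau>) ?E" "sets N = sigma_sets (topspace \<tau>) ?E"
    using sets by auto
  show ?thesis
  proof (rule measure_eqI_generator_eq[OF _ _ _ gen, where A="\<lambda>_. topspace \<tau>"])
    show "Int_stable ?E" by (auto simp: Int_stable_def)
    show "?E \<subseteq> Pow (topspace \<tau>)" by (auto dest: closedin_subset)
    fix F assume F: "F \<in> ?E"
    then have "measure M F = measure N F"
      using le[of M N F] le[of N M F] assms by (intro antisym) auto
    then show "emeasure M F = emeasure N F"
      by (simp add: M.emeasure_eq_measure N.emeasure_eq_measure)
  qed auto
qed

section \<open>Convolution, stationary measures and translation invariance\<close>

text \<open>Adding \<open>B\<close> makes the integrands nonnegative, where the rule for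
  \<open>nn_integral\<close> over a bind applies; the shift cancels at the end.\<close>

lemma expectation_bind_pmf:
  fixes \<psi> :: "'b \<Rightarrow> real"
  assumes B: "\<And>y. y \<in> set_pmf (bind_pmf p f) \<Longrightarrow> \<bar>\<psi> y\<bar> \<le> B"
  shows "measure_pmf.expectation (bind_pmf p f) \<psi> = measure_pmf.expectation p (\<lambda>x. measure_pmf.expectation (f x) \<psi>)"
proof -
  have Bf: "\<bar>\<psi> y\<bar> \<le> B" if "x \<in> set_pmf p" "y \<in> set_pmf (f x)" for x y
    using that by (intro B) auto
  have int: "integrable (measure_pmf (bind_pmf p f)) \<psi>"
    using B by (intro measure_pmf.integrable_const_bound[where B=B]) (auto simp: AE_measure_pmf_iff)
  have intf: "integrable (measure_pmf (f x)) \<psi>" if "x \<in> set_pmf p" for x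
    using Bf that by (intro measure_pmf.integrable_const_bound[where B=B]) (auto simp: AE_measure_pmf_iff)
  have Ef: "\<bar>measure_pmf.expectation (f x) \<psi>\<bar> \<le> B" if "x \<in> set_pmf p" for x
  proof -
    have "\<bar>measure_pmf.expectation (f x) \<psi>\<bar> \<le> measure_pmf.expectation (f x) (\<lambda>y. \<bar>\<psi> y\<bar>)"
      by (rule integral_abs_bound)
    also have "\<dots> \<le> B"
      using Bf that by (intro measure_pmf.integral_le_const integrable_abs intf) (auto simp: AE_measure_pmf_iff)
    finally show ?thesis .
  qed
  have intE: "integrable (measure_pmf p) (\<lambda>x. measure_pmf.expectation (f x) \<psi>)"
    using Ef by (intro measure_pmf.integrable_const_bound[where B=B]) (auto simp: AE_measure_pmf_iff)
  have "ennreal (measure_pmf.expectation (bind_pmf p f) \<psi> + B) = ennreal (measure_pmf.expectation (bind_pmf p f) (\<lambda>y. \<psi> y + B))"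
    using int by simp
  also have "\<dots> = (\<integral>\<^sup>+y. ennreal (\<psi> y + B) \<partial>bind_pmf p f)"
    using int B by (intro nn_integral_eq_integral[symmetric]) (force simp: AE_measure_pmf_iff)+
  also have "\<dots> = (\<integral>\<^sup>+x. \<integral>\<^sup>+y. ennreal (\<psi> y + B) \<partial>f x \<partial>p)" by simp
  also have "\<dots> = (\<integral>\<^sup>+x. ennreal (measure_pmf.expectation (f x) \<psi> + B) \<partial>p)"
  proof (rule nn_integral_cong_AE, unfold AE_measure_pmf_iff, intro ballI)
    fix x assume x: "x \<in> set_pmf p"
    have "(\<integral>\<^sup>+y. ennreal (\<psi> y + B) \<partial>f x) = ennreal (measure_pmf.expectation (f x) (\<lambda>y. \<psi> y + B))"
      using intf[OF x] Bf[OF x] by (intro nn_integral_eq_integral) (force simp: AE_measure_pmf_iff)+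
    then show "(\<integral>\<^sup>+y. ennreal (\<psi> y + B) \<partial>f x) = ennreal (measure_pmf.expectation (f x) \<psi> + B)"
      using intf[OF x] by simp
  qed
  also have "\<dots> = ennreal (measure_pmf.expectation p (\<lambda>x. measure_pmf.expectation (f x) \<psi> + B))"
    using intE Ef by (intro nn_integral_eq_integral) (force simp: AE_measure_pmf_iff)+
  also have "\<dots> = ennreal (measure_pmf.expectation p (\<lambda>x. measure_pmf.expectation (f x) \<psi>) + B)"
    using intE by simp
  finally have *: "ennreal (measure_pmf.expectation (bind_pmf p f) \<psi> + B) =
      ennreal (measure_pmf.expectation p (\<lambda>x. measure_pmf.expectation (f x) \<psi>) + B)" .
  have lower: "- B \<le> measure_pmf.expectation q \<phi>" if "integrable (measure_pmf q) \<phi>" "\<And>y. y \<in> set_pmf q \<Longrightarrow> \<bar>\<phi> y\<bar> \<le> B"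
    for q :: "'c pmf" and \<phi>
    using that by (intro measure_pmf.integral_ge_const) (force simp: AE_measure_pmf_iff)+
  have "0 \<le> measure_pmf.expectation (bind_pmf p f) \<psi> + B"
    using lower[OF int B] by simp
  moreover have "0 \<le> measure_pmf.expectation p (\<lambda>x. measure_pmf.expectation (f x) \<psi>) + B"
    using lower[OF intE Ef] by simp
  ultimately show ?thesis
    using * by simp
qed

text \<open>Compactness of \<open>\<tau>\<close> gives uniformity in \<open>g\<close>: the closed
  set \<open>D\<close> of pairs where the integrand has moved by at least \<open>e/2\<close> has
  closed projection along the compact factor, and the complement of this projection is the required
  neighbourhood of \<open>x\<close>.\<close>

lemma continuous_map_integral:
  assumes comp: "compact_space \<tau>" and "prob_space m" and sets: "sets m = sets (borel_of \<tau>)"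
    and \<Phi>: "continuous_map (prod_topology \<tau> \<sigma>) euclideanreal (\<lambda>(g, x). \<Phi> g x)"
  shows "continuous_map \<sigma> euclideanreal (\<lambda>x. \<integral>g. \<Phi> g x \<partial>m)"
  unfolding continuous_map_eq_topcontinuous_at topcontinuous_at_def
proof (intro ballI conjI allI impI)
  interpret prob_space m by fact
  have sp: "space m = topspace \<tau>" using sets_eq_imp_space_eq[OF sets] by simp
  have sec: "continuous_map \<tau> euclideanreal (\<lambda>g. \<Phi> g x)" if "x \<in> topspace \<sigma>" for x
    using continuous_map_compose[of \<tau> "prod_topology \<tau> \<sigma>" "\<lambda>g. (g, x)", OF _ \<Phi>] that
    by (simp add: continuous_map_paired comp_def)
  have int: "integrable m (\<lambda>g. \<Phi> g x)" if x: "x \<in> topspace \<sigma>" for x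
  proof -
    obtain B where "\<And>g. g \<in> topspace \<tau> \<Longrightarrow> \<bar>\<Phi> g x\<bar> \<le> B"
      using continuous_map_compact_bounded[OF comp sec[OF x]] by metis
    moreover have "(\<lambda>g. \<Phi> g x) \<in> borel_measurable m"
      using continuous_map_borel_measurable[OF sec[OF x]] sets by (simp cong: measurable_cong_sets)
    ultimately show ?thesis
      using sp by (intro integrable_const_bound[where B=B]) auto
  qed
  fix x V assume x: "x \<in> topspace \<sigma>" and V: "openin euclideanreal V \<and> (\<integral>g. \<Phi> g x \<partial>m) \<in> V"
  then obtain e where e: "0 < e" "\<And>t. \<bar>t - (\<integral>g. \<Phi> g x \<partial>m)\<bar> < e \<Longrightarrow> t \<in> V"
    by (auto simp: open_dist dist_real_def)
  let ?d = "\<lambda>p. \<bar>\<Phi> (fst p) (snd p) - \<Phi> (fst p) x\<bar>"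
  have "continuous_map (prod_topology \<tau> \<sigma>) euclideanreal (\<lambda>p. \<Phi> (fst p) x)"
    using continuous_map_compose[OF continuous_map_fst sec[OF x]] by (simp add: comp_def)
  then have d: "continuous_map (prod_topology \<tau> \<sigma>) euclideanreal ?d"
    using \<Phi> by (intro continuous_map_real_abs continuous_map_diff) (simp_all add: case_prod_unfold)
  define D where "D = {p \<in> topspace (prod_topology \<tau> \<sigma>). ?d p \<in> {e/2..}}"
  have "closedin (prod_topology \<tau> \<sigma>) D"
    unfolding D_def by (rule closedin_continuous_map_preimage[OF d]) auto
  then have "closedin \<sigma> (snd ` D)"
    using Abstract_Topological_Spaces.closed_map_snd[OF comp, of \<sigma>] by (simp add: closed_map_def)
  then have "openin \<sigma> (topspace \<sigma> - snd ` D)" by auto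
  moreover have "x \<in> topspace \<sigma> - snd ` D"
    using x e(1) by (auto simp: D_def)
  moreover have "(\<integral>g. \<Phi> g y \<partial>m) \<in> V" if y: "y \<in> topspace \<sigma> - snd ` D" for y
  proof (rule e(2))
    have small: "\<bar>\<Phi> g y - \<Phi> g x\<bar> \<le> e/2" if g: "g \<in> topspace \<tau>" for g
    proof (rule ccontr)
      assume "\<not> \<bar>\<Phi> g y - \<Phi> g x\<bar> \<le> e/2"
      then have "(g, y) \<in> D" using g y by (auto simp: D_def)
      then have "y \<in> snd ` D" by (rule image_eqI[rotated]) simp
      then show False using y by simp
    qed
    have "(\<integral>g. \<Phi> g y \<partial>m) - (\<integral>g. \<Phi> g x \<partial>m) = (\<integral>g. \<Phi> g y - \<Phi> g x \<partial>m)"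
      using int x y by simp
    moreover have "\<bar>\<integral>g. \<Phi> g y - \<Phi> g x \<partial>m\<bar> \<le> (\<integral>g. \<bar>\<Phi> g y - \<Phi> g x\<bar> \<partial>m)"
      by (rule integral_abs_bound)
    moreover have "(\<integral>g. \<bar>\<Phi> g y - \<Phi> g x\<bar> \<partial>m) \<le> e/2"
      using int x y small sp by (intro integral_le_const integrable_abs Bochner_Integration.integrable_diff) auto
    ultimately show "\<bar>(\<integral>g. \<Phi> g y \<partial>m) - (\<integral>g. \<Phi> g x \<partial>m)\<bar> < e"
      using e(1) by linarith
  qed
  ultimately show "\<exists>U. openin \<sigma> U \<and> x \<in> U \<and> (\<forall>y\<in>U. (\<integral>g. \<Phi> g y \<partial>m) \<in> V)"
    by blast
qed auto

text \<open>Maximum principle: the translates of \<open>\<psi>\<close> have a largest integral, attained at some \<open>x0\<close>; by stationarity it is a \<open>p\<close>-average of the integrals at the points \<open>op z x0\<close>, and \<open>p\<close> is not supported in any proper closed subset.\<close>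

lemma stationary_imp_translation_invariant:
  fixes op :: "'g \<Rightarrow> 'g \<Rightarrow> 'g"
  assumes comp: "compact_space \<tau>" and m: "prob_space m" "sets m = sets (borel_of \<tau>)"
    and cont: "continuous_map (prod_topology \<tau> \<tau>) \<tau> (\<lambda>(a, b). op a b)"
    and assoc: "\<And>a b c. a \<in> topspace \<tau> \<Longrightarrow> b \<in> topspace \<tau> \<Longrightarrow> c \<in> topspace \<tau> \<Longrightarrow> op (op a b) c = op a (op b c)"
    and transitive: "\<And>x y. x \<in> topspace \<tau> \<Longrightarrow> y \<in> topspace \<tau> \<Longrightarrow> \<exists>z\<in>topspace \<tau>. op z x = y"
    and p: "set_pmf p \<subseteq> topspace \<tau>" "\<And>F. closedin \<tau> F \<Longrightarrow> set_pmf p \<subseteq> F \<Longrightarrow> F = topspace \<tau>"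
    and stat: "\<And>\<psi>. continuous_map \<tau> euclideanreal \<psi> \<Longrightarrow>
      measure_pmf.expectation p (\<lambda>z. \<integral>g. \<psi> (op g z) \<partial>m) = (\<integral>g. \<psi> g \<partial>m)"
    and \<psi>: "continuous_map \<tau> euclideanreal \<psi>" and xy: "x \<in> topspace \<tau>" "y \<in> topspace \<tau>"
  shows "(\<integral>g. \<psi> (op g x) \<partial>m) = (\<integral>g. \<psi> (op g y) \<partial>m)"
proof -
  define h where "h x = (\<integral>g. \<psi> (op g x) \<partial>m)" for x
  have sp: "space m = topspace \<tau>" using sets_eq_imp_space_eq[OF m(2)] by simp
  have op_in: "op a b \<in> topspace \<tau>" if "a \<in> topspace \<tau>" "b \<in> topspace \<tau>" for a b
    using funcset_mem[OF continuous_map_funspace[OF cont], of "(a, b)"] that by simp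
  have \<psi>op: "continuous_map (prod_topology \<tau> \<tau>) euclideanreal (\<lambda>(a, b). \<psi> (op a b))"
    using continuous_map_compose[OF cont \<psi>] by (simp add: comp_def case_prod_unfold)
  have right: "continuous_map \<tau> \<tau> (\<lambda>g. op g x)" if "x \<in> topspace \<tau>" for x
    using continuous_map_compose[of \<tau> "prod_topology \<tau> \<tau>" "\<lambda>g. (g, x)", OF _ cont] that
    by (simp add: continuous_map_paired comp_def)
  have h: "continuous_map \<tau> euclideanreal h"
    unfolding h_def by (rule continuous_map_integral[OF comp m \<psi>op])
  have "compact (h ` topspace \<tau>)"
    using image_compactin[OF _ h, of "topspace \<tau>"] comp by (simp add: compact_space_def)
  then have "\<exists>s\<in>h ` topspace \<tau>. \<forall>t\<in>h ` topspace \<tau>. t \<le> s"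
    using xy(1) by (intro compact_attains_sup) blast+
  then obtain x0 where x0: "x0 \<in> topspace \<tau>" and max: "\<And>z. z \<in> topspace \<tau> \<Longrightarrow> h z \<le> h x0"
    by blast
  have hx0: "continuous_map \<tau> euclideanreal (\<lambda>z. h (op z x0))"
    using continuous_map_compose[OF right[OF x0] h] by (simp add: comp_def)
  have "measure_pmf.expectation p (\<lambda>z. h (op z x0)) = measure_pmf.expectation p (\<lambda>z. \<integral>g. \<psi> (op (op g z) x0) \<partial>m)"
  proof (rule integral_cong_AE, simp, simp, unfold AE_measure_pmf_iff, intro ballI)
    fix z assume "z \<in> set_pmf p"
    then have "z \<in> topspace \<tau>" using p(1) by auto
    then show "h (op z x0) = (\<integral>g. \<psi> (op (op g z) x0) \<partial>m)"
      unfolding h_def using x0 by (intro Bochner_Integration.integral_cong) (auto simp: assoc sp)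
  qed
  also have "\<dots> = h x0"
    using stat[of "\<lambda>g. \<psi> (op g x0)"] continuous_map_compose[OF right[OF x0] \<psi>] by (simp add: h_def comp_def)
  finally have eq: "measure_pmf.expectation p (\<lambda>z. h (op z x0)) = h x0" .
  obtain B where B: "\<And>z. z \<in> topspace \<tau> \<Longrightarrow> \<bar>h (op z x0)\<bar> \<le> B"
    using continuous_map_compact_bounded[OF comp hx0] by metis
  have int: "integrable (measure_pmf p) (\<lambda>z. h (op z x0))"
    using B p(1) by (intro measure_pmf.integrable_const_bound[where B=B]) (auto simp: AE_measure_pmf_iff)
  have "measure_pmf.expectation p (\<lambda>z. h x0 - h (op z x0)) = 0"
    using int eq by simp
  then have "AE z in measure_pmf p. h x0 - h (op z x0) = 0"
    using int p(1) max op_in x0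
    by (subst (asm) integral_nonneg_eq_0_iff_AE) (auto simp: AE_measure_pmf_iff)
  then have "set_pmf p \<subseteq> {z\<in>topspace \<tau>. h (op z x0) \<in> {h x0}}"
    using p(1) by (auto simp: AE_measure_pmf_iff)
  moreover have "closedin \<tau> {z\<in>topspace \<tau>. h (op z x0) \<in> {h x0}}"
    by (rule closedin_continuous_map_preimage[OF hx0]) simp
  ultimately have all: "{z\<in>topspace \<tau>. h (op z x0) \<in> {h x0}} = topspace \<tau>"
    using p(2) by blast
  have "h y = h x0" if y: "y \<in> topspace \<tau>" for y
  proof -
    obtain z where "z \<in> topspace \<tau>" "op z x0 = y" using transitive[OF x0 y] by blast
    then show ?thesis using all by auto
  qed
  then show ?thesis using xy by (simp add: h_def)
qed

text \<open>Convolving a Cesaro mean with \<open>p\<close> shifts its summands by one, so only the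
  two boundary terms survive and they are \<open>O(1/N)\<close>. Dominated convergence moves the
  limit under the expectation with respect to \<open>p\<close>.\<close>

lemma cesaro_limit_stationary:
  fixes op :: "'g \<Rightarrow> 'g \<Rightarrow> 'g" and q :: "nat \<Rightarrow> 'g pmf"
  assumes comp: "compact_space \<tau>"
    and q: "\<And>n. set_pmf (q n) \<subseteq> topspace \<tau>" and p: "set_pmf p \<subseteq> topspace \<tau>"
    and step: "\<And>n. q (Suc n) = bind_pmf p (\<lambda>z. map_pmf (\<lambda>g. op g z) (q n))"
    and right: "\<And>z. z \<in> topspace \<tau> \<Longrightarrow> continuous_map \<tau> \<tau> (\<lambda>g. op g z)"
    and r: "strict_mono (r :: nat \<Rightarrow> nat)"
    and lim: "\<And>\<psi>. continuous_map \<tau> euclideanreal \<psi> \<Longrightarrow>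
      (\<lambda>k. measure_pmf.expectation (bind_pmf (pmf_of_set {..r k}) q) \<psi>) \<longlonglongrightarrow> (\<integral>g. \<psi> g \<partial>m)"
    and \<psi>: "continuous_map \<tau> euclideanreal \<psi>"
  shows "measure_pmf.expectation p (\<lambda>z. \<integral>g. \<psi> (op g z) \<partial>m) = (\<integral>g. \<psi> g \<partial>m)"
proof -
  obtain B where B0: "0 \<le> B" and B: "\<And>x. x \<in> topspace \<tau> \<Longrightarrow> \<bar>\<psi> x\<bar> \<le> B"
    using continuous_map_compact_bounded[OF comp \<psi>] by metis
  define c where "c N = bind_pmf (pmf_of_set {..N}) q" for N
  have c: "set_pmf (c N) \<subseteq> topspace \<tau>" for N
    unfolding c_def using q by auto
  have op_in: "op g z \<in> topspace \<tau>" if "g \<in> topspace \<tau>" "z \<in> topspace \<tau>" for g z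
    using right[OF that(2)] that(1) by (auto simp: continuous_map_def)
  have E_le: "\<bar>measure_pmf.expectation s \<phi>\<bar> \<le> B" if "\<And>x. x \<in> set_pmf s \<Longrightarrow> \<bar>\<phi> x\<bar> \<le> B"
    for s :: "'g pmf" and \<phi>
  proof -
    have "integrable (measure_pmf s) \<phi>"
      using that by (intro measure_pmf.integrable_const_bound[where B=B]) (auto simp: AE_measure_pmf_iff)
    then have "measure_pmf.expectation s (\<lambda>x. \<bar>\<phi> x\<bar>) \<le> B"
      using that by (intro measure_pmf.integral_le_const integrable_abs) (auto simp: AE_measure_pmf_iff)
    then show ?thesis
      using integral_abs_bound[of "measure_pmf s" \<phi>] by linarith
  qed
  define E where "E n = measure_pmf.expectation (q n) \<psi>" for n
  have c_E: "measure_pmf.expectation (c N) \<psi> = (\<Sum>n\<le>N. E n) / Suc N" for N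
  proof -
    have "measure_pmf.expectation (c N) \<psi> = measure_pmf.expectation (pmf_of_set {..N}) E"
      unfolding c_def E_def using q B by (intro expectation_bind_pmf[where B=B]) auto
    also have "\<dots> = (\<Sum>n\<le>N. E n) / Suc N"
      by (subst integral_pmf_of_set) auto
    finally show ?thesis .
  qed
  have c_shift: "measure_pmf.expectation p (\<lambda>z. measure_pmf.expectation (c N) (\<lambda>g. \<psi> (op g z))) = (\<Sum>n\<le>N. E (Suc n)) / Suc N" for N
  proof -
    have "measure_pmf.expectation p (\<lambda>z. measure_pmf.expectation (c N) (\<lambda>g. \<psi> (op g z)))
        = measure_pmf.expectation (bind_pmf p (\<lambda>z. map_pmf (\<lambda>g. op g z) (c N))) \<psi>"
      using p c B op_in by (subst expectation_bind_pmf[where B=B]) (auto intro!: B op_in)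
    also have "bind_pmf p (\<lambda>z. map_pmf (\<lambda>g. op g z) (c N)) = bind_pmf (pmf_of_set {..N}) (\<lambda>n. q (Suc n))"
      unfolding c_def map_bind_pmf step by (rule bind_commute_pmf)
    also have "measure_pmf.expectation \<dots> \<psi> = measure_pmf.expectation (pmf_of_set {..N}) (\<lambda>n. E (Suc n))"
      unfolding E_def using q B by (intro expectation_bind_pmf[where B=B]) auto
    also have "\<dots> = (\<Sum>n\<le>N. E (Suc n)) / Suc N"
      by (subst integral_pmf_of_set) auto
    finally show ?thesis .
  qed
  have E_B: "\<bar>E n\<bar> \<le> B" for n
    unfolding E_def using q[of n] B by (intro E_le) auto
  have diff: "(\<Sum>n\<le>N. E (Suc n)) / Suc N - (\<Sum>n\<le>N. E n) / Suc N = (E (Suc N) - E 0) / Suc N" for N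
  proof -
    have "(\<Sum>n\<le>N. E (Suc n)) - (\<Sum>n\<le>N. E n) = E (Suc N) - E 0"
      using sum_telescope[of E N] by (simp add: sum_subtractf algebra_simps)
    then show ?thesis by (simp add: diff_divide_distrib[symmetric])
  qed
  have "(\<lambda>N. (E (Suc N) - E 0) / Suc N) \<longlonglongrightarrow> 0"
  proof (rule Lim_null_comparison)
    have "\<bar>(E (Suc N) - E 0) / Suc N\<bar> \<le> 2 * B * inverse (Suc N)" for N
      using E_B[of "Suc N"] E_B[of 0] by (simp add: divide_simps)
    then show "\<forall>\<^sub>F N in sequentially. norm ((E (Suc N) - E 0) / Suc N) \<le> 2 * B * inverse (Suc N)"
      by (simp add: always_eventually)
    show "(\<lambda>N. 2 * B * inverse (Suc N)) \<longlonglongrightarrow> 0"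
      using tendsto_mult_right_zero[OF LIMSEQ_inverse_real_of_nat, of "2 * B"] by simp
  qed
  then have "(\<lambda>k. (E (Suc (r k)) - E 0) / Suc (r k)) \<longlonglongrightarrow> 0"
    using LIMSEQ_subseq_LIMSEQ[OF _ r] by (auto simp: comp_def)
  moreover have "(\<lambda>k. (\<Sum>n\<le>r k. E n) / Suc (r k)) \<longlonglongrightarrow> (\<integral>g. \<psi> g \<partial>m)"
    using lim[OF \<psi>] c_E unfolding c_def by simp
  ultimately have "(\<lambda>k. (\<Sum>n\<le>r k. E n) / Suc (r k) + (E (Suc (r k)) - E 0) / Suc (r k)) \<longlonglongrightarrow> (\<integral>g. \<psi> g \<partial>m) + 0"
    by (intro tendsto_add)
  then have 1: "(\<lambda>k. measure_pmf.expectation p (\<lambda>z. measure_pmf.expectation (c (r k)) (\<lambda>g. \<psi> (op g z)))) \<longlonglongrightarrow> (\<integral>g. \<psi> g \<partial>m)"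
    unfolding c_shift using diff by (simp add: algebra_simps)
  have 2: "(\<lambda>k. measure_pmf.expectation p (\<lambda>z. measure_pmf.expectation (c (r k)) (\<lambda>g. \<psi> (op g z))))
      \<longlonglongrightarrow> measure_pmf.expectation p (\<lambda>z. \<integral>g. \<psi> (op g z) \<partial>m)"
  proof (rule integral_dominated_convergence[where w="\<lambda>_. B"])
    show "AE z in measure_pmf p. (\<lambda>k. measure_pmf.expectation (c (r k)) (\<lambda>g. \<psi> (op g z))) \<longlonglongrightarrow> (\<integral>g. \<psi> (op g z) \<partial>m)"
      unfolding AE_measure_pmf_iff
    proof
      fix z assume "z \<in> set_pmf p"
      then have "continuous_map \<tau> euclideanreal (\<lambda>g. \<psi> (op g z))"
        using continuous_map_compose[OF right \<psi>, of z] p by (auto simp: comp_def)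
      from lim[OF this] show "(\<lambda>k. measure_pmf.expectation (c (r k)) (\<lambda>g. \<psi> (op g z))) \<longlonglongrightarrow> (\<integral>g. \<psi> (op g z) \<partial>m)"
        unfolding c_def .
    qed
    show "AE z in measure_pmf p. norm (measure_pmf.expectation (c (r k)) (\<lambda>g. \<psi> (op g z))) \<le> B" for k
      unfolding AE_measure_pmf_iff real_norm_def
    proof
      fix z assume z: "z \<in> set_pmf p"
      show "\<bar>measure_pmf.expectation (c (r k)) (\<lambda>g. \<psi> (op g z))\<bar> \<le> B"
        using z p c[of "r k"] by (intro E_le B op_in) auto
    qed
  qed auto
  show ?thesis by (rule LIMSEQ_unique[OF 2 1])
qed

text \<open>Haar measure arises as a weak limit of Cesaro means of the convolution powers of a discrete measure with dense support.\<close>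

theorem compact_group_Haar_measure:
  fixes G (structure)
  assumes G: "topological_group G \<tau>" and comp: "compact_space \<tau>" and metr: "metrizable_space \<tau>"
  obtains m where "prob_space m" "sets m = sets (borel_of \<tau>)"
    "\<And>h. h \<in> carrier G \<Longrightarrow> distr m m (\<lambda>g. g \<otimes> h) = m"
    "\<And>h. h \<in> carrier G \<Longrightarrow> distr m m (\<lambda>g. h \<otimes> g) = m"
proof -
  interpret group G using G by (simp add: topological_group_def)
  have top: "topspace \<tau> = carrier G" using G by (simp add: topological_group_def)
  have mult: "continuous_map (prod_topology \<tau> \<tau>) \<tau> (\<lambda>(g, h). g \<otimes> h)"
    using G by (simp add: topological_group_def)
  have "continuous_map (prod_topology \<tau> \<tau>) \<tau> ((\<lambda>(g, h). g \<otimes> h) \<circ> (\<lambda>p. (snd p, fst p)))"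
    by (intro continuous_map_compose[OF _ mult] continuous_map_pairedI continuous_map_fst continuous_map_snd)
  then have mult': "continuous_map (prod_topology \<tau> \<tau>) \<tau> (\<lambda>(g, h). h \<otimes> g)"
    by (simp add: comp_def case_prod_unfold)
  have right: "continuous_map \<tau> \<tau> (\<lambda>g. g \<otimes> h)" if "h \<in> carrier G" for h
    using continuous_map_compose[of \<tau> "prod_topology \<tau> \<tau>" "\<lambda>g. (g, h)", OF _ mult] that
    by (simp add: continuous_map_paired comp_def top)
  have left: "continuous_map \<tau> \<tau> (\<lambda>g. h \<otimes> g)" if "h \<in> carrier G" for h
    using continuous_map_compose[of \<tau> "prod_topology \<tau> \<tau>" "\<lambda>g. (g, h)", OF _ mult'] that
    by (simp add: continuous_map_paired comp_def top)
  obtain U :: "nat \<Rightarrow> 'a set" where U: "\<And>j. openin \<tau> (U j)"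
      and base: "\<And>V x. openin \<tau> V \<Longrightarrow> x \<in> V \<Longrightarrow> \<exists>j. x \<in> U j \<and> U j \<subseteq> V"
    using compact_metrizable_countable_base[OF comp metr] by blast
  define d where "d j = (if U j = {} then \<one> else SOME x. x \<in> U j)" for j
  have d_U: "d j \<in> U j" if "U j \<noteq> {}" for j
    using that some_in_eq[of "U j"] by (simp add: d_def)
  have d_G: "d j \<in> carrier G" for j
    using d_U[of j] openin_subset[OF U, of j] top by (cases "U j = {}") (auto simp: d_def)
  \<comment> \<open>Every index has positive geometric mass, so each \<open>d j\<close> is an atom
    of \<open>p\<close> and every nonempty open set is charged.\<close>
  define p where "p = map_pmf d (geometric_pmf (1/2))"
  have set_p: "set_pmf p = range d" by (simp add: p_def set_pmf_geometric)
  have p_G: "set_pmf p \<subseteq> topspace \<tau>" using d_G by (auto simp: set_p top)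
  have p_dense: "F = topspace \<tau>" if F: "closedin \<tau> F" "set_pmf p \<subseteq> F" for F
  proof (rule ccontr)
    assume "F \<noteq> topspace \<tau>"
    then obtain x where "x \<in> topspace \<tau> - F" using closedin_subset[OF F(1)] by auto
    moreover have "openin \<tau> (topspace \<tau> - F)" using F(1) by auto
    ultimately obtain j where "x \<in> U j" "U j \<subseteq> topspace \<tau> - F" using base by blast
    then have "d j \<notin> F" using d_U[of j] by auto
    then show False using F(2) by (auto simp: set_p)
  qed
  define q where "q n = ((\<lambda>s. bind_pmf p (\<lambda>z. map_pmf (\<lambda>g. g \<otimes> z) s)) ^^ n) (return_pmf \<one>)" for n
  have q_Suc: "q (Suc n) = bind_pmf p (\<lambda>z. map_pmf (\<lambda>g. g \<otimes> z) (q n))" for n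
    by (simp add: q_def)
  have q_G: "set_pmf (q n) \<subseteq> topspace \<tau>" for n
  proof (induction n)
    case (Suc n)
    then show ?case using p_G by (auto simp: q_Suc top)
  qed (simp add: q_def top)
  \<comment> \<open>The convolution powers of \<open>p\<close> can also be built by multiplying on
    the left. Thus one and the same limit \<open>m\<close> is stationary on both sides.\<close>
  have q_Suc': "q (Suc n) = bind_pmf p (\<lambda>z. map_pmf (\<lambda>g. z \<otimes> g) (q n))" for n
  proof (induction n)
    case 0
    have "q (Suc 0) = bind_pmf p (\<lambda>z. map_pmf (\<lambda>g. g \<otimes> z) (return_pmf \<one>))"
      by (simp add: q_def)
    also have "\<dots> = bind_pmf p (\<lambda>z. map_pmf (\<lambda>g. z \<otimes> g) (return_pmf \<one>))"
      using p_G by (intro bind_pmf_cong) (auto simp: top)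
    finally show ?case by (simp add: q_def)
  next
    case (Suc n)
    have "q (Suc (Suc n)) = bind_pmf p (\<lambda>z. map_pmf (\<lambda>g. g \<otimes> z) (bind_pmf p (\<lambda>w. map_pmf (\<lambda>g. w \<otimes> g) (q n))))"
      using q_Suc[of "Suc n"] Suc by simp
    also have "\<dots> = bind_pmf p (\<lambda>z. bind_pmf p (\<lambda>w. map_pmf (\<lambda>g. (w \<otimes> g) \<otimes> z) (q n)))"
      by (simp add: map_bind_pmf pmf.map_comp comp_def)
    also have "\<dots> = bind_pmf p (\<lambda>w. bind_pmf p (\<lambda>z. map_pmf (\<lambda>g. (w \<otimes> g) \<otimes> z) (q n)))"
      by (rule bind_commute_pmf)
    also have "\<dots> = bind_pmf p (\<lambda>w. bind_pmf p (\<lambda>z. map_pmf (\<lambda>g. w \<otimes> (g \<otimes> z)) (q n)))"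
      using p_G q_G[of n] by (intro bind_pmf_cong map_pmf_cong refl) (auto simp: top subset_iff intro!: m_assoc)
    also have "\<dots> = bind_pmf p (\<lambda>w. map_pmf (\<lambda>g. w \<otimes> g) (q (Suc n)))"
      by (simp add: q_Suc map_bind_pmf pmf.map_comp comp_def)
    finally show ?case .
  qed
  have "set_pmf (bind_pmf (pmf_of_set {..N}) q) \<subseteq> topspace \<tau>" for N
    using q_G by auto
  then obtain r m where r: "strict_mono (r :: nat \<Rightarrow> nat)" and m: "prob_space m" "sets m = sets (borel_of \<tau>)"
    and lim: "\<And>\<psi>. continuous_map \<tau> euclideanreal \<psi> \<Longrightarrow>
      (\<lambda>n. measure_pmf.expectation (bind_pmf (pmf_of_set {..r n}) q) \<psi>) \<longlonglongrightarrow> (\<integral>x. \<psi> x \<partial>m)"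
    by (rule weak_limit_compact_metrizable[OF comp metr]) (rule that)
  interpret m: prob_space m by (rule m)
  have inv: "distr m m f = m"
    if f: "continuous_map \<tau> \<tau> f" and eq: "\<And>\<psi>. continuous_map \<tau> euclideanreal \<psi> \<Longrightarrow> (\<integral>g. \<psi> (f g) \<partial>m) = (\<integral>g. \<psi> g \<partial>m)" for f
  proof (rule prob_eq_of_continuous_integrals[OF metr])
    have fm: "f \<in> m \<rightarrow>\<^sub>M m"
      using continuous_map_measurable_borel_of[OF f] m(2) by (simp cong: measurable_cong_sets)
    then show "prob_space (distr m m f)" by (rule m.prob_space_distr)
    fix \<psi> assume \<psi>: "continuous_map \<tau> euclideanreal \<psi>"
    have "\<psi> \<in> borel_measurable m"
      using continuous_map_borel_measurable[OF \<psi>] m(2) by (simp cong: measurable_cong_sets)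
    then show "(\<integral>x. \<psi> x \<partial>distr m m f) = (\<integral>x. \<psi> x \<partial>m)"
      using eq[OF \<psi>] by (simp add: integral_distr[OF fm])
  qed (use m in auto)
  have R: "distr m m (\<lambda>g. g \<otimes> h) = m" if h: "h \<in> carrier G" for h
  proof (rule inv[OF right[OF h]])
    fix \<psi> assume \<psi>: "continuous_map \<tau> euclideanreal \<psi>"
    have "(\<integral>g. \<psi> (g \<otimes> h) \<partial>m) = (\<integral>g. \<psi> (g \<otimes> \<one>) \<partial>m)"
    proof (rule stationary_imp_translation_invariant[where op="(\<otimes>)" and p=p, OF comp m mult _ _ p_G p_dense _ \<psi>])
      show "\<exists>z\<in>topspace \<tau>. z \<otimes> x = y" if "x \<in> topspace \<tau>" "y \<in> topspace \<tau>" for x y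
        using that by (intro bexI[of _ "y \<otimes> inv x"]) (auto simp: top m_assoc)
      show "measure_pmf.expectation p (\<lambda>z. \<integral>g. \<phi> (g \<otimes> z) \<partial>m) = (\<integral>g. \<phi> g \<partial>m)"
        if "continuous_map \<tau> euclideanreal \<phi>" for \<phi>
        using right top by (intro cesaro_limit_stationary[OF comp q_G p_G q_Suc _ r lim that]) auto
    qed (use h in \<open>auto simp: top m_assoc\<close>)
    also have "\<dots> = (\<integral>g. \<psi> g \<partial>m)"
      using sets_eq_imp_space_eq[OF m(2)] by (intro Bochner_Integration.integral_cong) (auto simp: top)
    finally show "(\<integral>g. \<psi> (g \<otimes> h) \<partial>m) = (\<integral>g. \<psi> g \<partial>m)" .
  qed
  have L: "distr m m (\<lambda>g. h \<otimes> g) = m" if h: "h \<in> carrier G" for h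
  proof (rule inv[OF left[OF h]])
    fix \<psi> assume \<psi>: "continuous_map \<tau> euclideanreal \<psi>"
    have "(\<integral>g. \<psi> (h \<otimes> g) \<partial>m) = (\<integral>g. \<psi> (\<one> \<otimes> g) \<partial>m)"
    \<comment> \<open>The opposite multiplication turns the statement on right translations into the
      one on left translations.\<close>
    proof (rule stationary_imp_translation_invariant[where op="\<lambda>g z. z \<otimes> g" and p=p, OF comp m mult' _ _ p_G p_dense _ \<psi>])
      show "\<exists>z\<in>topspace \<tau>. x \<otimes> z = y" if "x \<in> topspace \<tau>" "y \<in> topspace \<tau>" for x y
        using that by (intro bexI[of _ "inv x \<otimes> y"]) (auto simp: top m_assoc[symmetric])
      show "measure_pmf.expectation p (\<lambda>z. \<integral>g. \<phi> (z \<otimes> g) \<partial>m) = (\<integral>g. \<phi> g \<partial>m)"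
        if "continuous_map \<tau> euclideanreal \<phi>" for \<phi>
        using left top by (intro cesaro_limit_stationary[where op="\<lambda>g z. z \<otimes> g", OF comp q_G p_G q_Suc' _ r lim that]) auto
    qed (use h in \<open>auto simp: top m_assoc\<close>)
    also have "\<dots> = (\<integral>g. \<psi> g \<partial>m)"
      using sets_eq_imp_space_eq[OF m(2)] by (intro Bochner_Integration.integral_cong) (auto simp: top)
    finally show "(\<integral>g. \<psi> (h \<otimes> g) \<partial>m) = (\<integral>g. \<psi> g \<partial>m)" .
  qed
  show ?thesis by (rule that[OF m R L])
qed

section \<open>Decomposition of Gibbs measures\<close>

text \<open>The extension takes the infimum over larger rationals, which is right continuous and
  agrees with \<open>F\<close> by the assumption \<open>right\<close>. Rational arguments matter
  later: a conditional distribution function is then governed by countably many almost sure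
  conditions.\<close>

lemma real_distribution_with_rational_cdf:
  fixes F :: "rat \<Rightarrow> real"
  assumes mono: "\<And>p q. p \<le> q \<Longrightarrow> F p \<le> F q"
    and right: "\<And>q e. 0 < e \<Longrightarrow> \<exists>p>q. F p < F q + e"
    and lo: "\<And>q. q < 0 \<Longrightarrow> F q = 0" and hi: "\<And>q. 1 \<le> q \<Longrightarrow> F q = 1"
  obtains \<mu> where "real_distribution \<mu>" "\<And>q. measure \<mu> {..of_rat q} = F q"
    "emeasure \<mu> {0..1} = 1"
proof -
  define c where "c t = (INF q\<in>{q. t < of_rat q}. F q)" for t :: real
  have F0: "0 \<le> F q" for q
    using mono[of "min q (-1)" q] lo[of "min q (-1)"] by simp
  have bdd: "bdd_below (F ` S)" for S
    using F0 by (auto simp: bdd_below_def)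
  have ne: "{q. t < of_rat q} \<noteq> {}" for t :: real
    using of_rat_dense[of t "t + 1"] by auto
  have c_le: "c t \<le> F q" if "t < of_rat q" for t q
    unfolding c_def using that by (intro cINF_lower bdd) auto
  have c_ge: "a \<le> c t" if "\<And>q. t < of_rat q \<Longrightarrow> a \<le> F q" for t a
    unfolding c_def using that ne by (intro cINF_greatest) auto
  have c_less: "\<exists>q. t < of_rat q \<and> F q < a" if "c t < a" for t a
    using c_ge[of t a] that by (meson not_le)
  have c_mono: "c s \<le> c t" if "s \<le> t" for s t
    using that by (intro c_ge c_le) auto
  have c_rat: "c (of_rat q) = F q" for q
  proof (rule antisym)
    show "c (of_rat q) \<le> F q"
    proof (rule field_le_epsilon)
      fix e :: real assume "0 < e"
      from right[OF this, of q] obtain p where "p > q" "F p < F q + e" by auto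
      then show "c (of_rat q) \<le> F q + e"
        using c_le[of "of_rat q" p] by (simp add: of_rat_less)
    qed
    show "F q \<le> c (of_rat q)"
      by (intro c_ge mono) (simp add: of_rat_less)
  qed
  have c_right: "continuous (at_right a) c" for a
    unfolding continuous_within
  proof (rule order_tendstoI)
    fix l assume "l < c a"
    then show "\<forall>\<^sub>F x in at_right a. l < c x"
      using c_mono[of a] unfolding eventually_at_right_field
      by (intro exI[of _ "a + 1"]) (force intro: less_le_trans)
  next
    fix u assume "c a < u"
    then obtain q where "a < of_rat q" "F q < u"
      using c_less by blast
    then show "\<forall>\<^sub>F x in at_right a. c x < u"
      using c_le[of _ q] by (auto simp: eventually_at_right_field intro: le_less_trans exI[of _ "of_rat q"])
  qed
  have c_bot: "c t = 0" if neg: "t < 0" for t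
  proof -
    obtain q where "t < of_rat q" "of_rat q < (0::real)"
      using of_rat_dense[OF neg] by auto
    then have "c t \<le> 0" using c_le[of t q] lo[of q] by simp
    moreover have "0 \<le> c t" by (intro c_ge F0)
    ultimately show ?thesis by simp
  qed
  have c_top: "c t = 1" if "1 \<le> t" for t
  proof -
    have *: "1 \<le> q" if "t < of_rat q" for q :: rat
    proof -
      have "1 < (of_rat q :: real)"
        using that \<open>1 \<le> t\<close> by linarith
      then show ?thesis
        by simp
    qed
    obtain q where q: "t < of_rat q" using ne[of t] by auto
    have "c t \<le> 1" using c_le[OF q] hi[OF *[OF q]] by simp
    moreover have "1 \<le> c t" by (intro c_ge) (simp add: hi *)
    ultimately show ?thesis by simp
  qed
  have lim_bot: "(c \<longlongrightarrow> 0) at_bot"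
    by (rule tendsto_eventually) (use c_bot in \<open>auto simp: eventually_at_bot_dense\<close>)
  have lim_top: "(c \<longlongrightarrow> 1) at_top"
    by (rule tendsto_eventually) (use c_top in \<open>auto simp: eventually_at_top_linorder\<close>)
  define \<mu> where "\<mu> = interval_measure c"
  have rd: "real_distribution \<mu>"
    unfolding \<mu>_def using c_mono c_right lim_bot lim_top by (rule real_distribution_interval_measure)
  interpret real_distribution \<mu> by (fact rd)
  have cdf: "cdf \<mu> = c"
    unfolding \<mu>_def by (rule cdf_interval_measure) (fact c_mono c_right lim_bot)+
  have m: "measure \<mu> {..t} = c t" for t
    using cdf by (metis cdf_def)
  have "measure \<mu> {..<0} = 0"
  proof -
    have "(cdf \<mu> \<longlongrightarrow> measure \<mu> {..<0}) (at_left 0)" by (rule cdf_at_left)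
    moreover have "(cdf \<mu> \<longlongrightarrow> 0) (at_left 0)"
      unfolding cdf by (rule tendsto_eventually) (use c_bot in \<open>auto simp: eventually_at_left_field intro: exI[of _ "-1"]\<close>)
    ultimately show ?thesis
      using tendsto_unique trivial_limit_at_left_real by blast
  qed
  moreover have "measure \<mu> {0..1} = measure \<mu> {..1} - measure \<mu> {..<0}"
    by (subst finite_measure_Diff[symmetric]) (auto intro!: arg_cong[where f="measure \<mu>"])
  ultimately have "measure \<mu> {0..1} = 1"
    using m[of 1] c_top[of 1] by simp
  then have "emeasure \<mu> {0..1} = 1"
    by (simp add: emeasure_eq_measure)
  with rd show ?thesis
    using m c_rat by (intro that) auto
qed

text \<open>True for divergent sequences as well, since \<open>lim\<close> is a definite description
  and both sequences have the same limits. This makes pointwise limits tail-measurable without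
  restriction to a convergence set.\<close>

lemma lim_shift:
  fixes u :: "nat \<Rightarrow> real"
  shows "lim (\<lambda>k. u (k + m)) = lim u"
proof -
  have "(\<lambda>k. u (k + m)) \<longlonglongrightarrow> L \<longleftrightarrow> u \<longlonglongrightarrow> L" for L
    by (blast intro: LIMSEQ_ignore_initial_segment LIMSEQ_offset)
  then show ?thesis
    unfolding lim_def by simp
qed

text \<open>The subsequence has squared L2 increments at most \<open>(1/4)^k\<close>. They stay
  summable after multiplication by \<open>2^k\<close>, so the weighted squares are summable almost
  everywhere, and then so are the increments themselves.\<close>

lemma (in prob_space) AE_convergent_subseq:
  fixes u :: "nat \<Rightarrow> 'a \<Rightarrow> real"
  assumes [measurable]: "\<And>n. u n \<in> borel_measurable M"
    and Cauchy: "\<And>e. 0 < e \<Longrightarrow> \<exists>N. \<forall>m\<ge>N. \<forall>n\<ge>m. (\<integral>\<^sup>+x. ennreal ((u n x - u m x)\<^sup>2) \<partial>M) \<le> ennreal e"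
  obtains r where "strict_mono r" "AE x in M. convergent (\<lambda>k. u (r k) x)"
proof -
  have "\<forall>k. \<exists>N. \<forall>m\<ge>N. \<forall>n\<ge>m. (\<integral>\<^sup>+x. ennreal ((u n x - u m x)\<^sup>2) \<partial>M) \<le> ennreal ((1/4)^k)"
    using Cauchy by simp
  then obtain N where N: "\<And>k m n. N k \<le> m \<Longrightarrow> m \<le> n \<Longrightarrow>
      (\<integral>\<^sup>+x. ennreal ((u n x - u m x)\<^sup>2) \<partial>M) \<le> ennreal ((1/4)^k)"
    by metis
  define r where "r k = (\<Sum>i\<le>k. N i) + k" for k
  have r: "strict_mono r"
    by (rule strict_mono_Suc_iff[THEN iffD2]) (simp add: r_def)
  have N_le: "N k \<le> r k" for k
    unfolding r_def by (simp add: trans_le_add1 member_le_sum)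
  define d where "d k x = u (r (Suc k)) x - u (r k) x" for k x
  have [measurable]: "d k \<in> borel_measurable M" for k
    unfolding d_def by measurable
  have d: "(\<integral>\<^sup>+x. ennreal (2^k * (d k x)\<^sup>2) \<partial>M) \<le> ennreal ((1/2)^k)" for k
  proof -
    have "(\<integral>\<^sup>+x. ennreal (2^k * (d k x)\<^sup>2) \<partial>M) = ennreal (2^k) * (\<integral>\<^sup>+x. ennreal ((d k x)\<^sup>2) \<partial>M)"
      by (subst nn_integral_cmult[symmetric]) (auto simp: ennreal_mult)
    also have "\<dots> \<le> ennreal (2^k) * ennreal ((1/4)^k)"
      unfolding d_def using N[OF N_le, of k "r (Suc k)"] r
      by (intro mult_left_mono) (auto simp: strict_mono_less_eq)
    also have "\<dots> = ennreal ((1/2)^k)"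
      by (subst ennreal_mult[symmetric]) (auto simp flip: power_mult_distrib)
    finally show ?thesis .
  qed
  have "(\<integral>\<^sup>+x. (\<Sum>k. ennreal (2^k * (d k x)\<^sup>2)) \<partial>M) = (\<Sum>k. \<integral>\<^sup>+x. ennreal (2^k * (d k x)\<^sup>2) \<partial>M)"
    by (rule nn_integral_suminf) simp
  also have "\<dots> \<le> (\<Sum>k. ennreal ((1/2)^k))"
    by (intro suminf_le d) auto
  also have "\<dots> < \<infinity>"
    by (subst suminf_ennreal2) (auto intro: summable_geometric)
  finally have "AE x in M. (\<Sum>k. ennreal (2^k * (d k x)\<^sup>2)) \<noteq> \<infinity>"
    by (intro nn_integral_PInf_AE) auto
  then have "AE x in M. convergent (\<lambda>k. u (r k) x)"
  proof eventually_elim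
    case (elim x)
    have s: "summable (\<lambda>k. 2^k * (d k x)\<^sup>2)"
      using elim by (intro summable_suminf_not_top) auto
    \<comment> \<open>The inequality of arithmetic and geometric means, with weights chosen so that
      both terms are summable.\<close>
    have "norm (d k x) \<le> (1/2)^k + 2^k * (d k x)\<^sup>2" for k
    proof -
      have "0 \<le> (1/2)^k * (1 - 2^k * \<bar>d k x\<bar>)\<^sup>2" by simp
      also have "\<dots> = (1/2)^k - 2 * \<bar>d k x\<bar> + 2^k * (d k x)\<^sup>2"
        by (simp add: power2_eq_square algebra_simps power_divide)
      finally show ?thesis by simp
    qed
    then have "summable (\<lambda>k. d k x)"
      by (intro summable_comparison_test'[OF summable_add[OF summable_geometric s]]) auto
    then have "convergent (\<lambda>n. (\<Sum>k<n. d k x))"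
      by (simp add: summable_iff_convergent)
    moreover have "(\<Sum>k<n. d k x) = u (r n) x - u (r 0) x" for n
      unfolding d_def by (rule sum_lessThan_telescope)
    ultimately have "convergent (\<lambda>n. u (r n) x - u (r 0) x)" by simp
    then show ?case
      using convergent_add[OF _ convergent_const[of "u (r 0) x"]] by fastforce
  qed
  with r show ?thesis by (rule that)
qed

section \<open>Specifications, Gibbs measures and tail limits\<close>

text \<open>The formalism of statistical mechanics, where \<open>J n\<close> would be the events
  outside the \<open>n\<close>-th volume. In the application it consists of the
  \<open>K n\<close>-invariant sets and \<open>A n x\<close> lives on the \<open>K n\<close>-orbit
  of \<open>x\<close>.\<close>

locale gibbs_specification =
  fixes X :: "'a measure" and J :: "nat \<Rightarrow> 'a measure" and A :: "nat \<Rightarrow> 'a \<Rightarrow> 'a measure"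
  assumes subalg: "subalgebra X (J n)"
    and decreasing: "sets (J (Suc n)) \<subseteq> sets (J n)"
    and kernel: "A n \<in> J n \<rightarrow>\<^sub>M prob_algebra X"
    and proper: "B \<in> sets (J n) \<Longrightarrow> x \<in> B \<Longrightarrow> emeasure (A n x) B = 1"
begin

definition tail :: "'a measure" where
  "tail = sigma (space X) (\<Inter>n. sets (J n))"

text \<open>The DLR equations in the weak form of stationarity. Properness strengthens them to the
  statement that \<open>A n\<close> is a conditional probability given \<open>J n\<close>.\<close>

definition gibbs :: "'a measure \<Rightarrow> bool" where
  "gibbs \<Theta> \<longleftrightarrow> \<Theta> \<in> space (prob_algebra X) \<and>
     (\<forall>n. \<forall>C\<in>sets X. (\<integral>\<^sup>+y. emeasure (A n y) C \<partial>\<Theta>) = emeasure \<Theta> C)"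

lemma space_J [simp]: "space (J n) = space X"
  using subalg[of n] by (simp add: subalgebra_def)

lemma sets_J: "sets (J n) \<subseteq> sets X"
  using subalg[of n] by (simp add: subalgebra_def)

lemma antimono_J: "m \<le> n \<Longrightarrow> sets (J n) \<subseteq> sets (J m)"
  by (rule lift_Suc_antimono_le[of "\<lambda>n. sets (J n)"]) (use decreasing in auto)

lemma sets_tail: "sets tail = (\<Inter>n. sets (J n))"
proof -
  have "sigma_algebra (space X) (\<Inter>n. sets (J n))"
  proof (rule sigma_algebra_iff2[THEN iffD2], intro conjI allI impI ballI)
    show "(\<Inter>n. sets (J n)) \<subseteq> Pow (space X)"
      using sets.sets_into_space[of _ "J 0"] by auto
    show "space X - s \<in> (\<Inter>n. sets (J n))" if "s \<in> (\<Inter>n. sets (J n))" for s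
      using that by auto (metis space_J sets.compl_sets)
  qed auto
  then show ?thesis
    unfolding tail_def by (metis sigma_algebra.sets_measure_of_eq)
qed

lemma space_tail [simp]: "space tail = space X"
  unfolding tail_def by (rule space_measure_of) (use sets.sets_into_space[of _ "J 0"] in auto)

lemma tail_subalg: "subalgebra X tail"
  using sets_J by (auto simp: subalgebra_def sets_tail)

lemma measurable_J_D: "f \<in> measurable (J n) N \<Longrightarrow> f \<in> measurable X N"
  using measurable_from_subalg[OF subalg] .

lemma measurable_tail_D: "f \<in> measurable tail N \<Longrightarrow> f \<in> measurable X N"
  using measurable_from_subalg[OF tail_subalg] .

lemma measurable_J_mono: "f \<in> measurable (J n) N \<Longrightarrow> m \<le> n \<Longrightarrow> f \<in> measurable (J m) N"
  by (rule measurable_from_subalg) (simp_all add: subalgebra_def antimono_J)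

lemma measurable_tailI:
  assumes "\<And>n. f \<in> measurable (J n) N"
  shows "f \<in> measurable tail N"
  using assms by (auto simp: measurable_def sets_tail)

lemma kernel_emeasure:
  "C \<in> sets X \<Longrightarrow> (\<lambda>y. emeasure (A n y) C) \<in> borel_measurable (J n)"
  using measurable_compose[OF measurable_prob_algebraD[OF kernel] measurable_emeasure_subprob_algebra] .

lemma kernel_measure:
  "C \<in> sets X \<Longrightarrow> (\<lambda>y. measure (A n y) C) \<in> borel_measurable (J n)"
  using measurable_compose[OF kernel measurable_measure_prob_algebra] .

lemmas [measurable] = kernel_emeasure[THEN measurable_J_D] kernel_measure[THEN measurable_J_D]

lemma kernel_space: "x \<in> space X \<Longrightarrow> prob_space (A n x) \<and> sets (A n x) = sets X"
  using measurable_space[OF kernel, of x n] by (simp add: space_prob_algebra)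

text \<open>By properness \<open>A n x\<close> gives full mass to \<open>B\<close> or to its
  complement, whichever contains \<open>x\<close>.\<close>

lemma kernel_Int:
  assumes "x \<in> space X" "B \<in> sets (J n)" "C \<in> sets X"
  shows "emeasure (A n x) (B \<inter> C) = indicator B x * emeasure (A n x) C"
proof -
  interpret prob_space "A n x" using kernel_space[OF assms(1)] by simp
  have sets: "sets (A n x) = sets X" using kernel_space[OF assms(1)] by simp
  have null: "emeasure (A n x) (D - B) = 0" if "x \<in> B" "B \<in> sets (J n)" "D \<in> sets X" for B D
  proof -
    have B: "B \<in> sets X" using sets_J that by auto
    have "emeasure (A n x) (space X - B) = 0"
      using emeasure_compl[of B "A n x"] proper[OF that(2,1)] B emeasure_space_1 sets_eq_imp_space_eq[OF sets] sets
      by auto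
    then show ?thesis
      using B that(3) sets sets.sets_into_space[OF that(3)]
      by (intro emeasure_eq_0[of "space X - B" "A n x" "D - B"]) auto
  qed
  have B: "B \<in> sets X" using sets_J assms by auto
  show ?thesis
  proof (cases "x \<in> B")
    case True
    have "emeasure (A n x) C = emeasure (A n x) (B \<inter> C) + emeasure (A n x) (C - B)"
      using B assms sets by (subst plus_emeasure) (auto intro!: arg_cong[where f="emeasure _"])
    then show ?thesis using null[OF True assms(2,3)] True by simp
  next
    case False
    have "space X - B \<in> sets (J n)"
      using assms(2) by (metis sets.compl_sets space_J)
    then have "emeasure (A n x) (C - (space X - B)) = 0"
      using False assms by (intro null) auto
    moreover have "C - (space X - B) = B \<inter> C"
      using sets.sets_into_space[OF assms(3)] by auto
    ultimately show ?thesis using False by simp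
  qed
qed

lemma gibbsD:
  assumes "gibbs \<Theta>"
  shows "prob_space \<Theta>" "sets \<Theta> = sets X" "space \<Theta> = space X"
  using assms sets_eq_imp_space_eq[of \<Theta> X] by (auto simp: gibbs_def space_prob_algebra)

text \<open>This says that \<open>emeasure (A n y) C\<close> is a version of the conditional
  probability of \<open>C\<close> given \<open>J n\<close>. Stationarity applied to
  \<open>B \<inter> C\<close> and \<open>kernel_Int\<close> give equality of two densities on
  \<open>J n\<close>, and measures that agree on \<open>J n\<close> integrate \<open>v\<close>
  alike.\<close>

lemma gibbs_nn_integral:
  assumes "gibbs \<Theta>" "C \<in> sets X" and v: "v \<in> borel_measurable (J n)"
  shows "(\<integral>\<^sup>+y. emeasure (A n y) C * v y \<partial>\<Theta>) = (\<integral>\<^sup>+y. indicator C y * v y \<partial>\<Theta>)"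
proof -
  note [measurable_cong] = gibbsD(2)[OF assms(1)]
  note [measurable] = assms(2) measurable_J_D[OF v]
  have sp: "space \<Theta> = space X" by (rule gibbsD[OF assms(1)])
  let ?N1 = "density \<Theta> (\<lambda>y. emeasure (A n y) C)" and ?N2 = "density \<Theta> (indicator C)"
  have sub: "subalgebra ?N1 (J n)" "subalgebra ?N2 (J n)"
    using subalg[of n] sp gibbsD(2)[OF assms(1)] by (auto simp: subalgebra_def)
  have "restr_to_subalg ?N1 (J n) = restr_to_subalg ?N2 (J n)"
  proof (rule measure_eqI)
    fix B assume "B \<in> sets (restr_to_subalg ?N1 (J n))"
    then have B: "B \<in> sets (J n)" using sub by (simp add: sets_restr_to_subalg)
    then have [measurable]: "B \<in> sets X" using sets_J by auto
    have "emeasure ?N1 B = (\<integral>\<^sup>+y. emeasure (A n y) (B \<inter> C) \<partial>\<Theta>)"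
      by (subst emeasure_density) (auto intro!: nn_integral_cong simp: kernel_Int[OF _ B assms(2)] sp mult.commute)
    also have "\<dots> = emeasure \<Theta> (B \<inter> C)"
      using assms by (auto simp: gibbs_def)
    also have "\<dots> = emeasure ?N2 B"
      by (subst emeasure_density) (auto simp: Int_commute simp flip: indicator_inter_arith)
    finally show "emeasure (restr_to_subalg ?N1 (J n)) B = emeasure (restr_to_subalg ?N2 (J n)) B"
      using B sub by (simp add: emeasure_restr_to_subalg)
  qed (use sub in \<open>simp add: sets_restr_to_subalg\<close>)
  then have "(\<integral>\<^sup>+y. v y \<partial>?N1) = (\<integral>\<^sup>+y. v y \<partial>?N2)"
    using nn_integral_subalgebra2[OF sub(1) v] nn_integral_subalgebra2[OF sub(2) v] by simp
  then show ?thesis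
    by (simp add: nn_integral_density)
qed

lemma kernel_bounds: "x \<in> space X \<Longrightarrow> 0 \<le> measure (A n x) C \<and> measure (A n x) C \<le> 1"
  using kernel_space[of x n] prob_space.prob_le_1 by auto

lemma gibbs_integral:
  assumes "gibbs \<Theta>" "C \<in> sets X" and v: "v \<in> borel_measurable (J n)"
    and v01: "\<And>y. y \<in> space X \<Longrightarrow> 0 \<le> v y \<and> v y \<le> (1::real)"
  shows "(\<integral>y. measure (A n y) C * v y \<partial>\<Theta>) = (\<integral>y. indicator C y * v y \<partial>\<Theta>)"
proof -
  note [measurable_cong] = gibbsD(2)[OF assms(1)]
  note [measurable] = assms(2) measurable_J_D[OF v]
  have sp: "space \<Theta> = space X" by (rule gibbsD[OF assms(1)])
  have "(\<integral>\<^sup>+y. ennreal (measure (A n y) C * v y) \<partial>\<Theta>) = (\<integral>\<^sup>+y. emeasure (A n y) C * ennreal (v y) \<partial>\<Theta>)"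
    using kernel_space v01
    by (intro nn_integral_cong) (auto simp: sp finite_measure.emeasure_eq_measure prob_space_def ennreal_mult)
  also have "\<dots> = (\<integral>\<^sup>+y. indicator C y * ennreal (v y) \<partial>\<Theta>)"
    using assms by (intro gibbs_nn_integral) auto
  also have "\<dots> = (\<integral>\<^sup>+y. ennreal (indicator C y * v y) \<partial>\<Theta>)"
    by (intro nn_integral_cong) (auto split: split_indicator)
  finally show ?thesis
    using v01 kernel_bounds
    by (subst (1 2) integral_eq_nn_integral) (auto simp: sp)
qed

lemma gibbs_set_integral:
  assumes "gibbs \<Theta>" "B \<in> sets (J n)" "C \<in> sets X"
  shows "(\<integral>y. measure (A n y) C * indicator B y \<partial>\<Theta>) = measure \<Theta> (B \<inter> C)"
proof -
  have "B \<inter> C \<in> sets \<Theta>"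
    using assms sets_J gibbsD(2)[OF assms(1)] by auto
  moreover have "(\<integral>y. measure (A n y) C * indicator B y \<partial>\<Theta>) = (\<integral>y. indicator C y * indicator B y \<partial>\<Theta>)"
    using assms by (intro gibbs_integral) auto
  ultimately show ?thesis
    using sets.sets_into_space by (simp add: Int_commute Int_absorb1 flip: indicator_inter_arith)
qed

text \<open>Under a Gibbs measure \<open>n \<mapsto> A n y C\<close> is a reverse martingale; this is the orthogonality of its increments.\<close>

lemma gibbs_L2_increment:
  assumes "gibbs \<Theta>" "C \<in> sets X" "m \<le> n"
  defines "u \<equiv> \<lambda>n y. measure (A n y) C"
  shows "has_bochner_integral \<Theta> (\<lambda>y. (u n y - u m y)\<^sup>2) ((\<integral>y. (u m y)\<^sup>2 \<partial>\<Theta>) - (\<integral>y. (u n y)\<^sup>2 \<partial>\<Theta>))"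
proof -
  note [measurable_cong] = gibbsD(2)[OF assms(1)]
  note [measurable] = assms(2)
  interpret prob_space \<Theta> by (rule gibbsD[OF assms(1)])
  have sp: "space \<Theta> = space X" by (rule gibbsD[OF assms(1)])
  have u: "u n \<in> borel_measurable (J n)" for n
    unfolding u_def by (rule kernel_measure[OF assms(2)])
  have [measurable]: "u n \<in> borel_measurable X" for n
    using u measurable_J_D by blast
  have u01: "y \<in> space X \<Longrightarrow> 0 \<le> u n y \<and> u n y \<le> 1" for n y
    unfolding u_def by (rule kernel_bounds)
  have int: "integrable \<Theta> (\<lambda>y. u k y * u l y)" for k l
    by (rule integrable_const_bound[where B=1]) (auto intro!: AE_I2 mult_le_one simp: u01 sp)
  \<comment> \<open>For \<open>k \<le> n\<close> the function \<open>u n\<close> is also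
    \<open>J k\<close>-measurable, so \<open>u k\<close> pairs with it as the indicator of
    \<open>C\<close> does. With \<open>k = m\<close> and \<open>k = n\<close> the mixed term equals
    the square of \<open>u n\<close>.\<close>
  have eq: "(\<integral>y. u k y * u n y \<partial>\<Theta>) = (\<integral>y. indicator C y * u n y \<partial>\<Theta>)" if "k \<le> n" for k
    using assms(1,2) u01 measurable_J_mono[OF u that] unfolding u_def
    by (intro gibbs_integral) auto
  have "(\<integral>y. (u n y - u m y)\<^sup>2 \<partial>\<Theta>) = (\<integral>y. u n y * u n y - 2 * (u m y * u n y) + u m y * u m y \<partial>\<Theta>)"
    by (intro Bochner_Integration.integral_cong) (auto simp: power2_eq_square algebra_simps)
  also have "\<dots> = (\<integral>y. u n y * u n y \<partial>\<Theta>) - 2 * (\<integral>y. u m y * u n y \<partial>\<Theta>) + (\<integral>y. u m y * u m y \<partial>\<Theta>)"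
    using int by simp
  also have "\<dots> = (\<integral>y. (u m y)\<^sup>2 \<partial>\<Theta>) - (\<integral>y. (u n y)\<^sup>2 \<partial>\<Theta>)"
    using eq[OF \<open>m \<le> n\<close>] eq[of n] by (simp add: power2_eq_square)
  finally show ?thesis
    using int by (simp add: has_bochner_integral_iff power2_eq_square algebra_simps)
qed

text \<open>The integrals \<open>a n\<close> decrease and are nonnegative, and by
  \<open>gibbs_L2_increment\<close> their differences are the squared L2 distances; so the sequence
  is Cauchy. The limit \<open>F\<close> is a version of the conditional probability of
  \<open>C\<close> given the tail.\<close>

lemma tail_limit:
  assumes P: "gibbs P" and C: "C \<in> sets X"
  shows "\<exists>r F. strict_mono (r :: nat \<Rightarrow> nat) \<and> F \<in> borel_measurable tail \<and> (\<forall>x. 0 \<le> F x \<and> F x \<le> (1::real)) \<and>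
    (AE x in P. (\<lambda>k. measure (A (r k) x) C) \<longlonglongrightarrow> F x) \<and>
    (\<forall>B\<in>sets tail. (\<integral>x. F x * indicator B x \<partial>P) = measure P (B \<inter> C))"
proof -
  note [measurable_cong] = gibbsD(2)[OF P]
  note [measurable] = C
  interpret prob_space P by (rule gibbsD[OF P])
  have sp: "space P = space X" by (rule gibbsD[OF P])
  define u where "u n y = measure (A n y) C" for n y
  have u: "u n \<in> borel_measurable (J n)" for n
    unfolding u_def by (rule kernel_measure[OF C])
  have [measurable]: "u n \<in> borel_measurable X" for n
    using u measurable_J_D by blast
  have u01: "y \<in> space X \<Longrightarrow> 0 \<le> u n y \<and> u n y \<le> 1" for n y
    unfolding u_def by (rule kernel_bounds)
  define a where "a n = (\<integral>y. (u n y)\<^sup>2 \<partial>P)" for n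
  have inc: "has_bochner_integral P (\<lambda>y. (u n y - u m y)\<^sup>2) (a m - a n)" if "m \<le> n" for m n
    unfolding a_def u_def by (rule gibbs_L2_increment[OF P C that])
  have "a n \<le> a m" if "m \<le> n" for m n
  proof -
    have "0 \<le> (\<integral>y. (u n y - u m y)\<^sup>2 \<partial>P)" by simp
    moreover have "(\<integral>y. (u n y - u m y)\<^sup>2 \<partial>P) = a m - a n"
      using inc[OF that] by (simp add: has_bochner_integral_iff)
    ultimately show ?thesis by linarith
  qed
  then have "decseq a" by (simp add: decseq_def)
  moreover have "0 \<le> a n" for n by (simp add: a_def)
  ultimately have "convergent a"
    using decseq_convergent[of a 0] unfolding convergent_def by metis
  then have "Cauchy a" by (rule convergent_Cauchy)
  have "\<exists>N. \<forall>m\<ge>N. \<forall>n\<ge>m. (\<integral>\<^sup>+x. ennreal ((u n x - u m x)\<^sup>2) \<partial>P) \<le> ennreal e" if "0 < e" for e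
  proof -
    obtain N where N: "\<And>m n. N \<le> m \<Longrightarrow> N \<le> n \<Longrightarrow> norm (a m - a n) < e"
      using CauchyD[OF \<open>Cauchy a\<close> \<open>0 < e\<close>] by blast
    have "a m - a n \<le> e" if "N \<le> m" "m \<le> n" for m n
      using N[of m n] that by auto
    then show ?thesis
      using inc by (auto simp: has_bochner_integral_iff nn_integral_eq_integral intro!: exI[of _ N] ennreal_leI)
  qed
  then obtain r where r: "strict_mono r" "AE x in P. convergent (\<lambda>k. u (r k) x)"
    by (rule AE_convergent_subseq[of u, rotated]) auto
  \<comment> \<open>Clamping gives the bounds everywhere, since \<open>lim\<close> is unspecified
    where the sequence diverges.\<close>
  define F where "F x = max 0 (min 1 (lim (\<lambda>k. u (r k) x)))" for x
  have F01: "0 \<le> F x \<and> F x \<le> 1" for x by (simp add: F_def)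
  have F_tail: "F \<in> borel_measurable tail"
  proof (rule measurable_tailI)
    fix n
    \<comment> \<open>After the first \<open>n\<close> terms are dropped, only
      \<open>J n\<close>-measurable functions remain, and the limit is unchanged.\<close>
    have "n \<le> r (k + n)" for k
      using strict_mono_imp_increasing[OF r(1), of "k + n"] by simp
    then have [measurable]: "u (r (k + n)) \<in> borel_measurable (J n)" for k
      using measurable_J_mono u by blast
    have "F = (\<lambda>x. max 0 (min 1 (lim (\<lambda>k. u (r (k + n)) x))))"
      using lim_shift[of "\<lambda>k. u (r k) x" n for x] by (simp add: F_def fun_eq_iff)
    then show "F \<in> borel_measurable (J n)" by simp
  qed
  have [measurable]: "F \<in> borel_measurable X"
    by (rule measurable_tail_D[OF F_tail])
  have lim: "AE x in P. (\<lambda>k. u (r k) x) \<longlonglongrightarrow> F x"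
    using r(2) AE_space
  proof eventually_elim
    case (elim x)
    then have *: "(\<lambda>k. u (r k) x) \<longlonglongrightarrow> lim (\<lambda>k. u (r k) x)"
      by (simp add: convergent_LIMSEQ_iff)
    moreover have "0 \<le> lim (\<lambda>k. u (r k) x)" "lim (\<lambda>k. u (r k) x) \<le> 1"
      using LIMSEQ_le_const[OF *, of 0] LIMSEQ_le_const2[OF *, of 1] u01 elim sp by auto
    ultimately show ?case by (simp add: F_def)
  qed
  have "(\<integral>x. F x * indicator B x \<partial>P) = measure P (B \<inter> C)" if B: "B \<in> sets tail" for B
  proof -
    have [measurable]: "B \<in> sets X" using B tail_subalg by (auto simp: subalgebra_def)
    have "(\<lambda>k. \<integral>x. u (r k) x * indicator B x \<partial>P) \<longlonglongrightarrow> (\<integral>x. F x * indicator B x \<partial>P)"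
    proof (rule integral_dominated_convergence[where w="\<lambda>_. 1"])
      show "AE x in P. (\<lambda>k. u (r k) x * indicator B x) \<longlonglongrightarrow> F x * indicator B x"
        using lim by eventually_elim (intro tendsto_intros)
      show "AE x in P. norm (u (r k) x * indicator B x) \<le> 1" for k
        using u01 sp by (auto intro!: split: split_indicator)
    qed auto
    moreover have "(\<integral>x. u (r k) x * indicator B x \<partial>P) = measure P (B \<inter> C)" for k
      unfolding u_def using B by (intro gibbs_set_integral P C) (auto simp: sets_tail)
    ultimately show ?thesis by (simp add: LIMSEQ_const_iff)
  qed
  with r(1) F_tail F01 lim show ?thesis
    unfolding u_def by blast
qed

end

section \<open>The regular conditional distribution given the tail\<close>

lemma AE_le_of_set_integral_le:
  fixes f g :: "'a \<Rightarrow> real"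
  assumes N: "subalgebra M N" and "f \<in> borel_measurable N" "g \<in> borel_measurable N"
    and "integrable M f" "integrable M g"
    and le: "\<And>B. B \<in> sets N \<Longrightarrow> (\<integral>x. f x * indicator B x \<partial>M) \<le> (\<integral>x. g x * indicator B x \<partial>M)"
  shows "AE x in M. f x \<le> g x"
proof -
  note [measurable] = assms(2,3)
  define B where "B = {x\<in>space N. g x < f x}"
  have B: "B \<in> sets N" unfolding B_def by measurable
  then have BM[measurable]: "B \<in> sets M" using N by (auto simp: subalgebra_def)
  have sp: "space N = space M" using N by (auto simp: subalgebra_def)
  have int: "integrable M (\<lambda>x. f x * indicator B x)" "integrable M (\<lambda>x. g x * indicator B x)"
    using assms(4,5) BM by (auto intro: integrable_real_mult_indicator)
  let ?d = "\<lambda>x. f x * indicator B x - g x * indicator B x"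
  have nonneg: "0 \<le> ?d x" for x
    by (auto simp: B_def split: split_indicator)
  have "(\<integral>x. ?d x \<partial>M) \<le> 0"
    using le[OF B] int by simp
  moreover have "0 \<le> (\<integral>x. ?d x \<partial>M)"
    using nonneg by (rule Bochner_Integration.integral_nonneg)
  ultimately have "(\<integral>x. ?d x \<partial>M) = 0" by linarith
  then have "AE x in M. ?d x = 0"
    using int nonneg by (subst (asm) integral_nonneg_eq_0_iff_AE) auto
  then show ?thesis
    using AE_space by eventually_elim (auto simp: B_def sp split: split_indicator_asm)
qed

lemma AE_eq_of_set_nn_integral_eq:
  assumes "prob_space M" and N: "subalgebra M N"
    and f: "f \<in> borel_measurable N" and g: "g \<in> borel_measurable N"
    and eq: "\<And>B. B \<in> sets N \<Longrightarrow> (\<integral>\<^sup>+x. f x * indicator B x \<partial>M) = (\<integral>\<^sup>+x. g x * indicator B x \<partial>M)"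
  shows "AE x in M. f x = g x"
proof -
  let ?R = "restr_to_subalg M N"
  interpret R: prob_space ?R
    by (rule prob_space_restr_to_subalg[OF N assms(1)])
  have fR: "f \<in> borel_measurable ?R" and gR: "g \<in> borel_measurable ?R"
    using measurable_in_subalg[OF N] f g by auto
  have "density ?R f = density ?R g"
  proof (rule measure_eqI)
    fix B assume "B \<in> sets (density ?R f)"
    then have B: "B \<in> sets N" "B \<in> sets ?R" by (auto simp: sets_restr_to_subalg[OF N])
    have "(\<integral>\<^sup>+x. h x * indicator B x \<partial>?R) = (\<integral>\<^sup>+x. h x * indicator B x \<partial>M)"
      if "h \<in> borel_measurable N" for h
      using that B by (intro nn_integral_subalgebra2[OF N]) auto
    then show "emeasure (density ?R f) B = emeasure (density ?R g) B"
      using eq[OF B(1)] f g fR gR B(2) by (simp add: emeasure_density)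
  qed simp
  then have "AE x in ?R. f x = g x"
    using R.density_unique_iff[OF fR gR] by simp
  then show ?thesis
    by (rule AE_restr_to_subalg[OF N])
qed

text \<open>A coordinate \<open>h\<close> identifies \<open>X\<close> with the unit interval, so
  that kernels on \<open>X\<close> can be built from distribution functions. Its inverse
  \<open>g\<close> is extended to all reals.\<close>

locale standard_gibbs_specification = gibbs_specification +
  fixes h :: "'a \<Rightarrow> real" and g :: "real \<Rightarrow> 'a"
  assumes h: "h \<in> X \<rightarrow>\<^sub>M borel" and g: "g \<in> borel \<rightarrow>\<^sub>M X"
    and h_range: "x \<in> space X \<Longrightarrow> h x \<in> {0..1}"
    and g_h: "x \<in> space X \<Longrightarrow> g (h x) = x" and h_g: "t \<in> {0..1} \<Longrightarrow> h (g t) = t"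
begin

lemmas [measurable] = h g

text \<open>A countable pi-system that generates \<open>sets X\<close>. Almost sure statements are
  made for these sets only, so that countably many null sets are discarded.\<close>

definition C :: "rat \<Rightarrow> 'a set" where
  "C q = {x\<in>space X. h x \<le> of_rat q}"

lemma sets_C [measurable, simp]: "C q \<in> sets X"
  unfolding C_def by measurable

lemma C_mono: "p \<le> q \<Longrightarrow> C p \<subseteq> C q"
  using of_rat_less_eq[of p q] by (auto simp: C_def intro: order_trans)

lemma h_bounds: "x \<in> space X \<Longrightarrow> 0 \<le> h x \<and> h x \<le> 1"
  using h_range[of x] by simp

lemma C_neg:
  assumes "q < 0" shows "C q = {}"
proof (rule equals0I)
  fix x assume "x \<in> C q"
  then have "0 \<le> h x" "h x \<le> of_rat q" by (auto simp: C_def h_bounds)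
  moreover have "(of_rat q :: real) < 0" using assms by simp
  ultimately show False by linarith
qed

lemma C_top:
  assumes "1 \<le> q" shows "C q = space X"
proof -
  have q: "1 \<le> (of_rat q :: real)" using assms by simp
  have "h x \<le> of_rat q" if "x \<in> space X" for x
    using h_bounds[OF that] q by linarith
  then show ?thesis by (auto simp: C_def)
qed

lemma Int_C: "C p \<inter> C q = C (min p q)"
  using C_mono[of p q] C_mono[of q p] by (auto simp: min_def)

lemma Inter_C: "(\<Inter>n. C (q + 1 / of_nat (Suc n))) = C q"
proof (intro antisym subsetI)
  fix x assume x: "x \<in> (\<Inter>n. C (q + 1 / of_nat (Suc n)))"
  have "h x \<le> of_rat q + 1 / real (Suc n)" for n
    using x by (auto simp: C_def of_rat_add of_rat_divide simp del: of_nat_Suc)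
  then have "h x \<le> of_rat q"
    by (intro LIMSEQ_le_const[OF LIMSEQ_inverse_real_of_nat_add]) (auto simp: inverse_eq_divide)
  then show "x \<in> C q" using x by (auto simp: C_def)
qed (auto intro: C_mono[THEN subsetD, rotated])

text \<open>\<open>h\<close> is measurable for the sigma-algebra generated by the sets
  \<open>C q\<close>, and every measurable \<open>B\<close> is the preimage under \<open>h\<close>
  of the Borel set of reals that \<open>g\<close> maps into \<open>B\<close>.\<close>

lemma sets_X_eq: "sets X = sigma_sets (space X) (range C)"
proof
  show "sigma_sets (space X) (range C) \<subseteq> sets X"
    by (rule sets.sigma_sets_subset) auto
  have C_real: "{x\<in>space X. h x \<le> a} \<in> sigma_sets (space X) (range C)" for a
  proof -
    have "{x\<in>space X. h x \<le> a} = (\<Inter>q\<in>{q. a < of_rat q}. C q)"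
    proof (intro antisym subsetI)
      fix x assume x: "x \<in> (\<Inter>q\<in>{q. a < of_rat q}. C q)"
      have "h x \<le> a"
      proof (rule ccontr)
        assume "\<not> h x \<le> a"
        then obtain q where "a < of_rat q" "of_rat q < h x"
          using of_rat_dense[of a "h x"] by auto
        then show False using x by (auto simp: C_def)
      qed
      moreover obtain q where "a < of_rat q" using of_rat_dense[of a "a + 1"] by auto
      ultimately show "x \<in> {x\<in>space X. h x \<le> a}" using x by (auto simp: C_def)
    qed (auto simp: C_def)
    moreover have "\<dots> \<in> sigma_sets (space X) (range C)"
    proof -
      interpret sigma_algebra "space X" "sigma_sets (space X) (range C)"
        by (rule sigma_algebra_sigma_sets) (auto simp: C_def)
      have "{q. a < of_rat q} \<noteq> {}" using of_rat_dense[of a "a + 1"] by auto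
      then show ?thesis by (intro countable_INT') auto
    qed
    ultimately show ?thesis by simp
  qed
  have C_Pow: "range C \<subseteq> Pow (space X)" by (auto simp: C_def)
  have hm: "h \<in> measurable (sigma (space X) (range C)) borel"
    using C_real C_Pow by (intro borel_measurableI_le) (simp add: space_measure_of sets_measure_of)
  show "sets X \<subseteq> sigma_sets (space X) (range C)"
  proof
    fix B assume B: "B \<in> sets X"
    then have "g -` B \<in> sets borel"
      using measurable_sets[OF g B] by simp
    from measurable_sets[OF hm this] have "h -` (g -` B) \<inter> space X \<in> sigma_sets (space X) (range C)"
      using C_Pow by (simp add: space_measure_of sets_measure_of)
    moreover have "h -` (g -` B) \<inter> space X = B"
      using sets.sets_into_space[OF B] g_h by auto
    ultimately show "B \<in> sigma_sets (space X) (range C)" by simp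
  qed
qed

lemma Int_stable_C: "Int_stable (range C)"
  by (auto simp: Int_stable_def Int_C)

lemma measure_eqI_C:
  assumes "sets M = sets X" "sets N = sets X" "\<And>q. emeasure M (C q) = emeasure N (C q)"
    "emeasure M (space X) \<noteq> \<infinity>"
  shows "M = N"
proof (rule measure_eqI_generator_eq[OF Int_stable_C, where \<Omega>="space X" and A="\<lambda>_. C 1"])
  show "range C \<subseteq> Pow (space X)" by (auto simp: C_def)
  show "sets M = sigma_sets (space X) (range C)" "sets N = sigma_sets (space X) (range C)"
    using assms sets_X_eq by auto
qed (use assms in \<open>auto simp: C_top intro: range_eqI[of _ _ 1]\<close>)

text \<open>The functions \<open>F q\<close> behave like a distribution function in \<open>q\<close>
  up to countably many null sets. Where all conditions hold, the associated law on the line is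
  transported to \<open>X\<close> by \<open>g\<close>.\<close>

lemma conditional_kernel:
  assumes P: "gibbs P"
    and F: "\<And>q. F q \<in> borel_measurable tail" and F01: "\<And>q x. 0 \<le> F q x \<and> F q x \<le> (1::real)"
    and FC: "\<And>q B. B \<in> sets tail \<Longrightarrow> (\<integral>x. F q x * indicator B x \<partial>P) = measure P (B \<inter> C q)"
  obtains \<kappa> where "\<kappa> \<in> tail \<rightarrow>\<^sub>M prob_algebra X" "AE x in P. \<forall>q. measure (\<kappa> x) (C q) = F q x"
proof -
  note [measurable_cong] = gibbsD(2)[OF P]
  interpret prob_space P by (rule gibbsD[OF P])
  have sp: "space P = space X" by (rule gibbsD[OF P])
  have sub: "subalgebra P tail"
    using tail_subalg sp gibbsD(2)[OF P] by (simp add: subalgebra_def)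
  note [measurable] = F
  have [measurable]: "F q \<in> borel_measurable P" for q
    using measurable_from_subalg[OF sub F] .
  have int: "integrable P (F q)" for q
    using F01 by (intro integrable_const_bound[where B=1]) auto
  have BP: "B \<in> sets tail \<Longrightarrow> B \<in> sets P" for B
    using sub by (auto simp: subalgebra_def)
  have mono: "AE x in P. F p x \<le> F q x" if "p \<le> q" for p q
  proof (rule AE_le_of_set_integral_le[OF sub F F int int])
    fix B assume B: "B \<in> sets tail"
    note [measurable] = BP[OF B]
    show "(\<integral>x. F p x * indicator B x \<partial>P) \<le> (\<integral>x. F q x * indicator B x \<partial>P)"
      unfolding FC[OF B] using C_mono[OF that] by (intro finite_measure_mono) auto
  qed
  have neg: "AE x in P. F q x = 0" if "q < 0" for q
  proof -
    have "AE x in P. F q x \<le> 0"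
      by (rule AE_le_of_set_integral_le[OF sub F _ int]) (auto simp: FC C_neg that)
    then show ?thesis by eventually_elim (use F01 in \<open>auto intro: antisym\<close>)
  qed
  have top: "AE x in P. F q x = 1" if "1 \<le> q" for q
  proof -
    have "AE x in P. 1 \<le> F q x"
    proof (rule AE_le_of_set_integral_le[OF sub _ F _ int])
      fix B assume B: "B \<in> sets tail"
      then show "(\<integral>x. 1 * indicator B x \<partial>P) \<le> (\<integral>x. F q x * indicator B x \<partial>P)"
        using BP[OF B] sets.sets_into_space[of B P] by (auto simp: FC C_top that sp Int_absorb2)
    qed auto
    then show ?thesis by eventually_elim (use F01 in \<open>auto intro: antisym\<close>)
  qed
  have right: "AE x in P. \<forall>n::nat. \<exists>p>q. F p x < F q x + 1 / Suc n" for q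
  proof -
    \<comment> \<open>Right continuity at \<open>q\<close>: the set integrals of the infimum
      \<open>G\<close> are at most those of \<open>F q\<close>, because
      \<open>C (q + 1 / of_nat (Suc k))\<close> decreases to \<open>C q\<close>.\<close>
    define G where "G x = (INF k. F (q + 1 / of_nat (Suc k)) x)" for x
    have bdd: "bdd_below (range (\<lambda>k. F (q + 1 / of_nat (Suc k)) x))" for x
      using F01 by (auto intro!: bdd_belowI[of _ 0])
    have G_le: "G x \<le> F (q + 1 / of_nat (Suc k)) x" for x k
      unfolding G_def by (intro cINF_lower bdd) auto
    have G0: "0 \<le> G x" for x
      unfolding G_def using F01 by (intro cINF_greatest) auto
    have G_tail[measurable]: "G \<in> borel_measurable tail"
      unfolding G_def using bdd by (intro borel_measurable_cINF) auto
    have [measurable]: "G \<in> borel_measurable P"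
      using measurable_from_subalg[OF sub G_tail] .
    have G1: "G x \<le> 1" for x
      using G_le[of x 0] F01[of "q + 1 / of_nat (Suc 0)" x] by linarith
    have intG: "integrable P G"
      using G0 G1 by (intro integrable_const_bound[where B=1]) auto
    have "AE x in P. G x \<le> F q x"
    proof (rule AE_le_of_set_integral_le[OF sub G_tail F intG int])
      fix B assume B: "B \<in> sets tail"
      note [measurable] = BP[OF B]
      have "(\<lambda>k. measure P (B \<inter> C (q + 1 / of_nat (Suc k)))) \<longlonglongrightarrow> measure P (\<Inter>k. B \<inter> C (q + 1 / of_nat (Suc k)))"
      proof (rule finite_Lim_measure_decseq)
        show "decseq (\<lambda>k. B \<inter> C (q + 1 / of_nat (Suc k)))"
          unfolding decseq_Suc_iff by (intro allI Int_mono C_mono order_refl add_left_mono divide_left_mono) auto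
      qed auto
      also have "(\<Inter>k. B \<inter> C (q + 1 / of_nat (Suc k))) = B \<inter> C q"
        using Inter_C[of q] by auto
      finally have lim: "(\<lambda>k. measure P (B \<inter> C (q + 1 / of_nat (Suc k)))) \<longlonglongrightarrow> measure P (B \<inter> C q)" .
      show "(\<integral>x. G x * indicator B x \<partial>P) \<le> (\<integral>x. F q x * indicator B x \<partial>P)"
        unfolding FC[OF B]
      proof (rule LIMSEQ_le_const[OF lim], intro exI allI impI)
        fix k :: nat
        have "(\<integral>x. G x * indicator B x \<partial>P) \<le> (\<integral>x. F (q + 1 / of_nat (Suc k)) x * indicator B x \<partial>P)"
          using intG int G_le by (intro integral_mono integrable_real_mult_indicator mult_right_mono) auto
        then show "(\<integral>x. G x * indicator B x \<partial>P) \<le> measure P (B \<inter> C (q + 1 / of_nat (Suc k)))"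
          by (simp add: FC[OF B])
      qed
    qed
    then show ?thesis
    proof eventually_elim
      case (elim x)
      show ?case
      proof
        fix n :: nat
        have "G x < F q x + 1 / Suc n" using elim by (simp add: add_strict_increasing2 le_less_trans)
        then obtain k where "F (q + 1 / of_nat (Suc k)) x < F q x + 1 / Suc n"
          unfolding G_def by (subst (asm) cINF_less_iff[OF _ bdd]) auto
        then show "\<exists>p>q. F p x < F q x + 1 / Suc n"
          by (intro exI[of _ "q + 1 / of_nat (Suc k)"]) auto
      qed
    qed
  qed
  \<comment> \<open>Only rational and natural quantifiers occur, which makes \<open>good\<close> a
    tail-measurable predicate.\<close>
  define good where "good x \<longleftrightarrow> (\<forall>p q. p \<le> q \<longrightarrow> F p x \<le> F q x) \<and> (\<forall>q. q < 0 \<longrightarrow> F q x = 0) \<and>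
      (\<forall>q. 1 \<le> q \<longrightarrow> F q x = 1) \<and> (\<forall>q. \<forall>n::nat. \<exists>p. q < p \<and> F p x < F q x + 1 / Suc n)" for x
  have [measurable]: "Measurable.pred tail good"
    unfolding good_def by measurable
  have AE_good: "AE x in P. good x"
    unfolding good_def using mono neg top right by (simp add: AE_all_countable AE_impI)
  have "\<exists>\<mu>. real_distribution \<mu> \<and> (\<forall>q. measure \<mu> {..of_rat q} = F q x) \<and> emeasure \<mu> {0..1} = 1" if "good x" for x
  proof (rule real_distribution_with_rational_cdf[of "\<lambda>q. F q x"])
    fix q and e :: real assume "0 < e"
    then obtain n where n: "1 / Suc n < e"
      using nat_approx_posE by blast
    obtain p where "q < p" "F p x < F q x + 1 / Suc n"
      using \<open>good x\<close> unfolding good_def by blast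
    then show "\<exists>p>q. F p x < F q x + e"
      using n by (intro exI[of _ p]) auto
  qed (use \<open>good x\<close> in \<open>auto simp: good_def\<close>)
  then obtain \<mu> where \<mu>: "\<And>x. good x \<Longrightarrow> real_distribution (\<mu> x)"
      "\<And>x q. good x \<Longrightarrow> measure (\<mu> x) {..of_rat q} = F q x" "\<And>x. good x \<Longrightarrow> emeasure (\<mu> x) {0..1} = 1"
    by metis
  \<comment> \<open>Off the good set any fixed probability measure serves as a default;
    \<open>P\<close> is at hand.\<close>
  define \<kappa> where "\<kappa> x = (if good x then distr (\<mu> x) X g else P)" for x
  have \<kappa>: "prob_space (\<kappa> x)" "sets (\<kappa> x) = sets X" for x
    using gibbsD(2)[OF P] prob_space_axioms
    by (auto simp: \<kappa>_def real_distribution_def real_distribution_axioms_def dest!: \<mu>(1) intro!: prob_space.prob_space_distr)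
  have \<kappa>C: "measure (\<kappa> x) (C q) = F q x" if "good x" for x q
  proof -
    interpret \<mu>: real_distribution "\<mu> x" by (rule \<mu>[OF that])
    have 01: "AE t in \<mu> x. t \<in> {0..1}"
      using \<mu>(3)[OF that] by (intro \<mu>.AE_prob_1) (simp add: \<mu>.emeasure_eq_measure)
    have "measure (\<kappa> x) (C q) = measure (\<mu> x) {t. h (g t) \<le> of_rat q}"
      using measurable_space[OF g] that by (simp add: \<kappa>_def measure_distr) (auto simp: C_def vimage_def)
    also have "\<dots> = measure (\<mu> x) {..of_rat q}"
      using 01 h_g by (intro \<mu>.finite_measure_eq_AE) auto
    finally show ?thesis using \<mu>(2)[OF that] by simp
  qed
  have "\<kappa> \<in> tail \<rightarrow>\<^sub>M prob_algebra X"
  proof (rule measurable_prob_algebra_generated[OF sets_X_eq Int_stable_C])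
    fix D assume "D \<in> range C"
    then obtain q where D: "D = C q" by auto
    have "emeasure (\<kappa> x) D = (if good x then ennreal (F q x) else emeasure P D)" for x
      using \<kappa>C[of x q] finite_measure.emeasure_eq_measure[of "\<kappa> x" D] \<kappa>(1)[of x]
      by (auto simp: D prob_space_def) (simp add: \<kappa>_def)
    then show "(\<lambda>x. emeasure (\<kappa> x) D) \<in> borel_measurable tail" by simp
  qed (use \<kappa> in \<open>auto simp: C_def\<close>)
  moreover have "AE x in P. \<forall>q. measure (\<kappa> x) (C q) = F q x"
    using AE_good by eventually_elim (simp add: \<kappa>C)
  ultimately show ?thesis by (rule that)
qed

text \<open>For a tail set \<open>B\<close>, the restriction of \<open>P\<close> to \<open>B\<close>
  and its mixture through \<open>\<kappa>\<close> agree on each \<open>C q\<close> by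
  \<open>FC\<close>, hence as measures. Integrating \<open>u\<close> against both gives the
  formula.\<close>

lemma kernel_disintegration:
  assumes P: "gibbs P" and F: "\<And>q. F q \<in> borel_measurable tail"
    and FC: "\<And>q B. B \<in> sets tail \<Longrightarrow> (\<integral>x. F q x * indicator B x \<partial>P) = measure P (B \<inter> C q)"
    and \<kappa>: "\<kappa> \<in> tail \<rightarrow>\<^sub>M prob_algebra X" and \<kappa>F: "AE x in P. \<forall>q. measure (\<kappa> x) (C q) = F q x"
    and B: "B \<in> sets tail" and u[measurable]: "u \<in> borel_measurable X"
  shows "(\<integral>\<^sup>+x. (\<integral>\<^sup>+y. u y \<partial>\<kappa> x) * indicator B x \<partial>P) = (\<integral>\<^sup>+y. u y * indicator B y \<partial>P)"
proof -
  note [measurable_cong] = gibbsD(2)[OF P]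
  interpret prob_space P by (rule gibbsD[OF P])
  have sp: "space P = space X" by (rule gibbsD[OF P])
  have [measurable]: "B \<in> sets X" using B tail_subalg by (auto simp: subalgebra_def)
  have [measurable]: "F q \<in> borel_measurable X" for q
    by (rule measurable_tail_D[OF F])
  have \<kappa>X[measurable]: "\<kappa> \<in> X \<rightarrow>\<^sub>M subprob_algebra X"
    using measurable_prob_algebraD[OF measurable_tail_D[OF \<kappa>]] .
  let ?N = "density P (indicator B)"
  have \<kappa>N: "\<kappa> \<in> ?N \<rightarrow>\<^sub>M subprob_algebra X" by simp
  have ne: "space ?N \<noteq> {}" using not_empty by simp
  have \<kappa>p: "prob_space (\<kappa> x)" if "x \<in> space X" for x
    using measurable_space[OF \<kappa>, of x] that by (simp add: space_prob_algebra)
  have \<kappa>s: "sets (\<kappa> x) = sets X" if "x \<in> space X" for x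
    using measurable_space[OF \<kappa>, of x] that by (simp add: space_prob_algebra)
  have \<kappa>1: "emeasure (\<kappa> x) (space X) = 1" if "x \<in> space X" for x
    using prob_space.emeasure_space_1[OF \<kappa>p[OF that]] sets_eq_imp_space_eq[OF \<kappa>s[OF that]] by simp
  have "bind ?N \<kappa> = ?N"
  proof (rule measure_eqI_C)
    show "sets (bind ?N \<kappa>) = sets X"
      using \<kappa>s ne sp by (intro sets_bind) auto
    fix q
    have "emeasure (bind ?N \<kappa>) (C q) = (\<integral>\<^sup>+x. emeasure (\<kappa> x) (C q) \<partial>?N)"
      by (rule emeasure_bind[OF ne \<kappa>N]) simp
    also have "\<dots> = (\<integral>\<^sup>+x. indicator B x * emeasure (\<kappa> x) (C q) \<partial>P)"
      by (subst nn_integral_density) auto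
    also have "\<dots> = (\<integral>\<^sup>+x. ennreal (measure (\<kappa> x) (C q) * indicator B x) \<partial>P)"
      using \<kappa>p by (intro nn_integral_cong)
        (auto simp: sp finite_measure.emeasure_eq_measure prob_space_def split: split_indicator)
    also have "\<dots> = ennreal (\<integral>x. measure (\<kappa> x) (C q) * indicator B x \<partial>P)"
    proof (rule nn_integral_eq_integral)
      show "integrable P (\<lambda>x. measure (\<kappa> x) (C q) * indicator B x)"
        using \<kappa>p by (intro integrable_const_bound[where B=1]) (auto simp: sp prob_space.prob_le_1 split: split_indicator)
    qed auto
    also have "(\<integral>x. measure (\<kappa> x) (C q) * indicator B x \<partial>P) = (\<integral>x. F q x * indicator B x \<partial>P)"
    proof (rule integral_cong_AE)
      show "AE x in P. measure (\<kappa> x) (C q) * indicator B x = F q x * indicator B x"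
        using \<kappa>F by eventually_elim simp
    qed simp_all
    also have "\<dots> = measure P (B \<inter> C q)" by (rule FC[OF B])
    finally show "emeasure (bind ?N \<kappa>) (C q) = emeasure ?N (C q)"
      by (simp add: emeasure_density emeasure_eq_measure flip: indicator_inter_arith)
  next
    have "emeasure (bind ?N \<kappa>) (space X) = (\<integral>\<^sup>+x. emeasure (\<kappa> x) (space X) \<partial>?N)"
      by (rule emeasure_bind[OF ne \<kappa>N]) simp
    also have "\<dots> = emeasure ?N (space ?N)"
      using \<kappa>1 by (subst nn_integral_cong[where v="\<lambda>_. 1"]) (auto simp: sp)
    finally show "emeasure (bind ?N \<kappa>) (space X) \<noteq> \<infinity>"
      using sets.Int[OF \<open>B \<in> sets X\<close> sets.top]
      by (simp add: emeasure_density sp emeasure_eq_measure flip: indicator_inter_arith)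
  qed (simp add: gibbsD(2)[OF P])
  then have "(\<integral>\<^sup>+y. u y \<partial>bind ?N \<kappa>) = (\<integral>\<^sup>+y. u y \<partial>?N)" by simp
  also have "(\<integral>\<^sup>+y. u y \<partial>bind ?N \<kappa>) = (\<integral>\<^sup>+x. \<integral>\<^sup>+y. u y \<partial>\<kappa> x \<partial>?N)"
    by (rule nn_integral_bind[OF u \<kappa>N])
  finally show ?thesis
    by (simp add: nn_integral_density mult.commute)
qed

section \<open>Conditional measures are Gibbs and tail-trivial\<close>

text \<open>Averaging \<open>\<Theta>\<close> through \<open>A n\<close> yields a probability
  measure, so agreement on the pi-system is agreement everywhere. Being Gibbs thus becomes countably
  many conditions.\<close>

lemma gibbsI_C:
  assumes \<Theta>: "\<Theta> \<in> space (prob_algebra X)"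
    and C: "\<And>n q. (\<integral>\<^sup>+y. emeasure (A n y) (C q) \<partial>\<Theta>) = emeasure \<Theta> (C q)"
  shows "gibbs \<Theta>"
proof -
  have s: "sets \<Theta> = sets X" and "prob_space \<Theta>"
    using \<Theta> by (auto simp: space_prob_algebra)
  interpret prob_space \<Theta> by fact
  have kernelX: "A n \<in> X \<rightarrow>\<^sub>M prob_algebra X" for n
    using measurable_J_D[OF kernel] .
  have "bind \<Theta> (A n) = \<Theta>" for n
  proof (rule measure_eqI_C)
    show "sets (bind \<Theta> (A n)) = sets X" using \<Theta> kernelX by (rule sets_bind')
    show "emeasure (bind \<Theta> (A n)) (C q) = emeasure \<Theta> (C q)" for q
      using emeasure_bind_prob_algebra[OF \<Theta> kernelX] C by simp
    show "emeasure (bind \<Theta> (A n)) (space X) \<noteq> \<infinity>"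
      using prob_space.emeasure_space_1[OF prob_space_bind'[OF \<Theta> kernelX, of n]]
        sets_bind'[OF \<Theta> kernelX, THEN sets_eq_imp_space_eq, of n] by simp
  qed (rule s)
  then have "(\<integral>\<^sup>+y. emeasure (A n y) D \<partial>\<Theta>) = emeasure \<Theta> D" if "D \<in> sets X" for n D
    using emeasure_bind_prob_algebra[OF \<Theta> kernelX that] by metis
  with \<Theta> show ?thesis by (simp add: gibbs_def)
qed

text \<open>A tail set \<open>B\<close> lies in every \<open>J n\<close>, so integrating the
  conditional probabilities of \<open>C q\<close> over \<open>B\<close> gives the mass of
  \<open>B \<inter> C q\<close> for each \<open>k\<close>. Their constant limit shows that
  \<open>B\<close> is independent of every \<open>C q\<close>, hence of every measurable set, in
  particular of itself.\<close>

lemma tail_trivialI: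
  assumes \<Theta>: "gibbs \<Theta>"
    and lim: "\<And>q. AE y in \<Theta>. (\<lambda>k. measure (A (r q k) y) (C q)) \<longlonglongrightarrow> measure \<Theta> (C q)"
    and B: "B \<in> sets tail"
  shows "emeasure \<Theta> B = 0 \<or> emeasure \<Theta> (space X - B) = 0"
proof -
  note [measurable_cong] = gibbsD(2)[OF \<Theta>]
  interpret prob_space \<Theta> by (rule gibbsD[OF \<Theta>])
  have sp: "space \<Theta> = space X" by (rule gibbsD[OF \<Theta>])
  have BX[measurable]: "B \<in> sets X" using B tail_subalg by (auto simp: subalgebra_def)
  have indep: "measure \<Theta> (B \<inter> C q) = measure \<Theta> (C q) * measure \<Theta> B" for q
  proof -
    have "(\<lambda>k. \<integral>y. measure (A (r q k) y) (C q) * indicator B y \<partial>\<Theta>) \<longlonglongrightarrow> (\<integral>y. measure \<Theta> (C q) * indicator B y \<partial>\<Theta>)"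
    proof (rule integral_dominated_convergence[where w="\<lambda>_. 1"])
      show "AE y in \<Theta>. (\<lambda>k. measure (A (r q k) y) (C q) * indicator B y) \<longlonglongrightarrow> measure \<Theta> (C q) * indicator B y"
        using lim[of q] by eventually_elim (intro tendsto_intros)
      show "AE y in \<Theta>. norm (measure (A (r q k) y) (C q) * indicator B y) \<le> 1" for k
        using kernel_bounds sp by (auto split: split_indicator)
    qed auto
    moreover have "(\<integral>y. measure (A (r q k) y) (C q) * indicator B y \<partial>\<Theta>) = measure \<Theta> (B \<inter> C q)" for k
      using B by (intro gibbs_set_integral \<Theta>) (auto simp: sets_tail)
    ultimately show ?thesis by (simp add: LIMSEQ_const_iff)
  qed
  have "density \<Theta> (indicator B) = density \<Theta> (\<lambda>_. emeasure \<Theta> B)"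
  proof (rule measure_eqI_C)
    fix q
    have "emeasure \<Theta> (B \<inter> C q) = emeasure \<Theta> (C q) * emeasure \<Theta> B"
      by (simp add: emeasure_eq_measure indep ennreal_mult)
    then show "emeasure (density \<Theta> (indicator B)) (C q) = emeasure (density \<Theta> (\<lambda>_. emeasure \<Theta> B)) (C q)"
      by (simp add: emeasure_density nn_integral_cmult mult.commute flip: indicator_inter_arith)
  next
    show "emeasure (density \<Theta> (indicator B)) (space X) \<noteq> \<infinity>"
      using sets.top[of X] by (simp add: emeasure_density emeasure_eq_measure flip: indicator_inter_arith)
  qed (simp_all add: gibbsD(2)[OF \<Theta>])
  then have "emeasure (density \<Theta> (indicator B)) B = emeasure (density \<Theta> (\<lambda>_. emeasure \<Theta> B)) B"
    by simp
  then have "emeasure \<Theta> B = emeasure \<Theta> B * emeasure \<Theta> B"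
    by (simp add: emeasure_density nn_integral_cmult flip: indicator_inter_arith)
  then have "prob B = prob B * prob B"
    by (simp add: emeasure_eq_measure flip: ennreal_mult)
  then have "prob B = 0 \<or> prob B = 1" by simp
  moreover have "prob (space X - B) = 1 - prob B"
    using prob_compl[of B] by (simp add: sp)
  ultimately show ?thesis by (auto simp: emeasure_eq_measure)
qed

text \<open>The good measures are collected in a measurable set \<open>S\<close>, described without
  reference to \<open>x\<close>. The almost sure properties of \<open>\<kappa> x\<close> then pass
  to the law of \<open>\<kappa>\<close> on the space of measures.\<close>

theorem gibbs_decomposition:
  assumes P: "gibbs P"
  obtains \<kappa> S where "\<kappa> \<in> X \<rightarrow>\<^sub>M prob_algebra X" "S \<in> sets (prob_algebra X)" "AE x in P. \<kappa> x \<in> S"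
    "\<And>\<Theta>. \<Theta> \<in> S \<Longrightarrow> gibbs \<Theta>"
    "\<And>\<Theta> B. \<Theta> \<in> S \<Longrightarrow> B \<in> sets tail \<Longrightarrow> emeasure \<Theta> B = 0 \<or> emeasure \<Theta> (space X - B) = 0"
    "\<And>u. u \<in> borel_measurable X \<Longrightarrow> (\<integral>\<^sup>+x. (\<integral>\<^sup>+y. u y \<partial>\<kappa> x) \<partial>P) = (\<integral>\<^sup>+y. u y \<partial>P)"
proof -
  note [measurable_cong] = gibbsD(2)[OF P]
  interpret prob_space P by (rule gibbsD[OF P])
  have sp: "space P = space X" by (rule gibbsD[OF P])
  have sub: "subalgebra P tail"
    using tail_subalg sp gibbsD(2)[OF P] by (simp add: subalgebra_def)
  define good where "good q r F \<longleftrightarrow> F \<in> borel_measurable tail \<and> (\<forall>x. 0 \<le> F x \<and> F x \<le> (1::real)) \<and>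
    (AE x in P. (\<lambda>k. measure (A (r k) x) (C q)) \<longlonglongrightarrow> F x) \<and>
    (\<forall>B\<in>sets tail. (\<integral>x. F x * indicator B x \<partial>P) = measure P (B \<inter> C q))" for q and r :: "nat \<Rightarrow> nat" and F
  have "\<exists>r F. good q r F" for q
    unfolding good_def using tail_limit[OF P sets_C, of q] by blast
  then obtain r F where "\<And>q. good q (r q) (F q)"
    by metis
  then have F: "\<And>q. F q \<in> borel_measurable tail" and F01: "\<And>q x. 0 \<le> F q x \<and> F q x \<le> (1::real)"
    and lim: "\<And>q. AE x in P. (\<lambda>k. measure (A (r q k) x) (C q)) \<longlonglongrightarrow> F q x"
    and FC: "\<And>q B. B \<in> sets tail \<Longrightarrow> (\<integral>x. F q x * indicator B x \<partial>P) = measure P (B \<inter> C q)"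
    by (simp_all add: good_def)
  have [measurable]: "F q \<in> borel_measurable X" for q
    by (rule measurable_tail_D[OF F])
  obtain \<kappa> where \<kappa>: "\<kappa> \<in> tail \<rightarrow>\<^sub>M prob_algebra X" and \<kappa>F: "AE x in P. \<forall>q. measure (\<kappa> x) (C q) = F q x"
    using conditional_kernel[OF P F F01 FC] by blast
  note dis = kernel_disintegration[OF P F FC \<kappa> \<kappa>F]
  have \<kappa>_meas: "(\<lambda>x. \<integral>\<^sup>+y. u y \<partial>\<kappa> x) \<in> borel_measurable tail" if "u \<in> borel_measurable X" for u
    using measurable_compose[OF measurable_prob_algebraD[OF \<kappa>] nn_integral_measurable_subprob_algebra[OF that]] .
  have \<kappa>sp: "space (\<kappa> x) = space X \<and> sets (\<kappa> x) = sets X" if "x \<in> space X" for x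
    using measurable_space[OF \<kappa>, of x] that by (auto simp: space_prob_algebra dest: sets_eq_imp_space_eq)
  \<comment> \<open>The almost sure convergence is replaced by a measurable set of full mass on
    which it holds; giving mass one to \<open>E q\<close> is a measurable condition on a measure.
    The subsequence may differ from one \<open>q\<close> to another.\<close>
  have "\<exists>E\<in>sets X. emeasure P E = 1 \<and> (\<forall>y\<in>E. (\<lambda>k. measure (A (r q k) y) (C q)) \<longlonglongrightarrow> F q y)" for q
  proof -
    obtain N where N: "\<And>y. y \<in> space P - N \<Longrightarrow> (\<lambda>k. measure (A (r q k) y) (C q)) \<longlonglongrightarrow> F q y" "N \<in> null_sets P"
      using AE_E3[OF lim[of q]] by blast
    then have "emeasure P (space P - N) = 1"
      using emeasure_space_1 by (simp add: emeasure_Diff_null_set)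
    with N show ?thesis
      by (intro bexI[of _ "space P - N"]) (auto simp: sp gibbsD(2)[OF P, symmetric])
  qed
  then obtain E where E[measurable]: "\<And>q. E q \<in> sets X" and E1: "\<And>q. emeasure P (E q) = 1"
    and E_lim: "\<And>q y. y \<in> E q \<Longrightarrow> (\<lambda>k. measure (A (r q k) y) (C q)) \<longlonglongrightarrow> F q y"
    by metis
  define L where "L q s = {y\<in>space X. F q y < of_rat s}" for q s :: rat
  have L_tail: "L q s \<in> sets tail" for q s
    using F[of q] by (simp add: L_def borel_measurable_iff_less)
  then have [measurable]: "L q s \<in> sets X" for q s
    using tail_subalg by (auto simp: subalgebra_def)
  \<comment> \<open>The conditions on all the \<open>L q s\<close> say that \<open>F q = measure \<Theta> (C q)\<close> holds \<open>\<Theta>\<close>-almost everywhere,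
    in a form that makes \<open>S\<close> visibly measurable.\<close>
  define S where "S = {\<Theta>\<in>space (prob_algebra X). (\<forall>n q. (\<integral>\<^sup>+y. emeasure (A n y) (C q) \<partial>\<Theta>) = emeasure \<Theta> (C q)) \<and>
    (\<forall>q. emeasure \<Theta> (E q) = 1) \<and> (\<forall>q s. emeasure \<Theta> (L q s) = (if measure \<Theta> (C q) < of_rat s then 1 else 0))}"
  have S_sets: "S \<in> sets (prob_algebra X)"
  proof -
    have [measurable]: "(\<lambda>\<Theta>. emeasure \<Theta> D) \<in> borel_measurable (prob_algebra X)" if "D \<in> sets X" for D
      unfolding prob_algebra_def using that by (intro measurable_restrict_space1) simp
    have [measurable]: "(\<lambda>\<Theta>. \<integral>\<^sup>+y. emeasure (A n y) (C q) \<partial>\<Theta>) \<in> borel_measurable (prob_algebra X)" for n q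
      unfolding prob_algebra_def by (intro measurable_restrict_space1) simp
    show ?thesis unfolding S_def by measurable
  qed
  have S_gibbs: "gibbs \<Theta>" if "\<Theta> \<in> S" for \<Theta>
    using that by (intro gibbsI_C) (auto simp: S_def)
  have S_trivial: "emeasure \<Theta> B = 0 \<or> emeasure \<Theta> (space X - B) = 0" if "\<Theta> \<in> S" "B \<in> sets tail" for \<Theta> B
  proof (rule tail_trivialI[OF S_gibbs[OF that(1)] _ that(2)])
    fix q
    note [measurable_cong] = gibbsD(2)[OF S_gibbs[OF that(1)]]
    interpret \<Theta>: prob_space \<Theta> by (rule gibbsD[OF S_gibbs[OF that(1)]])
    have sp\<Theta>: "space \<Theta> = space X" by (rule gibbsD[OF S_gibbs[OF that(1)]])
    let ?c = "measure \<Theta> (C q)"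
    have "AE y in \<Theta>. F q y < of_rat s \<longleftrightarrow> ?c < of_rat s" for s
    proof (cases "?c < of_rat s")
      case True
      then have "AE y in \<Theta>. y \<in> L q s"
        using that(1) by (intro \<Theta>.AE_prob_1) (simp add: S_def measure_def)
      then show ?thesis by eventually_elim (use True in \<open>auto simp: L_def\<close>)
    next
      case False
      then have "L q s \<in> null_sets \<Theta>"
        using that(1) by (simp add: S_def null_sets_def gibbsD(2)[OF S_gibbs[OF that(1)]])
      then have "AE y in \<Theta>. y \<notin> L q s" by (rule AE_not_in)
      then show ?thesis using AE_space by eventually_elim (use False in \<open>auto simp: L_def sp\<Theta>\<close>)
    qed
    then have "AE y in \<Theta>. \<forall>s. F q y < of_rat s \<longleftrightarrow> ?c < of_rat s"
      by (simp add: AE_all_countable)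
    moreover have "AE y in \<Theta>. y \<in> E q"
      using that(1) by (intro \<Theta>.AE_prob_1) (simp add: S_def measure_def)
    ultimately show "AE y in \<Theta>. (\<lambda>k. measure (A (r q k) y) (C q)) \<longlonglongrightarrow> ?c"
    proof eventually_elim
      case (elim y)
      have "F q y = ?c"
      proof (rule linorder_cases)
        assume "F q y < ?c"
        then obtain s where "F q y < of_rat s" "of_rat s < ?c" using of_rat_dense by blast
        then show ?thesis using elim(1) by (meson less_asym)
      next
        assume "?c < F q y"
        then obtain s where "?c < of_rat s" "of_rat s < F q y" using of_rat_dense by blast
        then show ?thesis using elim(1) by (meson less_asym)
      qed
      then show ?case using E_lim[OF elim(2)] by simp
    qed
  qed
  have AE_S: "AE x in P. \<kappa> x \<in> S"
  proof -
    \<comment> \<open>Each clause of \<open>S\<close> at \<open>\<kappa> x\<close> compares two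
      tail-measurable functions of \<open>x\<close>. They are shown equal by integration over every
      tail set, where the disintegration turns integrals against \<open>\<kappa> x\<close> into
      integrals against \<open>P\<close>.\<close>
    note uniq = AE_eq_of_set_nn_integral_eq[OF prob_space_axioms sub]
    have em: "(\<lambda>x. emeasure (\<kappa> x) D) \<in> borel_measurable tail" if "D \<in> sets X" for D
      using measurable_compose[OF measurable_prob_algebraD[OF \<kappa>] measurable_emeasure_subprob_algebra[OF that]] .
    have dis_ind: "(\<integral>\<^sup>+x. emeasure (\<kappa> x) D * indicator B x \<partial>P) = emeasure P (B \<inter> D)"
      if [measurable]: "D \<in> sets X" and B: "B \<in> sets tail" for D B
    proof -
      have [measurable]: "B \<in> sets X" using B tail_subalg by (auto simp: subalgebra_def)
      have "(\<integral>\<^sup>+x. emeasure (\<kappa> x) D * indicator B x \<partial>P) = (\<integral>\<^sup>+x. (\<integral>\<^sup>+y. indicator D y \<partial>\<kappa> x) * indicator B x \<partial>P)"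
        using \<kappa>sp by (intro nn_integral_cong) (simp add: sp)
      also have "\<dots> = (\<integral>\<^sup>+y. indicator D y * indicator B y \<partial>P)"
        using B by (intro dis) auto
      finally show ?thesis by (simp add: Int_commute flip: indicator_inter_arith)
    qed
    have 1: "AE x in P. (\<integral>\<^sup>+y. emeasure (A n y) (C q) \<partial>\<kappa> x) = emeasure (\<kappa> x) (C q)" for n q
    proof (rule uniq)
      fix B assume B: "B \<in> sets tail"
      have [measurable]: "B \<in> sets X" using B tail_subalg by (auto simp: subalgebra_def)
      have "(\<integral>\<^sup>+x. (\<integral>\<^sup>+y. emeasure (A n y) (C q) \<partial>\<kappa> x) * indicator B x \<partial>P) = (\<integral>\<^sup>+y. emeasure (A n y) (C q) * indicator B y \<partial>P)"
        using B by (intro dis) auto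
      also have "\<dots> = (\<integral>\<^sup>+y. indicator (C q) y * indicator B y \<partial>P)"
        using B by (intro gibbs_nn_integral P) (auto simp: sets_tail)
      also have "\<dots> = (\<integral>\<^sup>+x. emeasure (\<kappa> x) (C q) * indicator B x \<partial>P)"
        using B by (subst dis_ind) (auto simp: Int_commute simp flip: indicator_inter_arith)
      finally show "(\<integral>\<^sup>+x. (\<integral>\<^sup>+y. emeasure (A n y) (C q) \<partial>\<kappa> x) * indicator B x \<partial>P) = (\<integral>\<^sup>+x. emeasure (\<kappa> x) (C q) * indicator B x \<partial>P)" .
    qed (auto intro: \<kappa>_meas em)
    have 2: "AE x in P. emeasure (\<kappa> x) (E q) = 1" for q
    proof (rule uniq)
      fix B assume B: "B \<in> sets tail"
      have [measurable]: "B \<in> sets X" using B tail_subalg by (auto simp: subalgebra_def)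
      have "AE x in P. x \<in> E q"
        using E1 by (intro AE_prob_1) (simp add: measure_def)
      then have "emeasure P (B \<inter> E q) = emeasure P B"
        by (intro emeasure_eq_AE) auto
      then show "(\<integral>\<^sup>+x. emeasure (\<kappa> x) (E q) * indicator B x \<partial>P) = (\<integral>\<^sup>+x. 1 * indicator B x \<partial>P)"
        using B by (simp add: dis_ind)
    qed (auto intro: em)
    \<comment> \<open>\<open>L q s\<close> is itself a tail set, so conditioning returns its
      indicator. With \<open>\<kappa>F\<close> this becomes the clause of \<open>S\<close> that
      compares \<open>measure \<Theta> (C q)\<close> with \<open>s\<close>.\<close>
    have 3: "AE x in P. emeasure (\<kappa> x) (L q s) = indicator (L q s) x" for q s
    proof (rule uniq)
      fix B assume B: "B \<in> sets tail"
      have [measurable]: "B \<in> sets X" using B tail_subalg by (auto simp: subalgebra_def)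
      show "(\<integral>\<^sup>+x. emeasure (\<kappa> x) (L q s) * indicator B x \<partial>P) = (\<integral>\<^sup>+x. indicator (L q s) x * indicator B x \<partial>P)"
        using B by (simp add: dis_ind Int_commute flip: indicator_inter_arith)
    qed (use L_tail in \<open>auto intro: em\<close>)
    have "AE x in P. \<forall>n q. (\<integral>\<^sup>+y. emeasure (A n y) (C q) \<partial>\<kappa> x) = emeasure (\<kappa> x) (C q)"
      "AE x in P. \<forall>q. emeasure (\<kappa> x) (E q) = 1" "AE x in P. \<forall>q s. emeasure (\<kappa> x) (L q s) = indicator (L q s) x"
      using 1 2 3 by (simp_all add: AE_all_countable)
    then show ?thesis using \<kappa>F AE_space
    proof eventually_elim
      case (elim x)
      then show ?case
        using measurable_space[OF \<kappa>, of x] by (auto simp: S_def sp L_def)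
    qed
  qed
  have "(\<integral>\<^sup>+x. (\<integral>\<^sup>+y. u y \<partial>\<kappa> x) \<partial>P) = (\<integral>\<^sup>+y. u y \<partial>P)" if u: "u \<in> borel_measurable X" for u
  proof -
    have "(\<integral>\<^sup>+x. (\<integral>\<^sup>+y. u y \<partial>\<kappa> x) \<partial>P) = (\<integral>\<^sup>+x. (\<integral>\<^sup>+y. u y \<partial>\<kappa> x) * indicator (space X) x \<partial>P)"
      by (intro nn_integral_cong) (simp add: sp)
    also have "\<dots> = (\<integral>\<^sup>+y. u y * indicator (space X) y \<partial>P)"
      using u sets.top[of tail] by (intro dis) auto
    also have "\<dots> = (\<integral>\<^sup>+y. u y \<partial>P)"
      by (intro nn_integral_cong) (simp add: sp)
    finally show ?thesis .
  qed
  then show ?thesis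
    using measurable_tail_D[OF \<kappa>] S_sets AE_S S_gibbs S_trivial by (intro that[of \<kappa> S]) auto
qed

end

section \<open>Averaging over an inductively compact group\<close>

lemma (in inductively_compact_group) closedin_K:
  assumes "m \<le> n" shows "closedin (\<tau> n) (K m)"
proof (rule compactin_imp_closedin)
  show "Hausdorff_space (\<tau> n)" by (rule metrizable_imp_Hausdorff_space[OF metrizable_K])
  have "compactin (\<tau> m) (K m)"
    using compact_K[of m] by (simp add: compact_space_def topspace_K)
  then show "compactin (\<tau> n) (K m)"
    using subtopology_K_le[OF assms] by (simp add: compactin_subtopology)
qed

text \<open>An open set of \<open>K m\<close> is the trace of an open set of \<open>K n\<close> on
  \<open>K m\<close>, and \<open>K m\<close> is closed in \<open>K n\<close> because it is
  compact.\<close>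

lemma (in inductively_compact_group) sets_borel_of_mono:
  assumes "m \<le> n" shows "sets (borel_of (\<tau> m)) \<subseteq> sets (borel_of (\<tau> n))"
proof
  fix B assume "B \<in> sets (borel_of (\<tau> m))"
  then have "B \<in> sigma_sets (K m) {U. openin (\<tau> m) U}" by (simp add: sets_borel_of topspace_K)
  then show "B \<in> sets (borel_of (\<tau> n))"
  proof induction
    case (Basic U)
    then obtain V where "openin (\<tau> n) V" "U = V \<inter> K m"
      using subtopology_K_le[OF assms] by (auto simp: openin_subtopology)
    then show ?case using openin_borel_of closedin_borel_of[OF closedin_K[OF assms]] by auto
  next
    case (Compl a)
    then show ?case using closedin_borel_of[OF closedin_K[OF assms]] by auto
  qed auto
qed

text \<open>Through this inclusion the joint measurability of the action, given on \<open>G\<close>,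
  is used on each \<open>K n\<close>. A Borel set of \<open>K m\<close> is Borel in
  \<open>K n\<close> if \<open>m \<le> n\<close>, and otherwise its trace on the subspace
  \<open>K n\<close> is.\<close>

lemma (in inductively_compact_group) borel_of_le_inductive_limit_borel:
  "(\<lambda>g. g) \<in> borel_of (\<tau> n) \<rightarrow>\<^sub>M inductive_limit_borel \<tau>"
  unfolding inductive_limit_borel_def
proof (rule measurable_measure_of)
  show "(\<Union>n. sets (borel_of (\<tau> n))) \<subseteq> Pow (\<Union>n. topspace (\<tau> n))"
    using sets.sets_into_space[of _ "borel_of (\<tau> _)"] by fastforce
  show "(\<lambda>g. g) \<in> space (borel_of (\<tau> n)) \<rightarrow> (\<Union>n. topspace (\<tau> n))" by auto
  fix B assume "B \<in> (\<Union>n. sets (borel_of (\<tau> n)))"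
  then obtain m where B: "B \<in> sets (borel_of (\<tau> m))" by auto
  show "(\<lambda>g. g) -` B \<inter> space (borel_of (\<tau> n)) \<in> sets (borel_of (\<tau> n))"
  proof (cases "m \<le> n")
    case True
    then show ?thesis
      using sets.Int[OF subsetD[OF sets_borel_of_mono[OF True] B] sets.top] by simp
  next
    case False
    then have "n \<le> m" by simp
    then have "continuous_map (\<tau> n) (\<tau> m) (\<lambda>g. g)"
      using subtopology_K_le[of n m] continuous_map_from_subtopology[OF continuous_map_id[unfolded id_def], of "\<tau> m" "K n"]
      by simp
    from measurable_sets[OF continuous_map_measurable_borel_of[OF this] B] show ?thesis .
  qed
qed

lemma ennreal_mult_divide_cancel:
  fixes a b :: ennreal
  assumes "a \<noteq> 0" "a \<noteq> \<infinity>"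
  shows "a * (b / a) = b"
proof -
  have "a * (b / a) = (b * a) / a" by (simp only: ennreal_times_divide mult.commute)
  also have "\<dots> = b" using assms by (intro ennreal_mult_divide_eq) auto
  finally show ?thesis .
qed

section \<open>Haar averages along orbits\<close>

locale inductively_compact_action = inductively_compact_group G K \<tau>
  for G :: "('g, 'm) monoid_scheme" (structure) and K \<tau> +
  fixes X :: "'a measure" and T :: "'g \<Rightarrow> 'a \<Rightarrow> 'a" and f :: "'a \<Rightarrow> real"
  assumes action: "measurable_action G \<tau> X T"
    and f [measurable]: "f \<in> borel_measurable X"
    and f_pos: "x \<in> space X \<Longrightarrow> 0 < f x"
    and f_cont: "fibrewise_continuous \<tau> X T f"
begin

sublocale group_action G "space X" T
  using action by (simp add: measurable_action_def)

definition haar :: "nat \<Rightarrow> 'g measure" where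
  "haar n = (SOME m. prob_space m \<and> sets m = sets (borel_of (\<tau> n)) \<and>
     (\<forall>h\<in>K n. distr m m (\<lambda>g. g \<otimes> h) = m) \<and> (\<forall>h\<in>K n. distr m m (\<lambda>g. h \<otimes> g) = m))"

lemma haar:
  shows prob_space_haar: "prob_space (haar n)"
    and sets_haar [measurable_cong]: "sets (haar n) = sets (borel_of (\<tau> n))"
    and haar_right: "h \<in> K n \<Longrightarrow> distr (haar n) (haar n) (\<lambda>g. g \<otimes> h) = haar n"
    and haar_left: "h \<in> K n \<Longrightarrow> distr (haar n) (haar n) (\<lambda>g. h \<otimes> g) = haar n"
proof -
  obtain m where "prob_space m" "sets m = sets (borel_of (\<tau> n))"
    "\<And>h. h \<in> K n \<Longrightarrow> distr m m (\<lambda>g. g \<otimes> h) = m" "\<And>h. h \<in> K n \<Longrightarrow> distr m m (\<lambda>g. h \<otimes> g) = m"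
    using compact_group_Haar_measure[OF topological_group_K compact_K metrizable_K, of n] by auto
  then have "\<exists>m. prob_space m \<and> sets m = sets (borel_of (\<tau> n)) \<and>
     (\<forall>h\<in>K n. distr m m (\<lambda>g. g \<otimes> h) = m) \<and> (\<forall>h\<in>K n. distr m m (\<lambda>g. h \<otimes> g) = m)" by blast
  from someI_ex[OF this, folded haar_def]
  show "prob_space (haar n)" "sets (haar n) = sets (borel_of (\<tau> n))"
    "h \<in> K n \<Longrightarrow> distr (haar n) (haar n) (\<lambda>g. g \<otimes> h) = haar n"
    "h \<in> K n \<Longrightarrow> distr (haar n) (haar n) (\<lambda>g. h \<otimes> g) = haar n" by auto
qed

lemma space_haar [simp]: "space (haar n) = K n"
  using sets_eq_imp_space_eq[OF sets_haar, of n] by (simp add: topspace_K)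

lemma K_carrier: "g \<in> K n \<Longrightarrow> g \<in> carrier G"
  by (auto simp: carrier_eq)

lemma T_space [simp]: "g \<in> K n \<Longrightarrow> x \<in> space X \<Longrightarrow> T g x \<in> space X"
  using element_image[OF K_carrier] by blast

lemma K_mult [simp]: "g \<in> K n \<Longrightarrow> h \<in> K n \<Longrightarrow> g \<otimes> h \<in> K n"
  using subgroup_K by (rule subgroup.m_closed)

lemma K_inv [simp]: "g \<in> K n \<Longrightarrow> inv g \<in> K n"
  using subgroup_K by (rule subgroup.m_inv_closed)

lemma T_mult: "x \<in> space X \<Longrightarrow> g \<in> K n \<Longrightarrow> h \<in> K n \<Longrightarrow> T (g \<otimes> h) x = T g (T h x)"
  by (intro composition_rule K_carrier)

lemma T_inv: "x \<in> space X \<Longrightarrow> g \<in> K n \<Longrightarrow> T (inv g) (T g x) = x"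
  using orbit_sym_aux[OF K_carrier] by blast

lemma action_haar: "(\<lambda>(g, x). T g x) \<in> haar n \<Otimes>\<^sub>M X \<rightarrow>\<^sub>M X"
proof -
  have T: "(\<lambda>(g, x). T g x) \<in> inductive_limit_borel \<tau> \<Otimes>\<^sub>M X \<rightarrow>\<^sub>M X"
    using action by (simp add: measurable_action_def)
  have [measurable]: "(\<lambda>g. g) \<in> haar n \<rightarrow>\<^sub>M inductive_limit_borel \<tau>"
    using borel_of_le_inductive_limit_borel[of n] measurable_cong_sets[OF sets_haar refl] by blast
  have "(\<lambda>p. (fst p, snd p)) \<in> haar n \<Otimes>\<^sub>M X \<rightarrow>\<^sub>M inductive_limit_borel \<tau> \<Otimes>\<^sub>M X"
    by (intro measurable_Pair measurable_compose[OF measurable_fst]) auto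
  from measurable_compose[OF this T] show ?thesis by (simp add: case_prod_unfold)
qed

lemma measurable_action_haar [measurable (raw)]:
  assumes "a \<in> M \<rightarrow>\<^sub>M haar n" "b \<in> M \<rightarrow>\<^sub>M X"
  shows "(\<lambda>z. T (a z) (b z)) \<in> M \<rightarrow>\<^sub>M X"
  using measurable_compose[OF measurable_Pair[OF assms] action_haar] by simp

lemma measurable_T: "g \<in> K n \<Longrightarrow> T g \<in> X \<rightarrow>\<^sub>M X"
  using measurable_action_haar[of "\<lambda>_. g" X n "\<lambda>x. x"] by simp

lemma measurable_haar_mult:
  assumes h: "h \<in> K n"
  shows "(\<lambda>g. g \<otimes> h) \<in> haar n \<rightarrow>\<^sub>M haar n" "(\<lambda>g. h \<otimes> g) \<in> haar n \<rightarrow>\<^sub>M haar n"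
proof -
  have mult: "continuous_map (prod_topology (\<tau> n) (\<tau> n)) (\<tau> n) (\<lambda>(g, h). g \<otimes> h)"
    using topological_group_K[of n] by (simp add: topological_group_def)
  have "continuous_map (\<tau> n) (\<tau> n) (\<lambda>g. g \<otimes> h)"
    using continuous_map_compose[of "\<tau> n" "prod_topology (\<tau> n) (\<tau> n)" "\<lambda>g. (g, h)", OF _ mult] h
    by (simp add: continuous_map_paired comp_def topspace_K)
  from continuous_map_measurable_borel_of[OF this]
  show "(\<lambda>g. g \<otimes> h) \<in> haar n \<rightarrow>\<^sub>M haar n" by (simp cong: measurable_cong_sets add: sets_haar)
  have "continuous_map (\<tau> n) (\<tau> n) (\<lambda>g. h \<otimes> g)"
    using continuous_map_compose[of "\<tau> n" "prod_topology (\<tau> n) (\<tau> n)" "\<lambda>g. (h, g)", OF _ mult] h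
    by (simp add: continuous_map_paired comp_def topspace_K)
  from continuous_map_measurable_borel_of[OF this]
  show "(\<lambda>g. h \<otimes> g) \<in> haar n \<rightarrow>\<^sub>M haar n" by (simp cong: measurable_cong_sets add: sets_haar)
qed

lemma measurable_haar_inv [measurable]: "(\<lambda>g. inv g) \<in> haar n \<rightarrow>\<^sub>M haar n"
proof -
  have "continuous_map (\<tau> n) (\<tau> n) (\<lambda>g. inv\<^bsub>G\<lparr>carrier := K n\<rparr>\<^esub> g)"
    using topological_group_K[of n] by (simp add: topological_group_def)
  then have "continuous_map (\<tau> n) (\<tau> n) (\<lambda>g. inv g)"
    by (rule continuous_map_eq) (simp add: topspace_K m_inv_consistent[OF subgroup_K])
  from continuous_map_measurable_borel_of[OF this]
  show ?thesis by (simp cong: measurable_cong_sets add: sets_haar)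
qed

definition avg :: "nat \<Rightarrow> ('a \<Rightarrow> ennreal) \<Rightarrow> 'a \<Rightarrow> ennreal" where
  "avg n u x = (\<integral>\<^sup>+g. u (T g x) \<partial>haar n)"

lemma avg_measurable [measurable]:
  assumes [measurable]: "u \<in> borel_measurable X"
  shows "avg n u \<in> borel_measurable X"
proof -
  interpret prob_space "haar n" by (rule prob_space_haar)
  show ?thesis unfolding avg_def by measurable
qed

text \<open>Right invariance: moving the base point by \<open>h\<close> multiplies the group
  variable on the right.\<close>

lemma avg_T:
  assumes [measurable]: "u \<in> borel_measurable X" "x \<in> space X" and h: "h \<in> K n"
  shows "avg n u (T h x) = avg n u x"
proof -
  have "avg n u x = (\<integral>\<^sup>+g. u (T g x) \<partial>distr (haar n) (haar n) (\<lambda>g. g \<otimes> h))"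
    by (simp add: haar_right[OF h] avg_def)
  also have "\<dots> = (\<integral>\<^sup>+g. u (T (g \<otimes> h) x) \<partial>haar n)"
    using measurable_haar_mult[OF h] by (intro nn_integral_distr) auto
  also have "\<dots> = avg n u (T h x)"
    unfolding avg_def by (intro nn_integral_cong) (simp add: T_mult[OF _ _ h] assms)
  finally show ?thesis by simp
qed

text \<open>Left invariance: moving the function by \<open>h\<close> multiplies the group variable
  on the left.\<close>

lemma avg_comp:
  assumes [measurable]: "u \<in> borel_measurable X" "x \<in> space X" and h: "h \<in> K n"
  shows "avg n (\<lambda>y. u (T h y)) x = avg n u x"
proof -
  have "avg n u x = (\<integral>\<^sup>+g. u (T g x) \<partial>distr (haar n) (haar n) (\<lambda>g. h \<otimes> g))"
    by (simp add: haar_left[OF h] avg_def)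
  also have "\<dots> = (\<integral>\<^sup>+g. u (T (h \<otimes> g) x) \<partial>haar n)"
    using measurable_haar_mult[OF h] by (intro nn_integral_distr) auto
  also have "\<dots> = avg n (\<lambda>y. u (T h y)) x"
    unfolding avg_def by (intro nn_integral_cong) (simp add: T_mult[OF _ h] assms)
  finally show ?thesis by simp
qed

text \<open>Integrate \<open>u (T (inv g) (T h x))\<close> over \<open>g\<close> and \<open>h\<close> in both orders.\<close>

lemma avg_inv:
  assumes [measurable]: "u \<in> borel_measurable X" "x \<in> space X"
  shows "(\<integral>\<^sup>+g. u (T (inv g) x) \<partial>haar n) = avg n u x"
proof -
  interpret H: prob_space "haar n" by (rule prob_space_haar)
  interpret HH: pair_sigma_finite "haar n" "haar n" ..
  have 1: "(\<integral>\<^sup>+h. u (T (inv g) (T h x)) \<partial>haar n) = avg n u x" if "g \<in> K n" for g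
    using avg_comp[OF assms K_inv[OF that]] by (simp add: avg_def)
  \<comment> \<open>Replacing \<open>g\<close> by \<open>h \<otimes> g\<close> produces
    \<open>inv g \<otimes> inv h\<close>, whose second factor cancels \<open>T h\<close>.\<close>
  have 2: "(\<integral>\<^sup>+g. u (T (inv g) (T h x)) \<partial>haar n) = (\<integral>\<^sup>+g. u (T (inv g) x) \<partial>haar n)" if h: "h \<in> K n" for h
  proof -
    have "(\<integral>\<^sup>+g. u (T (inv g) (T h x)) \<partial>haar n) =
        (\<integral>\<^sup>+g. u (T (inv g) (T h x)) \<partial>distr (haar n) (haar n) (\<lambda>g. h \<otimes> g))"
      by (simp add: haar_left[OF h])
    also have "\<dots> = (\<integral>\<^sup>+g. u (T (inv (h \<otimes> g)) (T h x)) \<partial>haar n)"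
      using measurable_haar_mult[OF h] h by (intro nn_integral_distr) auto
    also have "\<dots> = (\<integral>\<^sup>+g. u (T (inv g) x) \<partial>haar n)"
    proof (intro nn_integral_cong)
      fix g assume "g \<in> space (haar n)"
      then have g: "g \<in> K n" by simp
      have "T (inv (h \<otimes> g)) (T h x) = T (inv g) (T (inv h) (T h x))"
        using g h assms by (simp add: inv_mult_group K_carrier T_mult[of _ _ n])
      then show "u (T (inv (h \<otimes> g)) (T h x)) = u (T (inv g) x)"
        using T_inv[OF assms(2) h] by simp
    qed
    finally show ?thesis .
  qed
  have "avg n u x = (\<integral>\<^sup>+g. (\<integral>\<^sup>+h. u (T (inv g) (T h x)) \<partial>haar n) \<partial>haar n)"
  proof -
    have "(\<integral>\<^sup>+g. (\<integral>\<^sup>+h. u (T (inv g) (T h x)) \<partial>haar n) \<partial>haar n) = (\<integral>\<^sup>+g. avg n u x \<partial>haar n)"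
      by (rule nn_integral_cong, rule 1) simp
    then show ?thesis by (simp add: H.emeasure_space_1[simplified])
  qed
  also have "\<dots> = (\<integral>\<^sup>+h. (\<integral>\<^sup>+g. u (T (inv g) (T h x)) \<partial>haar n) \<partial>haar n)"
    by (rule HH.Fubini'[symmetric]) measurable
  also have "\<dots> = (\<integral>\<^sup>+g. u (T (inv g) x) \<partial>haar n)"
  proof -
    have "(\<integral>\<^sup>+h. (\<integral>\<^sup>+g. u (T (inv g) (T h x)) \<partial>haar n) \<partial>haar n) =
        (\<integral>\<^sup>+h. (\<integral>\<^sup>+g. u (T (inv g) x) \<partial>haar n) \<partial>haar n)"
      by (rule nn_integral_cong, rule 2) simp
    then show ?thesis by (simp add: H.emeasure_space_1[simplified])
  qed
  finally show ?thesis by simp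
qed

abbreviation F :: "'a \<Rightarrow> ennreal" where "F x \<equiv> ennreal (f x)"

lemma F_pos: "x \<in> space X \<Longrightarrow> F x \<noteq> 0"
  using f_pos[of x] by simp

lemma avg_F:
  assumes x [measurable]: "x \<in> space X"
  shows "avg n F x \<noteq> 0" and "avg n F x \<noteq> \<infinity>"
proof -
  interpret H: prob_space "haar n" by (rule prob_space_haar)
  show "avg n F x \<noteq> 0"
  proof
    assume "avg n F x = 0"
    then have "AE g in haar n. F (T g x) = 0"
      unfolding avg_def by (subst (asm) nn_integral_0_iff_AE) auto
    moreover have "AE g in haar n. F (T g x) \<noteq> 0"
      using x F_pos by (intro AE_I2) auto
    ultimately have "AE g in haar n. False" by eventually_elim simp
    then show False by simp
  qed
  have "continuous_map (\<tau> n) euclideanreal (\<lambda>g. f (T g x))"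
    using f_cont x by (simp add: fibrewise_continuous_def continuous_map_inductive_limit)
  then obtain B where B: "\<And>g. g \<in> topspace (\<tau> n) \<Longrightarrow> \<bar>f (T g x)\<bar> \<le> B"
    using continuous_map_compact_bounded[OF compact_K[of n]] by blast
  have "avg n F x \<le> (\<integral>\<^sup>+g. ennreal B \<partial>haar n)"
    unfolding avg_def using B by (intro nn_integral_mono ennreal_leI) (auto simp: topspace_K abs_le_iff)
  also have "\<dots> < \<infinity>" by (simp add: H.emeasure_space_1[simplified])
  finally show "avg n F x \<noteq> \<infinity>" by simp
qed

section \<open>The specification of weighted orbit averages\<close>

text \<open>Since \<open>K n\<close> is a group, closure under all its elements already means that
  each of them maps \<open>B\<close> onto itself. Invariance is exact, not up to null sets, as in
  the definition of ergodicity.\<close>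

definition J :: "nat \<Rightarrow> 'a measure" where
  "J n = sigma (space X) {B\<in>sets X. \<forall>g\<in>K n. \<forall>x\<in>B. T g x \<in> B}"

definition A :: "nat \<Rightarrow> 'a \<Rightarrow> 'a measure" where
  "A n x = density (distr (haar n) X (\<lambda>g. T g x)) (\<lambda>y. F y / avg n F x)"

lemma space_J_eq: "space (J n) = space X"
  unfolding J_def by (rule space_measure_of) (auto dest: sets.sets_into_space)

lemma sets_J_eq: "sets (J n) = {B\<in>sets X. \<forall>g\<in>K n. \<forall>x\<in>B. T g x \<in> B}"
proof -
  have "sigma_algebra (space X) {B\<in>sets X. \<forall>g\<in>K n. \<forall>x\<in>B. T g x \<in> B}"
  proof (rule sigma_algebra_iff2[THEN iffD2], intro conjI allI impI ballI)
    show "{B\<in>sets X. \<forall>g\<in>K n. \<forall>x\<in>B. T g x \<in> B} \<subseteq> Pow (space X)"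
      by (auto dest: sets.sets_into_space)
    fix B assume B: "B \<in> {B\<in>sets X. \<forall>g\<in>K n. \<forall>x\<in>B. T g x \<in> B}"
    then have BX: "B \<in> sets X" and BT: "\<And>g x. g \<in> K n \<Longrightarrow> x \<in> B \<Longrightarrow> T g x \<in> B" by auto
    have "x \<in> B" if "g \<in> K n" "x \<in> space X" "T g x \<in> B" for g x
      using BT[OF K_inv[OF that(1)] that(3)] by (simp only: T_inv[OF that(2,1)])
    then show "space X - B \<in> {B\<in>sets X. \<forall>g\<in>K n. \<forall>x\<in>B. T g x \<in> B}"
      using BX by (intro CollectI conjI ballI sets.compl_sets DiffI T_space notI) (blast+)
  next
    fix B :: "nat \<Rightarrow> 'a set" assume "range B \<subseteq> {B\<in>sets X. \<forall>g\<in>K n. \<forall>x\<in>B. T g x \<in> B}"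
    then have "B i \<in> sets X" "\<forall>g\<in>K n. \<forall>x\<in>B i. T g x \<in> B i" for i by blast+
    then show "(\<Union>i. B i) \<in> {B\<in>sets X. \<forall>g\<in>K n. \<forall>x\<in>B. T g x \<in> B}"
      by (intro CollectI conjI sets.countable_UN) blast+
  qed auto
  then show ?thesis
    unfolding J_def by (rule sigma_algebra.sets_measure_of_eq)
qed

lemma measurable_JI:
  assumes "u \<in> X \<rightarrow>\<^sub>M N" "\<And>g x. g \<in> K n \<Longrightarrow> x \<in> space X \<Longrightarrow> u (T g x) = u x"
  shows "u \<in> J n \<rightarrow>\<^sub>M N"
  using assms by (auto simp: measurable_def space_J_eq sets_J_eq)

lemma sets_A [simp, measurable_cong]: "sets (A n x) = sets X"
  by (simp add: A_def)

lemma nn_integral_A: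
  assumes [measurable]: "u \<in> borel_measurable X" and x [measurable]: "x \<in> space X"
  shows "(\<integral>\<^sup>+y. u y \<partial>A n x) = avg n (\<lambda>y. F y * u y) x / avg n F x"
proof -
  have "(\<integral>\<^sup>+y. u y \<partial>A n x) = (\<integral>\<^sup>+y. F y / avg n F x * u y \<partial>distr (haar n) X (\<lambda>g. T g x))"
    unfolding A_def by (rule nn_integral_density) measurable
  also have "\<dots> = (\<integral>\<^sup>+g. F (T g x) * u (T g x) / avg n F x \<partial>haar n)"
    by (subst nn_integral_distr) (simp_all add: divide_ennreal_def mult_ac)
  also have "\<dots> = avg n (\<lambda>y. F y * u y) x / avg n F x"
    unfolding avg_def by (rule nn_integral_divide) measurable
  finally show ?thesis .
qed

lemma emeasure_A:
  assumes [measurable]: "C \<in> sets X" and x: "x \<in> space X"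
  shows "emeasure (A n x) C = avg n (\<lambda>y. F y * indicator C y) x / avg n F x"
  using nn_integral_A[OF _ x, of "indicator C" n] by simp

lemma A_T:
  assumes x: "x \<in> space X" and g: "g \<in> K n"
  shows "A n (T g x) = A n x"
proof (rule measure_eqI)
  fix C assume "C \<in> sets (A n (T g x))"
  then have [measurable]: "C \<in> sets X" by simp
  show "emeasure (A n (T g x)) C = emeasure (A n x) C"
    using x g by (subst (1 2) emeasure_A) (simp_all add: avg_T)
qed simp

lemma A_prob: "x \<in> space X \<Longrightarrow> prob_space (A n x)"
  using nn_integral_A[of "\<lambda>_. 1" x n] avg_F[of x n] sets_eq_imp_space_eq[OF sets_A, of n x]
  by (intro prob_spaceI) (simp add: ennreal_divide_self less_top)

sublocale gibbs_specification X J A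
proof
  show "subalgebra X (J n)" for n
    by (auto simp: subalgebra_def space_J_eq sets_J_eq)
  show "sets (J (Suc n)) \<subseteq> sets (J n)" for n
    using K_mono[of n] by (auto simp: sets_J_eq)
  show "A n \<in> J n \<rightarrow>\<^sub>M prob_algebra X" for n
  proof (rule measurable_JI)
    show "A n \<in> X \<rightarrow>\<^sub>M prob_algebra X"
    proof (rule measurable_prob_algebraI)
      show "A n \<in> X \<rightarrow>\<^sub>M subprob_algebra X"
      proof (rule measurable_subprob_algebra)
        fix C assume [measurable]: "C \<in> sets X"
        have "(\<lambda>x. avg n (\<lambda>y. F y * indicator C y) x / avg n F x) \<in> borel_measurable X"
          by measurable
        then show "(\<lambda>x. emeasure (A n x) C) \<in> borel_measurable X"
          by (rule measurable_cong[THEN iffD1, rotated]) (simp add: emeasure_A)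
      qed (auto intro: prob_space_imp_subprob_space A_prob)
    qed (rule A_prob)
  qed (rule A_T)
  show "emeasure (A n x) B = 1" if "B \<in> sets (J n)" "x \<in> B" for B n x
  proof -
    have B: "B \<in> sets X" "\<And>g. g \<in> K n \<Longrightarrow> T g x \<in> B" using that by (auto simp: sets_J_eq)
    then have x: "x \<in> space X" using that(2) sets.sets_into_space by auto
    \<comment> \<open>An invariant set contains the whole \<open>K n\<close>-orbit of each of its
      points, so the indicator is 1 throughout the average.\<close>
    have "avg n (\<lambda>y. F y * indicator B y) x = avg n F x"
      unfolding avg_def using B by (intro nn_integral_cong) simp
    then show ?thesis
      using B x avg_F[OF x, of n] by (simp add: emeasure_A ennreal_divide_self less_top)
  qed
qed

section \<open>Invariant measures and Gibbs measures\<close>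

lemma invariant_nn_integral:
  assumes inv: "invariant_measure G T \<nu>" and s: "sets \<nu> = sets X"
    and "u \<in> borel_measurable X" "g \<in> K n"
  shows "(\<integral>\<^sup>+x. u (T g x) \<partial>\<nu>) = (\<integral>\<^sup>+x. u x \<partial>\<nu>)"
proof -
  note [measurable_cong] = s
  have "(\<integral>\<^sup>+x. u x \<partial>\<nu>) = (\<integral>\<^sup>+x. u x \<partial>distr \<nu> \<nu> (T g))"
    using inv assms(4) K_carrier by (simp add: invariant_measure_def)
  also have "\<dots> = (\<integral>\<^sup>+x. u (T g x) \<partial>\<nu>)"
    using assms(3) measurable_T[OF assms(4)] by (intro nn_integral_distr) auto
  finally show ?thesis by simp
qed

text \<open>Fubini and invariance move the group element from \<open>v\<close> to the weight
  \<open>F\<close>, where it appears inverted. By \<open>avg_inv\<close> the average of the weight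
  is \<open>avg n F\<close>, and this cancels the normalising denominator of
  \<open>A n\<close>.\<close>

lemma invariant_imp_gibbs:
  assumes inv: "invariant_measure G T \<nu>" and s [measurable_cong]: "sets \<nu> = sets X"
    and sf: "sigma_finite_measure \<nu>" and P: "prob_space (density \<nu> (\<lambda>x. c * F x))"
  shows "gibbs (density \<nu> (\<lambda>x. c * F x))"
  unfolding gibbs_def
proof (intro conjI allI ballI)
  show "density \<nu> (\<lambda>x. c * F x) \<in> space (prob_algebra X)"
    using P s by (simp add: space_prob_algebra)
  have sp: "space \<nu> = space X" by (rule sets_eq_imp_space_eq[OF s])
  interpret sigma_finite_measure \<nu> by (rule sf)
  fix n C assume C [measurable]: "C \<in> sets X"
  interpret H: prob_space "haar n" by (rule prob_space_haar)
  interpret pair_sigma_finite "haar n" \<nu> ..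
  \<comment> \<open>The denominator is a \<open>K n\<close>-invariant function, so it may be taken
    at \<open>T g x\<close> instead of \<open>x\<close>; this puts everything except
    \<open>F x\<close> into one function of \<open>T g x\<close>.\<close>
  define v where "v y = indicator C y * F y / avg n F y" for y
  have [measurable]: "v \<in> borel_measurable X" unfolding v_def by measurable
  have A: "F x * emeasure (A n x) C = (\<integral>\<^sup>+g. F x * v (T g x) \<partial>haar n)" if x [measurable]: "x \<in> space X" for x
  proof -
    have "(\<integral>\<^sup>+g. F x * v (T g x) \<partial>haar n) = F x * (\<integral>\<^sup>+g. F (T g x) * indicator C (T g x) / avg n F x \<partial>haar n)"
      unfolding v_def by (subst nn_integral_cmult, measurable) (auto intro!: nn_integral_cong arg_cong2[where f="(*)"] simp: avg_T x mult.commute)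
    also have "\<dots> = F x * (avg n (\<lambda>y. F y * indicator C y) x / avg n F x)"
      unfolding avg_def by (subst nn_integral_divide) auto
    finally show ?thesis using x by (simp add: emeasure_A)
  qed
  have "(\<integral>\<^sup>+x. F x * emeasure (A n x) C \<partial>\<nu>) = (\<integral>\<^sup>+x. (\<integral>\<^sup>+g. F x * v (T g x) \<partial>haar n) \<partial>\<nu>)"
    by (rule nn_integral_cong) (simp add: A sp)
  also have "\<dots> = (\<integral>\<^sup>+g. (\<integral>\<^sup>+x. F x * v (T g x) \<partial>\<nu>) \<partial>haar n)"
    by (rule Fubini') measurable
  also have "\<dots> = (\<integral>\<^sup>+g. (\<integral>\<^sup>+x. F (T (inv g) x) * v x \<partial>\<nu>) \<partial>haar n)"
  proof (rule nn_integral_cong)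
    fix g assume "g \<in> space (haar n)"
    then have g [measurable]: "g \<in> K n" by simp
    note [measurable] = measurable_T[OF g] measurable_T[OF K_inv[OF g]]
    have "(\<integral>\<^sup>+x. F x * v (T g x) \<partial>\<nu>) = (\<integral>\<^sup>+x. F (T (inv g) (T g x)) * v (T g x) \<partial>\<nu>)"
      by (rule nn_integral_cong) (simp add: T_inv[OF _ g] sp)
    also have "\<dots> = (\<integral>\<^sup>+x. F (T (inv g) x) * v x \<partial>\<nu>)"
      by (rule invariant_nn_integral[OF inv s _ g, where u="\<lambda>x. F (T (inv g) x) * v x"]) measurable
    finally show "(\<integral>\<^sup>+x. F x * v (T g x) \<partial>\<nu>) = (\<integral>\<^sup>+x. F (T (inv g) x) * v x \<partial>\<nu>)" .
  qed
  also have "\<dots> = (\<integral>\<^sup>+x. (\<integral>\<^sup>+g. F (T (inv g) x) * v x \<partial>haar n) \<partial>\<nu>)"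
    by (rule Fubini'[symmetric]) measurable
  also have "\<dots> = (\<integral>\<^sup>+x. indicator C x * F x \<partial>\<nu>)"
  proof (rule nn_integral_cong)
    fix x assume "x \<in> space \<nu>"
    then have x [measurable]: "x \<in> space X" by (simp add: sp)
    have "(\<integral>\<^sup>+g. F (T (inv g) x) * v x \<partial>haar n) = avg n F x * v x"
      by (subst nn_integral_multc, measurable) (simp add: avg_inv[OF _ x, of F])
    also have "\<dots> = indicator C x * F x"
      unfolding v_def by (rule ennreal_mult_divide_cancel[OF avg_F[OF x]])
    finally show "(\<integral>\<^sup>+g. F (T (inv g) x) * v x \<partial>haar n) = indicator C x * F x" .
  qed
  finally have "(\<integral>\<^sup>+x. c * (F x * emeasure (A n x) C) \<partial>\<nu>) = (\<integral>\<^sup>+x. c * (indicator C x * F x) \<partial>\<nu>)"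
    by (simp add: nn_integral_cmult)
  then show "(\<integral>\<^sup>+y. emeasure (A n y) C \<partial>density \<nu> (\<lambda>x. c * F x)) = emeasure (density \<nu> (\<lambda>x. c * F x)) C"
    by (simp add: nn_integral_density emeasure_density mult_ac)
qed

text \<open>In one step of \<open>A n\<close> the density \<open>c / F\<close> cancels the weight
  \<open>F\<close>. The integral of \<open>u\<close> then depends on \<open>u\<close> only through
  its Haar average over \<open>K n\<close>, which by \<open>avg_comp\<close> does not change when
  \<open>u\<close> is moved by \<open>g\<close>.\<close>

lemma gibbs_imp_invariant:
  assumes \<Theta>: "gibbs \<Theta>"
  shows "invariant_measure G T (density \<Theta> (\<lambda>x. c / F x))"
  unfolding invariant_measure_def
proof
  note [measurable_cong] = gibbsD(2)[OF \<Theta>]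
  interpret prob_space \<Theta> by (rule gibbsD[OF \<Theta>])
  have sp: "space \<Theta> = space X" by (rule gibbsD[OF \<Theta>])
  let ?\<eta> = "density \<Theta> (\<lambda>x. c / F x)"
  fix g assume "g \<in> carrier G"
  then obtain n where g: "g \<in> K n" by (auto simp: carrier_eq)
  note [measurable] = measurable_T[OF g]
  have An: "A n \<in> \<Theta> \<rightarrow>\<^sub>M subprob_algebra X"
    using measurable_prob_algebraD[OF measurable_J_D[OF kernel], of n] by simp
  have sb: "sets (\<Theta> \<bind> A n) = sets X"
    by (rule sets_bind) (simp_all add: not_empty)
  have \<Theta>A: "\<Theta> \<bind> A n = \<Theta>"
  proof (rule measure_eqI)
    fix B assume "B \<in> sets (\<Theta> \<bind> A n)"
    then show "emeasure (\<Theta> \<bind> A n) B = emeasure \<Theta> B"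
      using \<Theta> by (simp add: sb emeasure_bind[OF not_empty An] gibbs_def)
  qed (simp add: sb gibbsD(2)[OF \<Theta>])
  have int: "(\<integral>\<^sup>+x. u x \<partial>?\<eta>) = (\<integral>\<^sup>+x. c * avg n u x / avg n F x \<partial>\<Theta>)"
    if [measurable]: "u \<in> borel_measurable X" for u
  proof -
    have "(\<integral>\<^sup>+x. u x \<partial>?\<eta>) = (\<integral>\<^sup>+x. c / F x * u x \<partial>(\<Theta> \<bind> A n))"
      unfolding \<Theta>A by (rule nn_integral_density) measurable
    also have "\<dots> = (\<integral>\<^sup>+x. (\<integral>\<^sup>+y. c / F y * u y \<partial>A n x) \<partial>\<Theta>)"
      by (rule nn_integral_bind[OF _ An]) measurable
    also have "\<dots> = (\<integral>\<^sup>+x. c * avg n u x / avg n F x \<partial>\<Theta>)"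
    proof (rule nn_integral_cong)
      fix x assume "x \<in> space \<Theta>"
      then have x [measurable]: "x \<in> space X" by (simp add: sp)
      have "avg n (\<lambda>y. F y * (c / F y * u y)) x = (\<integral>\<^sup>+g. c * u (T g x) \<partial>haar n)"
        unfolding avg_def
      proof (rule nn_integral_cong)
        fix g assume "g \<in> space (haar n)"
        then have "F (T g x) * (c / F (T g x)) = c"
          using F_pos x by (intro ennreal_mult_divide_cancel) auto
        then show "F (T g x) * (c / F (T g x) * u (T g x)) = c * u (T g x)"
          by (simp only: mult.assoc[symmetric])
      qed
      also have "\<dots> = c * avg n u x"
        unfolding avg_def by (rule nn_integral_cmult) measurable
      finally show "(\<integral>\<^sup>+y. c / F y * u y \<partial>A n x) = c * avg n u x / avg n F x"
        by (subst nn_integral_A[OF _ x]) simp_all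
    qed
    finally show ?thesis .
  qed
  show "distr ?\<eta> ?\<eta> (T g) = ?\<eta>"
  proof (rule measure_eqI)
    fix B assume "B \<in> sets (distr ?\<eta> ?\<eta> (T g))"
    then have [measurable]: "B \<in> sets X" by (simp add: gibbsD(2)[OF \<Theta>])
    have "emeasure (distr ?\<eta> ?\<eta> (T g)) B = (\<integral>\<^sup>+x. indicator B x \<partial>distr ?\<eta> ?\<eta> (T g))"
      by simp
    also have "\<dots> = (\<integral>\<^sup>+x. indicator B (T g x) \<partial>?\<eta>)"
      by (rule nn_integral_distr) measurable
    also have "\<dots> = (\<integral>\<^sup>+x. c * avg n (\<lambda>x. indicator B (T g x)) x / avg n F x \<partial>\<Theta>)"
      by (rule int) measurable
    also have "\<dots> = (\<integral>\<^sup>+x. c * avg n (indicator B) x / avg n F x \<partial>\<Theta>)"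
      by (rule nn_integral_cong) (simp add: avg_comp[OF _ _ g] sp)
    also have "\<dots> = (\<integral>\<^sup>+x. indicator B x \<partial>?\<eta>)"
      by (rule int[symmetric]) measurable
    finally show "emeasure (distr ?\<eta> ?\<eta> (T g)) B = emeasure ?\<eta> B"
      by simp
  qed simp
qed

text \<open>A \<open>G\<close>-invariant set belongs to every \<open>J n\<close>, hence to the tail,
  and a density with respect to \<open>\<Theta>\<close> keeps \<open>\<Theta>\<close>-null sets
  null.\<close>

lemma gibbs_trivial_imp_ergodic:
  assumes \<Theta>: "gibbs \<Theta>"
    and triv: "\<And>B. B \<in> sets tail \<Longrightarrow> emeasure \<Theta> B = 0 \<or> emeasure \<Theta> (space X - B) = 0"
  shows "ergodic_measure G T (density \<Theta> (\<lambda>x. c / F x))"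
  unfolding ergodic_measure_def
proof (intro ballI impI)
  note [measurable_cong] = gibbsD(2)[OF \<Theta>]
  have sp: "space \<Theta> = space X" by (rule gibbsD[OF \<Theta>])
  let ?\<eta> = "density \<Theta> (\<lambda>x. c / F x)"
  fix B assume "B \<in> sets ?\<eta>" and inv: "\<forall>g\<in>carrier G. T g ` B = B"
  then have B [measurable]: "B \<in> sets X" by (simp add: gibbsD(2)[OF \<Theta>])
  have "T g x \<in> B" if "g \<in> K n" "x \<in> B" for g x n
    using bspec[OF inv K_carrier[OF that(1)]] that(2) by blast
  then have "B \<in> sets (J n)" for n
    using B unfolding sets_J_eq by blast
  then have "emeasure \<Theta> B = 0 \<or> emeasure \<Theta> (space X - B) = 0"
    by (intro triv) (auto simp: sets_tail)
  moreover have "emeasure ?\<eta> D = 0" if "emeasure \<Theta> D = 0" and [measurable]: "D \<in> sets X" for D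
  proof -
    have "absolutely_continuous \<Theta> ?\<eta>"
      by (rule absolutely_continuousI_density) measurable
    moreover have "D \<in> null_sets \<Theta>" using that by (simp add: null_sets_def gibbsD(2)[OF \<Theta>])
    ultimately have "D \<in> null_sets ?\<eta>" unfolding absolutely_continuous_def by blast
    then show ?thesis by (rule null_setsD1)
  qed
  ultimately show "emeasure ?\<eta> B = 0 \<or> emeasure ?\<eta> (space ?\<eta> - B) = 0"
    using B by (auto simp: sp)
qed

end

section \<open>Ergodic decomposition\<close>

lemma standard_borel_space_coordinates:
  assumes "standard_borel_space X"
  obtains h :: "'a \<Rightarrow> real" and g where "h \<in> X \<rightarrow>\<^sub>M borel" "g \<in> borel \<rightarrow>\<^sub>M X"
    "\<And>x. x \<in> space X \<Longrightarrow> h x \<in> {0..1}" "\<And>x. x \<in> space X \<Longrightarrow> g (h x) = x"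
    "\<And>t. t \<in> {0..1} \<Longrightarrow> h (g t) = t"
proof -
  obtain h :: "'a \<Rightarrow> real" where h: "bij_betw h (space X) {0..1}"
    and eq: "(\<lambda>A. h ` A) ` sets X = sets (restrict_space borel {0..1})"
    using assms by (auto simp: standard_borel_space_def)
  have inj: "inj_on h (space X)" and im: "h ` space X = {0..1}"
    using h by (auto simp: bij_betw_def)
  have iff: "h x \<in> h ` A \<longleftrightarrow> x \<in> A" if "x \<in> space X" "A \<in> sets X" for x A
    using that sets.sets_into_space[OF that(2)] inj by (auto dest: inj_onD)
  \<comment> \<open>Outside the unit interval \<open>g\<close> repeats its value at 0, which makes
    it a Borel map on the whole line.\<close>
  define g where "g t = inv_into (space X) h (if t \<in> {0..1} then t else 0)" for t
  have g: "g t \<in> space X" "h (g t) = (if t \<in> {0..1} then t else 0)" for t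
    unfolding g_def using im by (auto intro!: inv_into_into f_inv_into_f)
  show ?thesis
  proof (rule that[of h g])
    show "h \<in> X \<rightarrow>\<^sub>M borel"
    proof (rule measurableI)
      fix B :: "real set" assume B: "B \<in> sets borel"
      then have "B \<inter> {0..1} \<in> sets (restrict_space borel {0..1})"
        by (auto simp: sets_restrict_space)
      then obtain A where A: "A \<in> sets X" "B \<inter> {0..1} = h ` A"
        using eq by (metis imageE)
      have "h -` B \<inter> space X = A"
      proof (intro antisym subsetI)
        fix x assume x: "x \<in> h -` B \<inter> space X"
        then have "h x \<in> B \<inter> {0..1}" using im by blast
        then show "x \<in> A" using iff[OF _ A(1)] x unfolding A(2) by blast
      next
        fix x assume "x \<in> A"
        then show "x \<in> h -` B \<inter> space X" using A sets.sets_into_space[OF A(1)] by blast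
      qed
      then show "h -` B \<inter> space X \<in> sets X" using A by simp
    qed simp
    show "g \<in> borel \<rightarrow>\<^sub>M X"
    proof (rule measurableI)
      fix A assume A: "A \<in> sets X"
      then have "h ` A \<in> sets (restrict_space borel {0..1})" using eq by blast
      then have [measurable]: "h ` A \<in> sets borel"
        by (auto simp: sets_restrict_space)
      have "g -` A \<inter> space borel = {t\<in>space borel. (if t \<in> {0..1} then t else 0) \<in> h ` A}"
        using iff[OF g(1) A] by (auto simp: g(2))
      also have "\<dots> \<in> sets borel" by measurable
      finally show "g -` A \<inter> space borel \<in> sets borel" .
    qed (rule g)
    show "h x \<in> {0..1}" if "x \<in> space X" for x using that im by blast
    then show "g (h x) = x" if "x \<in> space X" for x
      using that inj by (simp add: g_def)
    show "h (g t) = t" if "t \<in> {0..1}" for t using that by (simp add: g)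
  qed
qed

section \<open>The measurable space of sigma-finite measures\<close>

lemma space_sigma_finite_algebra: "space (sigma_finite_algebra X) = sigma_finite_measures X"
  unfolding sigma_finite_algebra_def by (rule space_measure_of) auto

lemma measurable_sigma_finite_algebraI:
  assumes "\<And>x. x \<in> space M \<Longrightarrow> k x \<in> sigma_finite_measures X"
    and [measurable]: "\<And>B. B \<in> sets X \<Longrightarrow> (\<lambda>x. emeasure (k x) B) \<in> borel_measurable M"
  shows "k \<in> M \<rightarrow>\<^sub>M sigma_finite_algebra X"
  unfolding sigma_finite_algebra_def
proof (rule measurable_measure_of)
  fix Y assume "Y \<in> {{\<eta> \<in> sigma_finite_measures X.
           ereal \<alpha> < enn2ereal (emeasure \<eta> A) \<and> enn2ereal (emeasure \<eta> A) < ereal \<beta>} |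
        \<alpha> \<beta> A. A \<in> sets X}"
  then obtain \<alpha> \<beta> B where [measurable]: "B \<in> sets X" and Y: "Y = {\<eta> \<in> sigma_finite_measures X.
           ereal \<alpha> < enn2ereal (emeasure \<eta> B) \<and> enn2ereal (emeasure \<eta> B) < ereal \<beta>}" by blast
  have "k -` Y \<inter> space M =
      {x\<in>space M. ereal \<alpha> < enn2ereal (emeasure (k x) B) \<and> enn2ereal (emeasure (k x) B) < ereal \<beta>}"
    using assms(1) by (auto simp: Y)
  also have "\<dots> \<in> sets M" by measurable
  finally show "k -` Y \<inter> space M \<in> sets M" .
qed (use assms(1) in auto)

text \<open>The generators have real bounds on both sides. The lower bound -1 is always satisfied,
  and countably many rational upper bounds exhaust the set below a possibly infinite
  \<open>y\<close>.\<close>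

lemma emeasure_measurable_sigma_finite_algebra:
  assumes B: "B \<in> sets X"
  shows "(\<lambda>\<eta>. emeasure \<eta> B) \<in> borel_measurable (sigma_finite_algebra X)"
proof (rule borel_measurableI_less)
  fix y :: ennreal
  let ?S = "sigma_finite_measures X"
  let ?I = "{q::rat. 0 \<le> q \<and> ennreal (of_rat q) \<le> y}"
  let ?U = "\<lambda>q. {\<eta>\<in>?S. ereal (-1) < enn2ereal (emeasure \<eta> B) \<and> enn2ereal (emeasure \<eta> B) < ereal (of_rat q)}"
  have lower: "ereal (-1) < enn2ereal a" for a
    using enn2ereal_nonneg[of a] by (rule less_le_trans[rotated]) simp
  have upper: "enn2ereal a < ereal (of_rat q) \<longleftrightarrow> a < ennreal (of_rat q)" if "0 \<le> q" for a and q :: rat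
    using that by (simp add: less_ennreal.rep_eq)
  have "{\<eta> \<in> space (sigma_finite_algebra X). emeasure \<eta> B < y} = (\<Union>q\<in>?I. ?U q)"
  proof (intro antisym subsetI)
    fix \<eta> assume \<eta>: "\<eta> \<in> {\<eta> \<in> space (sigma_finite_algebra X). emeasure \<eta> B < y}"
    then obtain r :: rat where r: "emeasure \<eta> B < ennreal (of_rat r)" "ennreal (of_rat r) < y"
      using ennreal_rat_dense[of "emeasure \<eta> B" y] by auto
    have "0 \<le> r"
    proof (rule ccontr)
      assume "\<not> 0 \<le> r"
      then have "ennreal (of_rat r) = 0" by (intro ennreal_neg) (simp add: less_imp_le)
      then show False using r(1) by simp
    qed
    then show "\<eta> \<in> (\<Union>q\<in>?I. ?U q)"
      using \<eta> r lower by (intro UN_I[of r]) (auto simp: upper space_sigma_finite_algebra less_imp_le)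
  next
    fix \<eta> assume "\<eta> \<in> (\<Union>q\<in>?I. ?U q)"
    then show "\<eta> \<in> {\<eta> \<in> space (sigma_finite_algebra X). emeasure \<eta> B < y}"
      by (auto simp: upper space_sigma_finite_algebra intro: less_le_trans)
  qed
  moreover have "?U q \<in> sets (sigma_finite_algebra X)" for q
    unfolding sigma_finite_algebra_def using B by (intro in_measure_of) blast+
  ultimately show "{\<eta> \<in> space (sigma_finite_algebra X). emeasure \<eta> B < y} \<in> sets (sigma_finite_algebra X)"
    by (simp only:) (rule sets.countable_UN'', auto)
qed

text \<open>Makes the normalisation defining \<open>\<Omega>\<close> and the reweighting map
  \<open>?L\<close> measurable in the final argument.\<close>

lemma nn_integral_measurable_sigma_finite_algebra:
  assumes u: "u \<in> borel_measurable X"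
  shows "(\<lambda>\<eta>. \<integral>\<^sup>+x. u x \<partial>\<eta>) \<in> borel_measurable (sigma_finite_algebra X)" (is "_ \<in> ?B")
  using u
proof induct
  have S: "sets \<eta> = sets X" if "\<eta> \<in> space (sigma_finite_algebra X)" for \<eta>
    using that by (auto simp: space_sigma_finite_algebra sigma_finite_measures_def)
  have sp: "space \<eta> = space X" if "\<eta> \<in> space (sigma_finite_algebra X)" for \<eta>
    by (rule sets_eq_imp_space_eq[OF S[OF that]])
  have B: "v \<in> borel_measurable \<eta>" if "\<eta> \<in> space (sigma_finite_algebra X)" "v \<in> borel_measurable X"
    for \<eta> and v :: "'a \<Rightarrow> ennreal"
    using that(2) by (simp cong: measurable_cong_sets add: S[OF that(1)])
  note [measurable] = emeasure_measurable_sigma_finite_algebra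
  {
    case (cong v w)
    then show ?case
      by (subst measurable_cong[where g="\<lambda>\<eta>. \<integral>\<^sup>+x. w x \<partial>\<eta>"]) (auto intro!: nn_integral_cong simp: sp)
  next
    case (set A)
    then show ?case
      by (subst measurable_cong[where g="\<lambda>\<eta>. emeasure \<eta> A"]) (auto simp: S)
  next
    case (mult u c)
    then show ?case
      by (subst measurable_cong[where g="\<lambda>\<eta>. c * (\<integral>\<^sup>+x. u x \<partial>\<eta>)"]) (auto intro!: nn_integral_cmult B)
  next
    case (add u v)
    then show ?case
      by (subst measurable_cong[where g="\<lambda>\<eta>. (\<integral>\<^sup>+x. v x \<partial>\<eta>) + (\<integral>\<^sup>+x. u x \<partial>\<eta>)"]) (auto intro!: nn_integral_add B)
  next
    case (seq U)
    have eq: "(SUP i. U i) = (\<lambda>x. SUP i. U i x)" by (rule ext) (rule SUP_apply)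
    have "integral\<^sup>N \<eta> (SUP i. U i) = (SUP i. integral\<^sup>N \<eta> (U i))"
      if "\<eta> \<in> space (sigma_finite_algebra X)" for \<eta>
      unfolding eq by (rule nn_integral_monotone_convergence_SUP[OF seq(4) B[OF that seq(1)]])
    then show ?case
      using seq(3) by (subst measurable_cong[where g="\<lambda>\<eta>. SUP i. integral\<^sup>N \<eta> (U i)"]) simp_all
  }
qed

section \<open>Assembling the ergodic decomposition\<close>

context inductively_compact_action
begin

lemma ergodic_decomposition_exists:
  assumes X: "standard_borel_space X" and s [measurable_cong]: "sets \<nu> = sets X"
    and sf: "sigma_finite_measure \<nu>" and inv: "invariant_measure G T \<nu>" and int: "integrable \<nu> f"
  shows "\<exists>\<nu>'. ergodic_decomposition G X T \<nu> \<nu>'"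
proof (cases "(\<integral>\<^sup>+x. F x \<partial>\<nu>) = 0")
  \<comment> \<open>As \<open>f\<close> is positive, \<open>\<nu>\<close> is zero here and cannot be
    normalised; the zero measure on the space of measures decomposes it.\<close>
  case True
  have sp: "space \<nu> = space X" by (rule sets_eq_imp_space_eq[OF s])
  have "AE x in \<nu>. F x = 0"
    using True by (subst (asm) nn_integral_0_iff_AE) auto
  then have "AE x in \<nu>. False"
    using AE_space by eventually_elim (use F_pos sp in auto)
  then have "emeasure \<nu> (space \<nu>) = 0"
    by (simp add: AE_iff_measurable[OF sets.top])
  then have "emeasure \<nu> B = 0" for B
    using emeasure_space[of \<nu> B] by simp
  then have "ergodic_decomposition G X T \<nu> (null_measure (sigma_finite_algebra X))"
    by (auto simp: ergodic_decomposition_def emeasure_measurable_sigma_finite_algebra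
        intro!: finite_measure.axioms(1) finite_measureI AE_I[of _ _ "space (sigma_finite_algebra X)"]
        cong: measurable_cong_sets)
  then show ?thesis by blast
next
  case False
  have sp: "space \<nu> = space X" by (rule sets_eq_imp_space_eq[OF s])
  \<comment> \<open>The total mass of \<open>\<nu>\<close> weighted by \<open>f\<close>. The density
    \<open>c * F\<close> turns \<open>\<nu>\<close> into the probability measure \<open>P\<close>,
    and \<open>c0 / F\<close> undoes it.\<close>
  define c0 where "c0 = (\<integral>\<^sup>+x. F x \<partial>\<nu>)"
  have c0: "c0 \<noteq> 0" "c0 \<noteq> \<infinity>"
  proof -
    have "c0 = (\<integral>\<^sup>+x. norm (f x) \<partial>\<nu>)"
      unfolding c0_def using f_pos by (intro nn_integral_cong) (simp add: sp less_imp_le)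
    also have "\<dots> < \<infinity>" using int by (simp add: integrable_iff_bounded)
    finally show "c0 \<noteq> \<infinity>" by simp
    show "c0 \<noteq> 0" using False by (simp add: c0_def)
  qed
  define c where "c = 1 / c0"
  have c0c: "c0 * c = 1" unfolding c_def using c0 by (rule ennreal_mult_divide_cancel)
  have cF: "c0 / F x * (c * F x) = 1" "c * F x * (c0 / F x) = 1" if "x \<in> space X" for x
  proof -
    have "F x * (c0 / F x) = c0"
      using F_pos[OF that] by (intro ennreal_mult_divide_cancel) auto
    then show "c * F x * (c0 / F x) = 1" using c0c by (simp only: mult.assoc) (simp only: mult.commute)
    then show "c0 / F x * (c * F x) = 1" by (simp only: mult.commute)
  qed
  define P where "P = density \<nu> (\<lambda>x. c * F x)"
  have P: "prob_space P"
  proof (rule prob_spaceI)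
    have "emeasure P (space P) = c * c0"
      by (simp add: P_def emeasure_density nn_integral_cmult c0_def cong: nn_integral_cong_simp)
    then show "emeasure P (space P) = 1" using c0c by (simp add: mult.commute)
  qed
  have gP: "gibbs P"
    unfolding P_def by (rule invariant_imp_gibbs[OF inv s sf P[unfolded P_def]])
  note [measurable_cong] = gibbsD(2)[OF gP]
  have spP: "space P = space X" by (rule gibbsD[OF gP])
  interpret P: prob_space P by (rule P)
  obtain h :: "'a \<Rightarrow> real" and g where hg: "h \<in> X \<rightarrow>\<^sub>M borel" "g \<in> borel \<rightarrow>\<^sub>M X"
    "\<And>x. x \<in> space X \<Longrightarrow> h x \<in> {0..1}" "\<And>x. x \<in> space X \<Longrightarrow> g (h x) = x"
    "\<And>t. t \<in> {0..1} \<Longrightarrow> h (g t) = t"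
    using standard_borel_space_coordinates[OF X] by blast
  interpret standard_gibbs_specification X J A h g
    by unfold_locales (use hg in auto)
  obtain \<kappa> S where \<kappa>: "\<kappa> \<in> X \<rightarrow>\<^sub>M prob_algebra X" and S [measurable]: "S \<in> sets (prob_algebra X)"
    and \<kappa>S: "AE x in P. \<kappa> x \<in> S" and S_gibbs: "\<And>\<Theta>. \<Theta> \<in> S \<Longrightarrow> gibbs \<Theta>"
    and S_triv: "\<And>\<Theta> B. \<Theta> \<in> S \<Longrightarrow> B \<in> sets tail \<Longrightarrow> emeasure \<Theta> B = 0 \<or> emeasure \<Theta> (space X - B) = 0"
    and dis: "\<And>u. u \<in> borel_measurable X \<Longrightarrow> (\<integral>\<^sup>+x. (\<integral>\<^sup>+y. u y \<partial>\<kappa> x) \<partial>P) = (\<integral>\<^sup>+y. u y \<partial>P)"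
    using gibbs_decomposition[OF gP] by blast
  have \<kappa>_prob: "prob_space (\<kappa> x)" and \<kappa>_sets: "sets (\<kappa> x) = sets X" if "x \<in> space X" for x
    using measurable_space[OF \<kappa> that] by (auto simp: space_prob_algebra)
  have \<kappa>_nn: "(\<lambda>x. \<integral>\<^sup>+y. u y \<partial>\<kappa> x) \<in> borel_measurable X" if "u \<in> borel_measurable X" for u
    using measurable_compose[OF measurable_prob_algebraD[OF \<kappa>] nn_integral_measurable_subprob_algebra[OF that]] .
  let ?\<M> = "sigma_finite_algebra X"
  \<comment> \<open>Mutually inverse passages between probability measures and measures that
    integrate \<open>f\<close> to \<open>c0\<close>.\<close>
  let ?D = "\<lambda>\<Theta>. density \<Theta> (\<lambda>x. c0 / F x)" and ?L = "\<lambda>\<eta>. density \<eta> (\<lambda>x. c * F x)"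
  have DL: "?L (?D \<Theta>) = \<Theta>" "?D (?L \<Theta>) = \<Theta>" if [measurable_cong]: "sets \<Theta> = sets X" for \<Theta>
  proof -
    have sp: "space \<Theta> = space X" by (rule sets_eq_imp_space_eq[OF that])
    have "?L (?D \<Theta>) = density \<Theta> (\<lambda>x. c0 / F x * (c * F x))"
      by (rule density_density_eq) measurable
    also have "\<dots> = density \<Theta> (\<lambda>_. 1)"
      by (rule density_cong) (auto simp: cF sp)
    finally show "?L (?D \<Theta>) = \<Theta>" by (simp add: density_1)
    have "?D (?L \<Theta>) = density \<Theta> (\<lambda>x. c * F x * (c0 / F x))"
      by (rule density_density_eq) measurable
    also have "\<dots> = density \<Theta> (\<lambda>_. 1)"
      by (rule density_cong) (auto simp: cF sp)
    finally show "?D (?L \<Theta>) = \<Theta>" by (simp add: density_1)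
  qed
  have D_em: "emeasure (?D (\<kappa> x)) B = (\<integral>\<^sup>+y. c0 / F y * indicator B y \<partial>\<kappa> x)"
    if "x \<in> space X" and [measurable]: "B \<in> sets X" for x B
  proof -
    note [measurable_cong] = \<kappa>_sets[OF that(1)]
    show ?thesis by (rule emeasure_density) measurable
  qed
  have k: "(\<lambda>x. ?D (\<kappa> x)) \<in> P \<rightarrow>\<^sub>M ?\<M>"
  proof (rule measurable_sigma_finite_algebraI)
    fix x assume "x \<in> space P"
    then have x: "x \<in> space X" by (simp add: spP)
    note [measurable_cong] = \<kappa>_sets[OF x]
    interpret \<kappa>: prob_space "\<kappa> x" by (rule \<kappa>_prob[OF x])
    \<comment> \<open>A finite density over a probability measure gives a sigma-finite measure,
      possibly of infinite mass.\<close>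
    have "c0 / F y \<noteq> \<infinity>" if "y \<in> space X" for y
      using F_pos[OF that] c0 by (simp add: ennreal_divide_eq_top_iff)
    then have "AE y in \<kappa> x. c0 / F y \<noteq> \<infinity>"
      by (intro AE_I2) (auto simp: sets_eq_imp_space_eq[OF \<kappa>_sets[OF x]])
    then have "sigma_finite_measure (?D (\<kappa> x))"
      by (subst \<kappa>.sigma_finite_iff_density_finite) measurable
    then show "?D (\<kappa> x) \<in> sigma_finite_measures X"
      by (simp add: sigma_finite_measures_def \<kappa>_sets[OF x])
  next
    fix B assume [measurable]: "B \<in> sets X"
    have "(\<lambda>x. \<integral>\<^sup>+y. c0 / F y * indicator B y \<partial>\<kappa> x) \<in> borel_measurable P"
      using \<kappa>_nn[of "\<lambda>y. c0 / F y * indicator B y"] by measurable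
    then show "(\<lambda>x. emeasure (?D (\<kappa> x)) B) \<in> borel_measurable P"
      by (rule measurable_cong[THEN iffD1, rotated]) (simp add: D_em spP)
  qed
  \<comment> \<open>The decomposing measure is the law of the reweighted conditional measure of a
    \<open>P\<close>-random point.\<close>
  define \<nu>' where "\<nu>' = distr P ?\<M> (\<lambda>x. ?D (\<kappa> x))"
  note emeasure_measurable_sigma_finite_algebra[measurable]
  \<comment> \<open>Exactly the measures that \<open>?L\<close> turns into probability measures, so
    that membership of \<open>?L \<eta>\<close> in \<open>S\<close> can be tested measurably
    there.\<close>
  define \<Omega> where "\<Omega> = {\<eta>\<in>space ?\<M>. (\<integral>\<^sup>+x. c * F x \<partial>\<eta>) = 1}"
  have \<M>_sets: "sets \<eta> = sets X" if "\<eta> \<in> space ?\<M>" for \<eta>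
    using that by (simp add: space_sigma_finite_algebra sigma_finite_measures_def)
  have \<Omega> [measurable]: "\<Omega> \<in> sets ?\<M>"
  proof -
    have [measurable]: "(\<lambda>\<eta>. \<integral>\<^sup>+x. c * F x \<partial>\<eta>) \<in> borel_measurable ?\<M>"
      by (rule nn_integral_measurable_sigma_finite_algebra) measurable
    show ?thesis unfolding \<Omega>_def by measurable
  qed
  have L: "?L \<in> restrict_space ?\<M> \<Omega> \<rightarrow>\<^sub>M prob_algebra X"
  proof (rule measurable_prob_algebraI)
    have prob: "prob_space (?L \<eta>)" if "\<eta> \<in> space (restrict_space ?\<M> \<Omega>)" for \<eta>
    proof (rule prob_spaceI)
      have \<eta>: "\<eta> \<in> space ?\<M>" "(\<integral>\<^sup>+x. c * F x \<partial>\<eta>) = 1"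
        using that by (auto simp: space_restrict_space \<Omega>_def)
      note [measurable_cong] = \<M>_sets[OF \<eta>(1)]
      have "emeasure (?L \<eta>) (space (?L \<eta>)) = (\<integral>\<^sup>+x. c * F x * indicator (space \<eta>) x \<partial>\<eta>)"
        by (simp add: emeasure_density)
      also have "\<dots> = (\<integral>\<^sup>+x. c * F x \<partial>\<eta>)" by (rule nn_integral_cong) simp
      finally show "emeasure (?L \<eta>) (space (?L \<eta>)) = 1" using \<eta>(2) by simp
    qed
    then show "prob_space (?L \<eta>)" if "\<eta> \<in> space (restrict_space ?\<M> \<Omega>)" for \<eta>
      using that .
    show "?L \<in> restrict_space ?\<M> \<Omega> \<rightarrow>\<^sub>M subprob_algebra X"
    proof (rule measurable_subprob_algebra)
      fix B assume [measurable]: "B \<in> sets X"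
      have "(\<lambda>\<eta>. \<integral>\<^sup>+x. c * F x * indicator B x \<partial>\<eta>) \<in> borel_measurable (restrict_space ?\<M> \<Omega>)"
        by (intro measurable_restrict_space1 nn_integral_measurable_sigma_finite_algebra) measurable
      moreover have "emeasure (?L \<eta>) B = (\<integral>\<^sup>+x. c * F x * indicator B x \<partial>\<eta>)"
        if "\<eta> \<in> space (restrict_space ?\<M> \<Omega>)" for \<eta>
      proof -
        have "sets \<eta> = sets X" using that by (intro \<M>_sets) (simp add: space_restrict_space \<Omega>_def)
        note [measurable_cong] = this
        show ?thesis by (rule emeasure_density) measurable
      qed
      ultimately show "(\<lambda>\<eta>. emeasure (?L \<eta>) B) \<in> borel_measurable (restrict_space ?\<M> \<Omega>)"
        by (subst measurable_cong)
    next
      fix \<eta> assume \<eta>: "\<eta> \<in> space (restrict_space ?\<M> \<Omega>)"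
      show "subprob_space (?L \<eta>)"
        by (rule prob_space_imp_subprob_space[OF prob[OF \<eta>]])
      show "sets (?L \<eta>) = sets X"
        using \<eta> \<M>_sets[of \<eta>] by (auto simp: space_restrict_space \<Omega>_def)
    qed
  qed
  \<comment> \<open>The set of all invariant ergodic measures need not be measurable; \<open>E\<close> is a measurable part of it
    that carries \<open>\<nu>'\<close>.\<close>
  define E where "E = {\<eta>\<in>\<Omega>. ?L \<eta> \<in> S}"
  have E: "E \<in> sets ?\<M>"
  proof -
    have "?L -` S \<inter> space (restrict_space ?\<M> \<Omega>) \<in> sets (restrict_space ?\<M> \<Omega>)"
      by (rule measurable_sets[OF L S])
    moreover have "?L -` S \<inter> space (restrict_space ?\<M> \<Omega>) = E"
      using sets.sets_into_space[OF \<Omega>] by (auto simp: E_def space_restrict_space)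
    ultimately show ?thesis by (simp add: sets_restrict_space_iff)
  qed
  have "AE x in P. ?D (\<kappa> x) \<in> E"
    using \<kappa>S AE_space
  proof eventually_elim
    case (elim x)
    then have x: "x \<in> space X" by (simp add: spP)
    interpret \<kappa>: prob_space "\<kappa> x" by (rule \<kappa>_prob[OF x])
    note [measurable_cong] = \<kappa>_sets[OF x]
    have "(\<integral>\<^sup>+y. c * F y \<partial>?D (\<kappa> x)) = (\<integral>\<^sup>+y. c0 / F y * (c * F y) \<partial>\<kappa> x)"
      by (rule nn_integral_density) measurable
    also have "\<dots> = (\<integral>\<^sup>+y. 1 \<partial>\<kappa> x)"
      by (rule nn_integral_cong) (simp add: cF sets_eq_imp_space_eq[OF \<kappa>_sets[OF x]])
    finally have "(\<integral>\<^sup>+y. c * F y \<partial>?D (\<kappa> x)) = 1" by (simp add: \<kappa>.emeasure_space_1)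
    then show ?case
      using elim measurable_space[OF k, of x] by (simp add: E_def \<Omega>_def DL(1)[OF \<kappa>_sets[OF x]])
  qed
  then have "AE \<eta> in \<nu>'. \<eta> \<in> E"
    unfolding \<nu>'_def using E by (subst AE_distr_iff[OF k]) auto
  then have AE: "AE \<eta> in \<nu>'. invariant_measure G T \<eta> \<and> ergodic_measure G T \<eta>"
  proof eventually_elim
    case (elim \<eta>)
    then have S: "?L \<eta> \<in> S" and \<eta>: "sets \<eta> = sets X" by (auto simp: E_def \<Omega>_def \<M>_sets)
    have "invariant_measure G T (?D (?L \<eta>)) \<and> ergodic_measure G T (?D (?L \<eta>))"
      by (intro conjI gibbs_imp_invariant gibbs_trivial_imp_ergodic S_gibbs S_triv S)
    then show ?case by (simp only: DL(2)[OF \<eta>])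
  qed
  \<comment> \<open>Applying the disintegration to \<open>c0 / F\<close> times the indicator leaves
    the product of the two densities, which is 1. No finiteness of \<open>emeasure \<nu> B\<close>
    enters.\<close>
  have dec: "emeasure \<nu> B = (\<integral>\<^sup>+\<eta>. emeasure \<eta> B \<partial>\<nu>')" if [measurable]: "B \<in> sets X" for B
  proof -
    have "(\<integral>\<^sup>+\<eta>. emeasure \<eta> B \<partial>\<nu>') = (\<integral>\<^sup>+x. emeasure (?D (\<kappa> x)) B \<partial>P)"
      unfolding \<nu>'_def by (rule nn_integral_distr[OF k]) measurable
    also have "\<dots> = (\<integral>\<^sup>+x. (\<integral>\<^sup>+y. c0 / F y * indicator B y \<partial>\<kappa> x) \<partial>P)"
      by (rule nn_integral_cong) (simp add: D_em spP)
    also have "\<dots> = (\<integral>\<^sup>+y. c0 / F y * indicator B y \<partial>P)"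
      by (rule dis) measurable
    also have "\<dots> = (\<integral>\<^sup>+y. c * F y * (c0 / F y * indicator B y) \<partial>\<nu>)"
      unfolding P_def by (rule nn_integral_density) measurable
    also have "\<dots> = (\<integral>\<^sup>+y. indicator B y \<partial>\<nu>)"
      by (rule nn_integral_cong) (simp only: mult.assoc[symmetric] cF sp mult_1)
    finally show ?thesis by (simp add: s)
  qed
  interpret \<nu>': prob_space \<nu>'
    unfolding \<nu>'_def by (rule P.prob_space_distr[OF k])
  have "ergodic_decomposition G X T \<nu> \<nu>'"
    unfolding ergodic_decomposition_def
  proof (intro conjI ballI impI)
    show "sets \<nu>' = sets ?\<M>" by (simp add: \<nu>'_def)
    show "sigma_finite_measure \<nu>'" ..
    show "AE \<eta> in \<nu>'. invariant_measure G T \<eta> \<and> ergodic_measure G T \<eta>" by (rule AE)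
    fix B assume B: "B \<in> sets X" "emeasure \<nu> B < \<infinity>"
    show "(\<lambda>\<eta>. emeasure \<eta> B) \<in> borel_measurable \<nu>'"
      using emeasure_measurable_sigma_finite_algebra[OF B(1)] by (simp add: \<nu>'_def)
    show "emeasure \<nu> B = (\<integral>\<^sup>+\<eta>. emeasure \<eta> B \<partial>\<nu>')" by (rule dec[OF B(1)])
    with B(2) show "(\<integral>\<^sup>+\<eta>. emeasure \<eta> B \<partial>\<nu>') < \<infinity>" by (simp only:)
  qed
  then show ?thesis by blast
qed

end

theorem corollary2:
  fixes G :: "('g, 'm) monoid_scheme"
    and K :: "nat \<Rightarrow> 'g set" and \<tau> :: "nat \<Rightarrow> 'g topology"
    and X \<nu> :: "'a measure" and T :: "'g \<Rightarrow> 'a \<Rightarrow> 'a"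
  assumes "inductively_compact_group G K \<tau>"
    and "standard_borel_space X"
    and "measurable_action G \<tau> X T"
    and "sets \<nu> = sets X" and "sigma_finite_measure \<nu>"
    and "invariant_measure G T \<nu>"
    and "\<exists>f :: 'a \<Rightarrow> real. f \<in> borel_measurable X \<and> integrable \<nu> f \<and>
           (\<forall>x\<in>space X. f x > 0) \<and> fibrewise_continuous \<tau> X T f"
  shows "\<exists>\<nu>'. ergodic_decomposition G X T \<nu> \<nu>'"
proof -
  obtain f :: "'a \<Rightarrow> real" where f': "f \<in> borel_measurable X" "integrable \<nu> f"
    "\<And>x. x \<in> space X \<Longrightarrow> 0 < f x" "fibrewise_continuous \<tau> X T f"
    using assms(7) by blast
  interpret inductively_compact_group G K \<tau> by fact
  interpret inductively_compact_action G K \<tau> X T f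
    by unfold_locales (use assms f' in auto)
  show ?thesis
    by (rule ergodic_decomposition_exists[OF assms(2,4,5,6) f'(2)])
qed

end
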